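(* For $T\ge1$ let $p=p(T)\to\infty$ as $T\to\infty$, let $s_i=(i-1)/p$, $1\leq i\leq p$, be equidistant sampling points, and let $Y_t=(X_t(s_1),\ldots,X_t(s_p))^\prime+U_t$, $1\leq t\leq T$, with $U_t=(U_{t1},\ldots,U_{tp})^\prime$. Assume that conditions (N), (S)(a) and (S)(b) listed in the context hold, and that $$\sup_{s}E|X_1(s+h)-X_1(s)|^2=O(h)\qquad(h\to0),$$ the supremum being over $s$ with $s,s+h\in[0,1]$. Let $\lambda_1\geq\lambda_2\geq\cdots\ge 0$ and $\varphi_1,\varphi_2,\ldots$ be the eigenvalues and corresponding orthonormal eigenfunctions of the covariance operator of $X_1$, and let $\tilde\varphi_\ell$ be the step-function estimator of $\varphi_\ell$ defined in the context. Then for each $\ell\geq1$ such that $\alpha_\ell=\min\{\lambda_\ell-\lambda_{\ell+1},\lambda_{\ell-1}-\lambda_\ell\}\neq0$ (with $\lambda_0:=+\infty$), we have, as $T\to\infty$, $$\|\varphi_\ell-\tilde\varphi_\ell\|=O_P\left(\frac{1}{\sqrt p}+\frac{1}{\sqrt T}\right).$$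
   Context: $(X_t)_{t\ge1}$ is a stationary sequence of random curves $X_t=(X_t(s)\colon s\in[0,1])$ with values in $H=L^2([0,1])$, with norm $\|f\|^2=\int_0^1f^2(s)\,ds$ and inner product $\langle\cdot,\cdot\rangle$. The covariance operator is the integral operator with kernel $\Gamma^X(s,s')=\mathrm{Cov}(X_t(s),X_t(s'))$. Estimator. Let $Y=(Y_1,\ldots,Y_T)\in\mathbb{R}^{p\times T}$ and let $\hat\psi_\ell^Y\in\mathbb{R}^p$ be a unit eigenvector associated with the $\ell$-th largest eigenvalue of $\hat\Sigma^Y=T^{-1}YY^\prime\in\mathbb{R}^{p\times p}$. With $s_{p+1}:=1$, put $\tilde\varphi_\ell(s)=\sqrt p\,[\hat\psi_\ell^Y]_i$ for $s\in[s_i,s_{i+1})$, where $[v]_i$ is the $i$-th component of $v$. The sign is chosen so that $\langle\varphi_\ell,\tilde\varphi_\ell\rangle\geq0$. Definition ($L^4$-$m$-approximability). The sequence $(X_t)$ with $E\|X_t\|^4<\infty$ is $L^4$-$m$-approximable if $X_t=f(\varepsilon_t,\varepsilon_{t-1},\ldots)$ for i.i.d. elements $(\varepsilon_i)$ of some measurable space $S$ and a measurable function $f\colon S^\infty\to H$, and if, with $(\varepsilon_i')$ an independent copy of $(\varepsilon_i)$ and $X_t^{(m)}=f(\varepsilon_t,\ldots,\varepsilon_{t-m+1},\varepsilon'_{t-m},\varepsilon'_{t-m-1},\ldots)$, one has $\sum_{m\geq1}\big(E\|X_m-X_m^{(m)}\|^4\big)^{1/4}<\infty$. (N) The noise vectors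 $(U_t)$ are i.i.d. in $t$, have zero mean and are independent of the signals $(X_t)$. The processes $(U_{ti}\colon1\leq i\leq p)$ are stationary and Gaussian with covariance function $\gamma^U(h)=\mathrm{Cov}(U_{t,i+h},U_{ti})$ such that $\sum_{h\in\mathbb{Z}}|\gamma^U(h)|\leq C_U<\infty$. (S) (a) The process $(X_t\colon t\geq1)$ has zero mean and is $L^4$-$m$-approximable. (b) $\sup_{s\in[0,1]}EX_1^4(s)\leq C_X<\infty$ and the covariance kernel $\Gamma^X$ is continuous. *)

theory Defs
  imports "HOL-Probability.Probability" "Jordan_Normal_Form.Char_Poly"
begin

text \<open>The component notation \<open>$\<close> below is that of \<open>Jordan_Normal_Form\<close>, whose matrices and
  vectors have dimensions that are terms (here \<open>p\<close> and \<open>T\<close> vary).\<close>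

unbundle no vec_syntax

section \<open>The function space\<close>

abbreviation leb01 :: "real measure" where
  "leb01 \<equiv> restrict_space lborel {0..1}"

text \<open>Elements of \<open>L\<^sup>2([0,1])\<close> are represented by square integrable functions; equality of
  elements is equality almost everywhere with respect to \<open>leb01\<close>.\<close>

definition L2 :: "(real \<Rightarrow> real) set" where
  "L2 = {f \<in> borel_measurable leb01. integrable leb01 (\<lambda>s. (f s)\<^sup>2)}"

definition L2_inner :: "(real \<Rightarrow> real) \<Rightarrow> (real \<Rightarrow> real) \<Rightarrow> real" where
  "L2_inner f g = (\<integral>s. f s * g s \<partial>leb01)"

definition L2_norm :: "(real \<Rightarrow> real) \<Rightarrow> real" where
  "L2_norm f = sqrt (\<integral>s. (f s)\<^sup>2 \<partial>leb01)"

text \<open>The Borel sigma-algebra of the seminormed space \<open>L2\<close>. Open sets are closed under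
  a.e. equality, so this is the Borel sigma-algebra of the Hilbert space.\<close>

definition L2_borel :: "(real \<Rightarrow> real) measure" where
  "L2_borel = sigma L2
     {G. G \<subseteq> L2 \<and> (\<forall>f\<in>G. \<exists>e>0. \<forall>g\<in>L2. L2_norm (\<lambda>s. g s - f s) < e \<longrightarrow> g \<in> G)}"

section \<open>Random curves\<close>

text \<open>Joint measurability links the point values \<open>X\<^sub>t(s)\<close>, which are sampled, to the
  \<open>L\<^sup>2\<close>-valued random element \<open>X\<^sub>t\<close>.\<close>

definition random_curve :: "'w measure \<Rightarrow> ('w \<Rightarrow> real \<Rightarrow> real) \<Rightarrow> bool" where
  "random_curve M Z \<longleftrightarrow>
     (\<lambda>(\<omega>, s). Z \<omega> s) \<in> borel_measurable (M \<Otimes>\<^sub>M leb01) \<and> (\<forall>\<omega>\<in>space M. Z \<omega> \<in> L2)"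

abbreviation curve_index :: "(nat \<times> real) set" where
  "curve_index \<equiv> {1..} \<times> {0..1}"

definition curve_values :: "(nat \<Rightarrow> 'w \<Rightarrow> real \<Rightarrow> real) \<Rightarrow> 'w \<Rightarrow> nat \<times> real \<Rightarrow> real" where
  "curve_values X \<omega> = (\<lambda>(t, s)\<in>curve_index. X t \<omega> s)"

text \<open>Strict stationarity in \<open>t\<close>, in the sense of all finite-dimensional distributions of
  the point values; stationarity of the \<open>L\<^sup>2\<close> classes alone would say nothing about sampled
  values.\<close>

definition stationary_curves :: "'w measure \<Rightarrow> (nat \<Rightarrow> 'w \<Rightarrow> real \<Rightarrow> real) \<Rightarrow> bool" where
  "stationary_curves M X \<longleftrightarrow>
     (\<forall>h. distr M (PiM curve_index (\<lambda>_. borel)) (curve_values (\<lambda>t. X (t + h)))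
        = distr M (PiM curve_index (\<lambda>_. borel)) (curve_values X))"

definition cov :: "'w measure \<Rightarrow> ('w \<Rightarrow> real) \<Rightarrow> ('w \<Rightarrow> real) \<Rightarrow> real" where
  "cov M V W = (\<integral>\<omega>. (V \<omega> - (\<integral>\<xi>. V \<xi> \<partial>M)) * (W \<omega> - (\<integral>\<xi>. W \<xi> \<partial>M)) \<partial>M)"

definition cov_kernel :: "'w measure \<Rightarrow> ('w \<Rightarrow> real \<Rightarrow> real) \<Rightarrow> real \<Rightarrow> real \<Rightarrow> real" where
  "cov_kernel M Z s s' = cov M (\<lambda>\<omega>. Z \<omega> s) (\<lambda>\<omega>. Z \<omega> s')"

definition integral_operator :: "(real \<Rightarrow> real \<Rightarrow> real) \<Rightarrow> (real \<Rightarrow> real) \<Rightarrow> real \<Rightarrow> real" where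
  "integral_operator K g s = (\<integral>s'. K s s' * g s' \<partial>leb01)"

text \<open>\<open>lam 1 \<ge> lam 2 \<ge> \<dots> \<ge> 0\<close> are the eigenvalues of the integral operator with kernel \<open>K\<close>, with
  orthonormal eigenfunctions \<open>phi 1, phi 2, \<dots>\<close>; index \<open>0\<close> is not used. The last clause says that
  no nonzero eigenvalue is missing or listed with too small a multiplicity. The \<open>phi k\<close> need not
  span \<open>L2\<close>: if all \<open>lam k\<close> are positive, the kernel of the operator is not covered.\<close>

definition eigensystem ::
  "(real \<Rightarrow> real \<Rightarrow> real) \<Rightarrow> (nat \<Rightarrow> real) \<Rightarrow> (nat \<Rightarrow> real \<Rightarrow> real) \<Rightarrow> bool" where
  "eigensystem K lam phi \<longleftrightarrow>
     (\<forall>k\<ge>1. 0 \<le> lam k \<and> lam (Suc k) \<le> lam k) \<and>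
     (\<forall>k\<ge>1. phi k \<in> L2 \<and> (AE s in leb01. integral_operator K (phi k) s = lam k * phi k s)) \<and>
     (\<forall>j\<ge>1. \<forall>k\<ge>1. L2_inner (phi j) (phi k) = (if j = k then 1 else 0)) \<and>
     (\<forall>\<mu> g. \<mu> \<noteq> 0 \<and> g \<in> L2 \<and> (AE s in leb01. integral_operator K g s = \<mu> * g s) \<and>
        (\<forall>k\<ge>1. L2_inner g (phi k) = 0) \<longrightarrow> (AE s in leb01. g s = 0))"

text \<open>The convention \<open>lam 0 = \<infinity>\<close> removes the second term of the minimum for \<open>l = 1\<close>.\<close>

definition eigengap :: "(nat \<Rightarrow> real) \<Rightarrow> nat \<Rightarrow> real" where
  "eigengap lam l =
     (if l = 1 then lam l - lam (l + 1) else min (lam l - lam (l + 1)) (lam (l - 1) - lam l))"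

section \<open>Conditions on the signal\<close>

text \<open>The independent copy of \<open>eps\<close> lives on the second factor of \<open>M \<Otimes>\<^sub>M M\<close>, so \<open>M\<close> itself need not
  carry one: \<open>coupled eps t m (\<omega>, \<omega>')\<close> is the sequence
  \<open>\<epsilon>\<^sub>t, \<dots>, \<epsilon>\<^bsub>t-m+1\<^esub>, \<epsilon>'\<^bsub>t-m\<^esub>, \<epsilon>'\<^bsub>t-m-1\<^esub>, \<dots>\<close>.\<close>

definition coupled :: "(int \<Rightarrow> 'w \<Rightarrow> 's) \<Rightarrow> nat \<Rightarrow> nat \<Rightarrow> 'w \<times> 'w \<Rightarrow> nat \<Rightarrow> 's" where
  "coupled eps t m = (\<lambda>(\<omega>, \<omega>') k. eps (int t - int k) (if k < m then \<omega> else \<omega>'))"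

definition L4_m_approximable ::
  "'w measure \<Rightarrow> 's measure \<Rightarrow> (int \<Rightarrow> 'w \<Rightarrow> 's) \<Rightarrow> ((nat \<Rightarrow> 's) \<Rightarrow> real \<Rightarrow> real)
     \<Rightarrow> (nat \<Rightarrow> 'w \<Rightarrow> real \<Rightarrow> real) \<Rightarrow> bool" where
  "L4_m_approximable M S eps f X \<longleftrightarrow>
     (\<forall>t\<ge>1. integrable M (\<lambda>\<omega>. L2_norm (X t \<omega>) ^ 4)) \<and>
     prob_space.indep_vars M (\<lambda>_. S) eps UNIV \<and>
     (\<forall>i. distr M S (eps i) = distr M S (eps 0)) \<and>
     f \<in> measurable (PiM UNIV (\<lambda>_. S)) L2_borel \<and>
     (\<forall>t\<ge>1. AE \<omega> in M. AE s in leb01. X t \<omega> s = f (\<lambda>k. eps (int t - int k) \<omega>) s) \<and>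
     (let d = (\<lambda>m z. L2_norm (\<lambda>s. X m (fst z) s - f (coupled eps m m z) s) ^ 4)
      in (\<forall>m\<ge>1. integrable (M \<Otimes>\<^sub>M M) (d m)) \<and>
         summable (\<lambda>n. (\<integral>z. d (Suc n) z \<partial>(M \<Otimes>\<^sub>M M)) powr (1 / 4)))"

definition signal_cond_a ::
  "'w measure \<Rightarrow> 's measure \<Rightarrow> (int \<Rightarrow> 'w \<Rightarrow> 's) \<Rightarrow> ((nat \<Rightarrow> 's) \<Rightarrow> real \<Rightarrow> real)
     \<Rightarrow> (nat \<Rightarrow> 'w \<Rightarrow> real \<Rightarrow> real) \<Rightarrow> bool" where
  "signal_cond_a M S eps f X \<longleftrightarrow>
     (\<forall>t\<ge>1. \<forall>s\<in>{0..1}. integrable M (\<lambda>\<omega>. X t \<omega> s) \<and> (\<integral>\<omega>. X t \<omega> s \<partial>M) = 0) \<and>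
     L4_m_approximable M S eps f X"

definition signal_cond_b ::
  "'w measure \<Rightarrow> (nat \<Rightarrow> 'w \<Rightarrow> real \<Rightarrow> real) \<Rightarrow> real \<Rightarrow> bool" where
  "signal_cond_b M X C \<longleftrightarrow>
     (\<forall>s\<in>{0..1}. integrable M (\<lambda>\<omega>. X 1 \<omega> s ^ 4) \<and> (\<integral>\<omega>. X 1 \<omega> s ^ 4 \<partial>M) \<le> C) \<and>
     continuous_on ({0..1} \<times> {0..1}) (\<lambda>(s, s'). cov_kernel M (X 1) s s')"

section \<open>Conditions on the noise\<close>

text \<open>Degenerate (constant) normal variables are included.\<close>

definition gaussian :: "'w measure \<Rightarrow> ('w \<Rightarrow> real) \<Rightarrow> bool" where
  "gaussian M Z \<longleftrightarrow> Z \<in> borel_measurable M \<and>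
     (\<exists>\<mu> \<sigma>. if \<sigma> > 0 then distributed M lborel Z (normal_density \<mu> \<sigma>) else (AE \<omega> in M. Z \<omega> = \<mu>))"

definition gaussian_process :: "'w measure \<Rightarrow> 'i set \<Rightarrow> ('i \<Rightarrow> 'w \<Rightarrow> real) \<Rightarrow> bool" where
  "gaussian_process M I V \<longleftrightarrow>
     (\<forall>J a. finite J \<and> J \<subseteq> I \<longrightarrow> gaussian M (\<lambda>\<omega>. \<Sum>i\<in>J. a i * V i \<omega>))"

text \<open>The condition for one sample size \<open>T\<close> with \<open>p\<close> sampling points; \<open>U t \<omega> i\<close> is the noise
  variable \<open>U\<^bsub>ti\<^esub>\<close>, \<open>1 \<le> t \<le> T\<close>, \<open>1 \<le> i \<le> p\<close>. For a centred Gaussian process, stationarity in \<open>i\<close> is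
  the statement that covariances depend on the lag only. Independence from the signals is
  independence of the generated sigma-algebras.\<close>

definition noise_cond ::
  "'w measure \<Rightarrow> (nat \<Rightarrow> 'w \<Rightarrow> real \<Rightarrow> real) \<Rightarrow> nat \<Rightarrow> nat \<Rightarrow> (nat \<Rightarrow> 'w \<Rightarrow> nat \<Rightarrow> real)
     \<Rightarrow> (int \<Rightarrow> real) \<Rightarrow> real \<Rightarrow> bool" where
  "noise_cond M X T p U \<gamma> C \<longleftrightarrow>
     prob_space.indep_vars M (\<lambda>_. PiM {1..p} (\<lambda>_. borel)) (\<lambda>t \<omega>. restrict (U t \<omega>) {1..p}) {1..T} \<and>
     (\<forall>t\<in>{1..T}. distr M (PiM {1..p} (\<lambda>_. borel)) (\<lambda>\<omega>. restrict (U t \<omega>) {1..p})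
               = distr M (PiM {1..p} (\<lambda>_. borel)) (\<lambda>\<omega>. restrict (U 1 \<omega>) {1..p})) \<and>
     prob_space.indep_set M
       (sets (vimage_algebra (space M) (curve_values X) (PiM curve_index (\<lambda>_. borel))))
       (sets (vimage_algebra (space M) (\<lambda>\<omega>. \<lambda>(t, i)\<in>{1..T} \<times> {1..p}. U t \<omega> i)
                (PiM ({1..T} \<times> {1..p}) (\<lambda>_. borel)))) \<and>
     (\<forall>t\<in>{1..T}.
        gaussian_process M {1..p} (\<lambda>i \<omega>. U t \<omega> i) \<and>
        (\<forall>i\<in>{1..p}. (\<integral>\<omega>. U t \<omega> i \<partial>M) = 0) \<and>
        (\<forall>i\<in>{1..p}. \<forall>j\<in>{1..p}.
           cov M (\<lambda>\<omega>. U t \<omega> i) (\<lambda>\<omega>. U t \<omega> j) = \<gamma> (int i - int j))) \<and>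
     (\<lambda>h. \<bar>\<gamma> h\<bar>) summable_on UNIV \<and> (\<Sum>\<^sub>\<infinity>h. \<bar>\<gamma> h\<bar>) \<le> C"

section \<open>The estimator\<close>

text \<open>Entry \<open>(i, j)\<close> (counted from 0) is \<open>X\<^bsub>j+1\<^esub>(s\<^bsub>i+1\<^esub>) + U\<^bsub>j+1,i+1\<^esub>\<close>, where \<open>s\<^bsub>i+1\<^esub> = i/p\<close>.\<close>

definition data_matrix ::
  "(nat \<Rightarrow> 'w \<Rightarrow> real \<Rightarrow> real) \<Rightarrow> nat \<Rightarrow> nat \<Rightarrow> (nat \<Rightarrow> 'w \<Rightarrow> nat \<Rightarrow> real) \<Rightarrow> 'w \<Rightarrow> real mat" where
  "data_matrix X T p U \<omega> =
     mat p T (\<lambda>(i, j). X (j + 1) \<omega> (real i / real p) + U (j + 1) \<omega> (i + 1))"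

definition sample_cov :: "nat \<Rightarrow> real mat \<Rightarrow> real mat" where
  "sample_cov T Y = (1 / real T) \<cdot>\<^sub>m (Y * transpose_mat Y)"

text \<open>\<open>\<mu>\<close> is the \<open>l\<close>-th largest eigenvalue, \<open>1 \<le> l\<close>, counted with algebraic multiplicity.\<close>

definition nth_largest_eigenvalue :: "real mat \<Rightarrow> nat \<Rightarrow> real \<Rightarrow> bool" where
  "nth_largest_eigenvalue A l \<mu> \<longleftrightarrow>
     (\<exists>es. char_poly A = (\<Prod>e\<leftarrow>es. [:- e, 1:]) \<and> sorted_wrt (\<ge>) es \<and>
           1 \<le> l \<and> l \<le> length es \<and> \<mu> = es ! (l - 1))"

definition unit_eigenvector :: "real mat \<Rightarrow> nat \<Rightarrow> real Matrix.vec \<Rightarrow> bool" where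
  "unit_eigenvector A l v \<longleftrightarrow>
     (\<exists>\<mu>. nth_largest_eigenvalue A l \<mu> \<and> eigenvector A v \<mu>) \<and> (\<Sum>i<dim_vec v. (v $ i)\<^sup>2) = 1"

definition step_function :: "nat \<Rightarrow> real Matrix.vec \<Rightarrow> real \<Rightarrow> real" where
  "step_function p v s =
     (\<Sum>i<p. sqrt (real p) * (v $ i) * indicator {real i / real p ..< (real i + 1) / real p} s)"

section \<open>Stochastic boundedness\<close>

text \<open>\<open>Z T = O\<^sub>P(r T)\<close> as \<open>T \<rightarrow> \<infinity>\<close>, for random variables \<open>Z T\<close> on \<open>M\<close>.\<close>

definition bigO_P :: "'w measure \<Rightarrow> (nat \<Rightarrow> 'w \<Rightarrow> real) \<Rightarrow> (nat \<Rightarrow> real) \<Rightarrow> bool" where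
  "bigO_P M Z r \<longleftrightarrow>
     (\<forall>e>0. \<exists>C>0. \<forall>\<^sub>F T in sequentially. measure M {\<omega> \<in> space M. \<bar>Z T \<omega>\<bar> > C * r T} < e)"

end

theory Submission
  imports Defs "HOL-Complex_Analysis.Great_Picard" "Jordan_Normal_Form.Schur_Decomposition"
begin

text \<open>Step functions embed the eigenvectors of \<open>\<Sigma>\<^sup>Y / p\<close> isometrically into \<open>L\<^sup>2\<close>, as
  eigenfunctions of a finite-rank operator, so the Davis-Kahan inequality bounds the error by
  \<open>2 \<surd>2 / \<alpha>\<^sub>l\<close> times the distance of that operator to the covariance operator. This
  distance is split into three parts. The empirical covariance operator of the fully observed curves
  is at Hilbert-Schmidt distance \<open>O(T\<^bsup>-1/2\<^esup>)\<close> in mean square: replacing \<open>X\<^sub>t\<close> by its coupled copy,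
  which is independent of \<open>X\<^sub>u\<close> for \<open>u < t\<close>, costs a summable amount. Discretisation costs
  \<open>O(p\<^bsup>-1/2\<^esup>)\<close> by the regularity of the increments. The cross terms are uncorrelated in \<open>t\<close>, and
  the noise covariance matrix, divided by \<open>p\<close>, has squared Hilbert-Schmidt norm \<open>O(1/p)\<close> because its
  autocovariances are summable. Markov's inequality concludes.\<close>

section \<open>Perturbation of eigenvectors\<close>

text \<open>The estimate is made outcome by outcome: the quadratic forms of the two operators differ
  by at most \<open>error_bound\<close>, a random variable whose expectation is explicit, and
  Markov's inequality is applied to it. Hilbert-Schmidt distances enter through square roots, and
  these are linearised by \<open>sqrt q \<le> (q / rate + rate) / 2\<close>; first moments of the
  squared distances then suffice, and since those are of order \<open>rate\<^sup>2\<close>, the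
  result is of order \<open>rate\<close>. A curve has two faces. Sampling, increments and
  stationarity concern its point values, whereas the dependence condition sees only its class in the
  Hilbert space. Joint measurability and Fubini's theorem connect the two. The classes form a type
  \<open>l2\<close> with a countable base, so that distances and inner products of random classes
  are measurable. Matrices of growing size are compared with a fixed operator by letting them act on
  step functions. The scale 1/p turns averages over grid points into integrals; it is also what
  makes the noise covariance, whose entries do not shrink, negligible at the rate
  \<open>1 / sqrt p\<close>.\<close>

definition orthonormal_on :: "nat set \<Rightarrow> (nat \<Rightarrow> 'a::real_inner) \<Rightarrow> bool" where
  "orthonormal_on I e \<longleftrightarrow> (\<forall>i\<in>I. \<forall>j\<in>I. inner (e i) (e j) = (if i = j then 1 else 0))"

lemma orthonormal_on_subset: "orthonormal_on I e \<Longrightarrow> J \<subseteq> I \<Longrightarrow> orthonormal_on J e"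
  unfolding orthonormal_on_def by blast

lemma orthonormal_onD:
  "orthonormal_on I e \<Longrightarrow> i \<in> I \<Longrightarrow> j \<in> I \<Longrightarrow> inner (e i) (e j) = (if i = j then 1 else 0)"
  unfolding orthonormal_on_def by blast

lemma inner_orthonormal_sum:
  assumes "orthonormal_on I e" "finite I" "j \<in> I"
  shows "inner (\<Sum>i\<in>I. c i *\<^sub>R e i) (e j) = c j"
proof -
  have "inner (\<Sum>i\<in>I. c i *\<^sub>R e i) (e j) = (\<Sum>i\<in>I. c i * (if i = j then 1 else 0))"
    unfolding inner_sum_left using assms by (intro sum.cong) (auto simp: orthonormal_onD)
  also have "\<dots> = (\<Sum>i\<in>I. if i = j then c i else 0)"
    by (intro sum.cong) auto
  finally show ?thesis using assms by simp
qed

lemma inner_orthonormal_sums: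
  assumes "orthonormal_on I e" "finite I"
  shows "inner (\<Sum>i\<in>I. c i *\<^sub>R e i) (\<Sum>i\<in>I. d i *\<^sub>R e i) = (\<Sum>i\<in>I. c i * d i)"
proof -
  have "inner (\<Sum>i\<in>I. c i *\<^sub>R e i) (\<Sum>j\<in>I. d j *\<^sub>R e j)
      = (\<Sum>j\<in>I. d j * inner (\<Sum>i\<in>I. c i *\<^sub>R e i) (e j))"
    by (simp add: inner_sum_right)
  also have "\<dots> = (\<Sum>j\<in>I. c j * d j)"
    by (intro sum.cong) (auto simp: inner_orthonormal_sum[OF assms])
  finally show ?thesis .
qed

lemma orthonormal_decomposition:
  assumes "orthonormal_on I e" "finite I"
  obtains w where "g = (\<Sum>i\<in>I. inner g (e i) *\<^sub>R e i) + w" "\<And>i. i \<in> I \<Longrightarrow> inner w (e i) = 0"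
    "(norm g)\<^sup>2 = (\<Sum>i\<in>I. (inner g (e i))\<^sup>2) + (norm w)\<^sup>2"
proof -
  let ?s = "\<Sum>i\<in>I. inner g (e i) *\<^sub>R e i"
  have orth: "inner (g - ?s) (e i) = 0" if "i \<in> I" for i
    using inner_orthonormal_sum[OF assms that] by (simp add: inner_diff_left)
  have "inner ?s (g - ?s) = 0"
    unfolding inner_sum_left using orth by (intro sum.neutral) (simp add: inner_commute)
  then have "inner (?s + (g - ?s)) (?s + (g - ?s)) = inner ?s ?s + inner (g - ?s) (g - ?s)"
    by (simp only: inner_add_left inner_add_right inner_commute[of "g - ?s" ?s])
  then have "(norm g)\<^sup>2 = (\<Sum>i\<in>I. (inner g (e i))\<^sup>2) + (norm (g - ?s))\<^sup>2"
    unfolding power2_norm_eq_inner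
    by (simp add: inner_orthonormal_sums[OF assms] power2_eq_square)
  with orth show thesis by (intro that[of "g - ?s"]) auto
qed

text \<open>A zero row completes the n by n + 1 coefficient scheme to a square matrix, which is then
  singular.\<close>

lemma underdetermined_system:
  fixes a :: "nat \<Rightarrow> nat \<Rightarrow> real"
  obtains c where "\<exists>k\<le>n. c k \<noteq> 0" "\<And>j. j < n \<Longrightarrow> (\<Sum>k\<le>n. a j k * c k) = 0"
proof -
  define A where "A = mat (Suc n) (Suc n) (\<lambda>(j, k). if j < n then a j k else 0)"
  have A: "A \<in> carrier_mat (Suc n) (Suc n)" by (simp add: A_def)
  have "A = mat\<^sub>r (Suc n) (Suc n) (\<lambda>i. if i = n then 0\<^sub>v (Suc n) else row A i)"
    by (rule eq_matI) (auto simp: A_def)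
  also have "det \<dots> = 0"
    by (rule det_row_0) (auto simp: A_def)
  finally have "det A = 0" .
  then obtain v where v: "v \<in> carrier_vec (Suc n)" "v \<noteq> 0\<^sub>v (Suc n)" "A *\<^sub>v v = 0\<^sub>v (Suc n)"
    using det_0_iff_vec_prod_zero_field[OF A] by blast
  show thesis
  proof
    show "\<exists>k\<le>n. v $ k \<noteq> 0"
      using v(1,2) by (metis carrier_vecD eq_vecI index_zero_vec less_Suc_eq_le)
    show "(\<Sum>k\<le>n. a j k * v $ k) = 0" if "j < n" for j
    proof -
      have "(A *\<^sub>v v) $ j = (\<Sum>k<Suc n. a j k * v $ k)"
        using that v(1) by (auto simp: A_def scalar_prod_def atLeast0LessThan intro!: sum.cong)
      then show ?thesis using v(3) that by (simp add: lessThan_Suc_atMost)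
    qed
  qed
qed

text \<open>The span of the l vectors \<phi> contains a nonzero \<open>g\<close> orthogonal to the l
  - 1 vectors \<psi>. There the form of \<open>A\<close> is at least \<open>la l\<close> and that of
  \<open>B\<close> at most \<kappa>. Only one-sided bounds are assumed, so the lemma can be applied
  again with the operators exchanged.\<close>

lemma weyl_inequality:
  fixes A B :: "'a::real_inner \<Rightarrow> 'a"
  assumes "linear A" and on: "orthonormal_on {1..l} \<phi>" and "l \<ge> 1"
    and eig: "\<And>k. k \<in> {1..l} \<Longrightarrow> A (\<phi> k) = la k *\<^sub>R \<phi> k"
    and dec: "\<And>k. k \<in> {1..l} \<Longrightarrow> la l \<le> la k"
    and B: "\<And>g. (\<And>j. j \<in> {1..<l} \<Longrightarrow> inner g (\<psi> j) = 0) \<Longrightarrow> inner (B g) g \<le> \<kappa> * (norm g)\<^sup>2"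
    and AB: "\<And>g. inner (A g) g \<le> inner (B g) g + \<delta> * (norm g)\<^sup>2"
  shows "la l \<le> \<kappa> + \<delta>"
proof -
  obtain n where l: "l = Suc n" using \<open>l \<ge> 1\<close> by (cases l) auto
  obtain c where c: "\<exists>k\<le>n. c k \<noteq> 0"
      "\<And>j. j < n \<Longrightarrow> (\<Sum>k\<le>n. inner (\<phi> (Suc k)) (\<psi> (Suc j)) * c k) = 0"
    using underdetermined_system[of n "\<lambda>j k. inner (\<phi> (Suc k)) (\<psi> (Suc j))"] by blast
  \<comment> \<open>The linear system counts its unknowns from 0, the eigenvectors are counted from
    1.\<close>
  define d where "d k = c (k - 1)" for k
  define g where "g = (\<Sum>k\<in>{1..l}. d k *\<^sub>R \<phi> k)"
  have img: "{1..l} = Suc ` {..n}"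
    unfolding l atLeast0AtMost[symmetric] by (simp only: image_Suc_atLeastAtMost One_nat_def)
  have g: "inner g (\<psi> j) = 0" if "j \<in> {1..<l}" for j
  proof -
    have "inner g (\<psi> (Suc (j - 1))) = (\<Sum>k\<le>n. inner (\<phi> (Suc k)) (\<psi> (Suc (j - 1))) * c k)"
      unfolding g_def inner_sum_left img by (subst sum.reindex) (auto simp: d_def mult.commute)
    then show ?thesis using c(2)[of "j - 1"] that l by auto
  qed
  have n2: "(norm g)\<^sup>2 = (\<Sum>k\<in>{1..l}. (d k)\<^sup>2)"
    unfolding power2_norm_eq_inner g_def inner_orthonormal_sums[OF on finite_atLeastAtMost]
    by (simp add: power2_eq_square)
  have "A g = (\<Sum>k\<in>{1..l}. (d k * la k) *\<^sub>R \<phi> k)"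
    unfolding g_def linear_sum[OF \<open>linear A\<close>]
    by (intro sum.cong) (auto simp: linear_scale[OF \<open>linear A\<close>] eig)
  then have "inner (A g) g = (\<Sum>k\<in>{1..l}. d k * la k * d k)"
    by (simp only:) (simp only: g_def inner_orthonormal_sums[OF on finite_atLeastAtMost])
  also have "\<dots> \<ge> (\<Sum>k\<in>{1..l}. la l * (d k)\<^sup>2)"
  proof (rule sum_mono)
    fix k assume "k \<in> {1..l}"
    then have "la l * (d k)\<^sup>2 \<le> la k * (d k)\<^sup>2" by (intro mult_right_mono dec) auto
    then show "la l * (d k)\<^sup>2 \<le> d k * la k * d k" by (simp add: power2_eq_square mult_ac)
  qed
  finally have "la l * (norm g)\<^sup>2 \<le> inner (A g) g"
    by (simp add: n2 sum_distrib_left)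
  also have "\<dots> \<le> (\<kappa> + \<delta>) * (norm g)\<^sup>2"
    using AB[of g] B[OF g] by (simp add: distrib_right)
  finally have *: "la l * (norm g)\<^sup>2 \<le> (\<kappa> + \<delta>) * (norm g)\<^sup>2" .
  obtain k where k: "k \<le> n" "c k \<noteq> 0" using c(1) by blast
  then have "0 < (d (Suc k))\<^sup>2" by (simp add: d_def)
  also have "\<dots> \<le> (\<Sum>k\<in>{1..l}. (d k)\<^sup>2)"
    using k l by (intro member_le_sum) auto
  finally show ?thesis using * unfolding n2[symmetric] by simp
qed

text \<open>Turns a Schur triangularisation into an orthonormal eigenbasis with the eigenvalues in the
  prescribed order.\<close>

lemma triangular_orthonormal_eigenbasis:
  fixes A :: "'a::real_inner \<Rightarrow> 'a"
  assumes "linear A" and sym: "\<And>x y. inner (A x) y = inner x (A y)"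
    and indep: "\<And>j. j \<in> {1..n} \<Longrightarrow> b j \<notin> span (b ` {1..<j})"
    and tri: "\<And>j. j \<in> {1..n} \<Longrightarrow> A (b j) - \<kappa> j *\<^sub>R b j \<in> span (b ` {1..<j})"
  shows "\<exists>q. orthonormal_on {1..n} q \<and> (\<forall>j\<in>{1..n}. A (q j) = \<kappa> j *\<^sub>R q j)
            \<and> span (q ` {1..n}) = span (b ` {1..n})"
  using indep tri
proof (induction n)
  case 0
  then show ?case by (auto simp: orthonormal_on_def)
next
  case (Suc n)
  then obtain q where q: "orthonormal_on {1..n} q" "\<And>j. j \<in> {1..n} \<Longrightarrow> A (q j) = \<kappa> j *\<^sub>R q j"
      "span (q ` {1..n}) = span (b ` {1..n})"
    by fastforce
  let ?N = "Suc n"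
  have iv: "{1..<?N} = {1..n}" by auto
  define s where "s = (\<Sum>i\<in>{1..n}. inner (b ?N) (q i) *\<^sub>R q i)"
  have s: "s \<in> span (q ` {1..n})"
    unfolding s_def by (intro span_sum span_scale span_base) auto
  define r where "r = b ?N - s"
  have r_orth: "inner r (q j) = 0" if "j \<in> {1..n}" for j
    unfolding r_def s_def inner_diff_left using inner_orthonormal_sum[OF q(1) _ that] by simp
  have "b ?N \<notin> span (q ` {1..n})" using Suc.prems(1)[of ?N] q(3) iv by simp
  then have "r \<noteq> 0" using s r_def by auto
  have Aspan: "A x \<in> span (q ` {1..n})" if "x \<in> span (q ` {1..n})" for x
  proof -
    have "A x \<in> span (A ` q ` {1..n})"
      using that linear_span_image[OF \<open>linear A\<close>] by blast
    also have "\<dots> \<subseteq> span (q ` {1..n})"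
    proof (rule span_minimal)
      have "\<kappa> j *\<^sub>R q j \<in> span (q ` {1..n})" if "j \<in> {1..n}" for j
        using that by (intro span_scale span_base) auto
      then show "A ` q ` {1..n} \<subseteq> span (q ` {1..n})" using q(2) by auto
    qed simp
    finally show ?thesis .
  qed
  have z: "A r - \<kappa> ?N *\<^sub>R r \<in> span (q ` {1..n})"
  proof -
    have "A r - \<kappa> ?N *\<^sub>R r = (A (b ?N) - \<kappa> ?N *\<^sub>R b ?N) - A s + \<kappa> ?N *\<^sub>R s"
      by (simp add: r_def linear_diff[OF \<open>linear A\<close>] algebra_simps)
    moreover have "A (b ?N) - \<kappa> ?N *\<^sub>R b ?N \<in> span (q ` {1..n})"
      using Suc.prems(2)[of ?N] q(3) iv by simp
    ultimately show ?thesis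
      using Aspan[OF s] s by (simp add: span_add span_diff span_scale)
  qed
  \<comment> \<open>The defect lies in the span of the earlier \<open>q\<close>. By symmetry of
    \<open>A\<close> it is also orthogonal to each of them, because \<open>r\<close> is and the
    \<open>q j\<close> are eigenvectors. Hence it vanishes.\<close>
  have "real_inner_class.orthogonal (A r - \<kappa> ?N *\<^sub>R r) y" if y: "y \<in> q ` {1..n}" for y
  proof -
    obtain j where j: "j \<in> {1..n}" "y = q j" using y by blast
    show ?thesis
      using r_orth[OF j(1)] q(2)[OF j(1)] sym[of r "q j"]
      by (simp add: j(2) real_inner_class.orthogonal_def inner_diff_left)
  qed
  then have "real_inner_class.orthogonal (A r - \<kappa> ?N *\<^sub>R r) (A r - \<kappa> ?N *\<^sub>R r)"
    using orthogonal_to_span[OF z, of "A r - \<kappa> ?N *\<^sub>R r"] by blast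
  then have eig: "A r = \<kappa> ?N *\<^sub>R r" by (simp add: real_inner_class.orthogonal_def)
  define q' where "q' j = (if j = ?N then (1 / norm r) *\<^sub>R r else q j)" for j
  have on: "orthonormal_on {1..?N} q'"
    unfolding orthonormal_on_def
  proof (intro ballI)
    fix i j assume "i \<in> {1..?N}" "j \<in> {1..?N}"
    then consider "i = ?N" "j = ?N" | "i \<in> {1..n}" "j = ?N" | "i = ?N" "j \<in> {1..n}" | "i \<in> {1..n}" "j \<in> {1..n}"
      by fastforce
    then show "inner (q' i) (q' j) = (if i = j then 1 else 0)"
    proof cases
      case 1
      then show ?thesis using \<open>r \<noteq> 0\<close> by (simp add: q'_def dot_square_norm power2_eq_square)
    next
      case 4
      then show ?thesis using orthonormal_onD[OF q(1)] by (auto simp: q'_def)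
    qed (auto simp: q'_def r_orth inner_commute)
  qed
  have eig': "A (q' j) = \<kappa> j *\<^sub>R q' j" if "j \<in> {1..?N}" for j
    using that q(2)[of j] eig by (auto simp: q'_def linear_scale[OF \<open>linear A\<close>])
  have iv2: "{1..?N} = insert ?N {1..n}" by auto
  have Q: "q' ` {1..?N} = insert ((1 / norm r) *\<^sub>R r) (q ` {1..n})"
    unfolding iv2 by (auto simp: q'_def)
  have Bq: "b ` {1..?N} = insert (b ?N) (b ` {1..n})"
    unfolding iv2 by simp
  have sp: "span (q' ` {1..?N}) = span (b ` {1..?N})"
  proof (rule antisym)
    have sub: "span (b ` {1..n}) \<subseteq> span (b ` {1..?N})" by (intro span_mono) auto
    show "span (q' ` {1..?N}) \<subseteq> span (b ` {1..?N})"
      unfolding Q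
    proof (rule span_minimal)
      have "r \<in> span (b ` {1..?N})"
        unfolding r_def
      proof (rule span_diff)
        show "b ?N \<in> span (b ` {1..?N})" by (rule span_base) simp
        show "s \<in> span (b ` {1..?N})" using s q(3) sub by auto
      qed
      then show "insert ((1 / norm r) *\<^sub>R r) (q ` {1..n}) \<subseteq> span (b ` {1..?N})"
        using q(3) sub span_superset[of "q ` {1..n}"] by (auto intro: span_scale)
    qed auto
    have sub2: "span (q ` {1..n}) \<subseteq> span (q' ` {1..?N})" unfolding Q by (intro span_mono) auto
    show "span (b ` {1..?N}) \<subseteq> span (q' ` {1..?N})"
      unfolding Bq
    proof (rule span_minimal)
      have "r = norm r *\<^sub>R (1 / norm r) *\<^sub>R r" using \<open>r \<noteq> 0\<close> by simp
      also have "\<dots> \<in> span (q' ` {1..?N})" unfolding Q by (intro span_scale span_base) auto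
      finally have "r + s \<in> span (q' ` {1..?N})" using s sub2 by (intro span_add) auto
      then have "b ?N \<in> span (q' ` {1..?N})" by (simp add: r_def)
      then show "insert (b ?N) (b ` {1..n}) \<subseteq> span (q' ` {1..?N})"
        using q(3) sub2 span_superset[of "b ` {1..n}"] by auto
    qed auto
  qed
  show ?case using on eig' sp by blast
qed

text \<open>Write v as a multiple of \<open>\<phi> l\<close> plus \<open>P\<close> in the span of
  the earlier eigenvectors plus \<open>w\<close> orthogonal to all of them. The operator
  \<open>D\<close>, which is \<open>A\<close> minus \<open>la l\<close>, is at least \<alpha> on
  \<open>P\<close> and at most -\<alpha> on \<open>w\<close>, so testing \<open>D v\<close> against
  \<open>P - w\<close> controls both parts at once. \<open>D v\<close> is small because
  \<open>A v\<close> is close to \<open>B v\<close> and, by Weyl in both directions,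
  \<open>\<kappa> l\<close> is close to \<open>la l\<close>; these two errors give the factor 2. The
  factor \<open>sqrt 2\<close> arises when the distance from the line of \<open>\<phi> l\<close> is
  converted into the distance between unit vectors.\<close>

lemma davis_kahan:
  fixes A B :: "'a::real_inner \<Rightarrow> 'a"
  assumes A: "linear A" "\<And>x y. inner (A x) y = inner x (A y)" and B: "linear B"
    and on: "orthonormal_on {1..l} \<phi>" "orthonormal_on {1..l} \<psi>" and "l \<ge> 1" and "\<alpha> > 0"
    and eigA: "\<And>k. k \<in> {1..l} \<Longrightarrow> A (\<phi> k) = la k *\<^sub>R \<phi> k"
    and gap: "\<And>k. k \<in> {1..<l} \<Longrightarrow> la l + \<alpha> \<le> la k"
    and A_le: "\<And>g. (\<And>j. j \<in> {1..<l} \<Longrightarrow> inner g (\<phi> j) = 0) \<Longrightarrow> inner (A g) g \<le> la l * (norm g)\<^sup>2"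
    and A_less: "\<And>g. (\<And>j. j \<in> {1..l} \<Longrightarrow> inner g (\<phi> j) = 0) \<Longrightarrow>
                   inner (A g) g \<le> (la l - \<alpha>) * (norm g)\<^sup>2"
    and eigB: "\<And>k. k \<in> {1..l} \<Longrightarrow> B (\<psi> k) = \<kappa> k *\<^sub>R \<psi> k"
    and decB: "\<And>k. k \<in> {1..l} \<Longrightarrow> \<kappa> l \<le> \<kappa> k"
    and B_le: "\<And>g. (\<And>j. j \<in> {1..<l} \<Longrightarrow> inner g (\<psi> j) = 0) \<Longrightarrow> inner (B g) g \<le> \<kappa> l * (norm g)\<^sup>2"
    and \<delta>: "\<And>g. norm (A g - B g) \<le> \<delta> * norm g"
    and v: "B v = \<kappa> l *\<^sub>R v" "norm v = 1" "inner (\<phi> l) v \<ge> 0"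
  shows "norm (\<phi> l - v) \<le> 2 * sqrt 2 * \<delta> / \<alpha>"
proof -
  have form: "\<bar>inner (A g) g - inner (B g) g\<bar> \<le> \<delta> * (norm g)\<^sup>2" for g
  proof -
    have "\<bar>inner (A g - B g) g\<bar> \<le> norm (A g - B g) * norm g" by (rule Cauchy_Schwarz_ineq2)
    also have "\<dots> \<le> \<delta> * norm g * norm g" by (intro mult_right_mono \<delta>) auto
    finally show ?thesis by (simp add: inner_diff_left power2_eq_square mult.assoc)
  qed
  have "la l \<le> \<kappa> l + \<delta>"
  proof (rule weyl_inequality[where \<psi> = \<psi>, OF A(1) on(1) \<open>l \<ge> 1\<close> eigA _ B_le])
    show "la l \<le> la k" if "k \<in> {1..l}" for k
      using that gap[of k] \<open>\<alpha> > 0\<close> by (cases "k = l") auto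
    show "inner (A g) g \<le> inner (B g) g + \<delta> * (norm g)\<^sup>2" for g
      using form[of g] by linarith
  qed auto
  moreover have "\<kappa> l \<le> la l + \<delta>"
  proof (rule weyl_inequality[where \<psi> = \<phi>, OF B on(2) \<open>l \<ge> 1\<close> eigB decB A_le])
    show "inner (B g) g \<le> inner (A g) g + \<delta> * (norm g)\<^sup>2" for g
      using form[of g] by linarith
  qed auto
  ultimately have ev: "\<bar>\<kappa> l - la l\<bar> \<le> \<delta>" by linarith
  define D where "D x = A x - la l *\<^sub>R x" for x
  have D_add: "D (x + y) = D x + D y" for x y
    by (simp add: D_def linear_add[OF A(1)] algebra_simps)
  have D_sym: "inner (D x) y = inner x (D y)" for x y
    by (simp add: D_def inner_diff_left inner_diff_right A(2))
  have "D v = (A v - B v) + (\<kappa> l - la l) *\<^sub>R v"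
    by (simp add: D_def v(1) algebra_simps)
  also have "norm \<dots> \<le> norm (A v - B v) + \<bar>\<kappa> l - la l\<bar> * norm v"
    using norm_triangle_ineq[of "A v - B v" "(\<kappa> l - la l) *\<^sub>R v"] by simp
  finally have Dv: "norm (D v) \<le> 2 * \<delta>"
    using ev \<delta>[of v] v(2) by simp
  obtain w where w: "v = (\<Sum>k\<in>{1..l}. inner v (\<phi> k) *\<^sub>R \<phi> k) + w"
      "\<And>k. k \<in> {1..l} \<Longrightarrow> inner w (\<phi> k) = 0"
      "(norm v)\<^sup>2 = (\<Sum>k\<in>{1..l}. (inner v (\<phi> k))\<^sup>2) + (norm w)\<^sup>2"
    using orthonormal_decomposition[OF on(1), of v] by blast
  define c where "c k = inner v (\<phi> k)" for k
  define P where "P = (\<Sum>k\<in>{1..<l}. c k *\<^sub>R \<phi> k)"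
  have iv: "{1..l} = insert l {1..<l}" using \<open>l \<ge> 1\<close> by auto
  have on': "orthonormal_on {1..<l} \<phi>" by (rule orthonormal_on_subset[OF on(1)]) auto
  have vP: "v = c l *\<^sub>R \<phi> l + P + w"
    using w(1) unfolding P_def c_def iv by simp
  have nP: "(norm P)\<^sup>2 = (\<Sum>k\<in>{1..<l}. (c k)\<^sup>2)"
    unfolding power2_norm_eq_inner P_def inner_orthonormal_sums[OF on' finite_atLeastLessThan]
    by (simp add: power2_eq_square)
  have one: "1 = (c l)\<^sup>2 + (norm P)\<^sup>2 + (norm w)\<^sup>2"
    using w(3) unfolding v(2) nP iv c_def[symmetric] by simp
  have Pw: "inner P w = 0"
    unfolding P_def inner_sum_left using w(2)
    by (intro sum.neutral) (auto simp: inner_commute)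
  have "A P = (\<Sum>k\<in>{1..<l}. (la k * c k) *\<^sub>R \<phi> k)"
    unfolding P_def linear_sum[OF A(1)]
    by (intro sum.cong) (auto simp: linear_scale[OF A(1)] eigA)
  then have DP: "D P = (\<Sum>k\<in>{1..<l}. ((la k - la l) * c k) *\<^sub>R \<phi> k)"
    by (simp add: D_def P_def scaleR_sum_right algebra_simps sum_subtractf)
  have DPw: "inner (D P) w = 0"
    unfolding DP inner_sum_left using w(2)
    by (intro sum.neutral) (auto simp: inner_commute)
  have "inner (D P) P = (\<Sum>k\<in>{1..<l}. ((la k - la l) * c k) * c k)"
    unfolding DP by (simp only: P_def inner_orthonormal_sums[OF on' finite_atLeastLessThan])
  also have "\<dots> \<ge> (\<Sum>k\<in>{1..<l}. \<alpha> * (c k)\<^sup>2)"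
  proof (rule sum_mono)
    fix k assume "k \<in> {1..<l}"
    then have "\<alpha> * (c k)\<^sup>2 \<le> (la k - la l) * (c k)\<^sup>2"
      using gap[of k] by (intro mult_right_mono) auto
    then show "\<alpha> * (c k)\<^sup>2 \<le> ((la k - la l) * c k) * c k" by (simp add: power2_eq_square mult_ac)
  qed
  finally have DPP: "\<alpha> * (norm P)\<^sup>2 \<le> inner (D P) P" by (simp add: nP sum_distrib_left)
  have Dww: "inner (D w) w \<le> - \<alpha> * (norm w)\<^sup>2"
    using A_less[of w] w(2) by (simp add: D_def inner_diff_left power2_norm_eq_inner algebra_simps)
  have "D (c l *\<^sub>R \<phi> l) = 0"
    using eigA[of l] \<open>l \<ge> 1\<close> by (simp add: D_def linear_scale[OF A(1)])
  then have "D v = D P + D w" unfolding vP by (simp add: D_add)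
  then have "inner (D v) (P - w) = inner (D P) P - inner (D w) w"
    using DPw D_sym[of w P] by (simp add: inner_add_left inner_diff_right inner_commute[of w "D P"])
  then have "\<alpha> * ((norm P)\<^sup>2 + (norm w)\<^sup>2) \<le> inner (D v) (P - w)"
    using DPP Dww by (simp add: algebra_simps)
  also have "\<dots> \<le> norm (D v) * norm (P - w)" by (rule norm_cauchy_schwarz)
  also have "\<dots> \<le> 2 * \<delta> * norm (P - w)" by (intro mult_right_mono Dv) auto
  finally have *: "\<alpha> * ((norm P)\<^sup>2 + (norm w)\<^sup>2) \<le> 2 * \<delta> * norm (P - w)" .
  define \<rho> where "\<rho> = norm (P - w)"
  have \<rho>2: "\<rho>\<^sup>2 = (norm P)\<^sup>2 + (norm w)\<^sup>2"
    unfolding \<rho>_def power2_norm_eq_inner using Pw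
    by (simp add: inner_diff_left inner_diff_right inner_commute)
  have \<delta>0: "0 \<le> \<delta>" using Dv norm_ge_zero[of "D v"] by linarith
  have "\<alpha> * \<rho> \<le> 2 * \<delta>"
  proof (cases "\<rho> = 0")
    case False
    then have "\<rho> > 0" by (simp add: \<rho>_def)
    then show ?thesis using * unfolding \<rho>2[symmetric] \<rho>_def[symmetric] by (simp add: power2_eq_square)
  qed (use \<delta>0 in simp)
  then have \<rho>: "\<rho> \<le> 2 * \<delta> / \<alpha>" using \<open>\<alpha> > 0\<close> by (simp add: field_simps)
  have cl: "0 \<le> c l" "(c l)\<^sup>2 = 1 - \<rho>\<^sup>2"
    using v(3) one \<rho>2 by (auto simp: c_def inner_commute)
  then have "c l \<le> 1" by (metis abs_le_square_iff abs_of_nonneg diff_le_eq le_add_same_cancel1 one_power2 zero_le_one zero_le_power2)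
  \<comment> \<open>The sign condition on v enters here: for \<open>c l\<close> between 0 and 1 the
    squared distance 2 - 2 c is at most 2 - 2 c^2, that is, twice the square of \<rho>.\<close>
  then have "(c l)\<^sup>2 \<le> c l" using cl(1) by (simp add: power2_eq_square mult_left_le)
  have "inner (\<phi> l) (\<phi> l) = 1" using orthonormal_onD[OF on(1)] \<open>l \<ge> 1\<close> by simp
  then have "(norm (\<phi> l - v))\<^sup>2 = 2 - 2 * c l"
    using v(2) unfolding power2_norm_eq_inner
    by (simp add: inner_diff_left inner_diff_right c_def inner_commute norm_eq_1)
  also have "\<dots> \<le> 2 * \<rho>\<^sup>2" using \<open>(c l)\<^sup>2 \<le> c l\<close> cl(2) by linarith
  finally have "(norm (\<phi> l - v))\<^sup>2 \<le> (sqrt 2 * \<rho>)\<^sup>2" by (simp add: power_mult_distrib)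
  then have "norm (\<phi> l - v) \<le> sqrt 2 * \<rho>"
    by (rule power2_le_imp_le) (simp add: \<rho>_def)
  also have "\<dots> \<le> sqrt 2 * (2 * \<delta> / \<alpha>)" by (intro mult_left_mono \<rho>) simp
  finally show ?thesis by (simp add: mult_ac)
qed

text \<open>On the orthogonal complement of some eigenfunctions this produces an eigenvector that a complete
  eigensystem cannot have, which yields the variational bounds \<open>A_le\<close> and \<open>A_less\<close> above.\<close>

lemma top_eigenvector:
  fixes A :: "'a::real_inner \<Rightarrow> 'a"
  assumes A: "bounded_linear A" "\<And>x y. inner (A x) y = inner x (A y)" "\<And>x. 0 \<le> inner (A x) x"
    and cpt: "\<And>s :: nat \<Rightarrow> 'a. (\<And>n. norm (s n) = 1) \<Longrightarrow>
                \<exists>h r. strict_mono (r :: nat \<Rightarrow> nat) \<and> (\<lambda>n. A (s (r n))) \<longlonglongrightarrow> h"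
    and W: "real_vector.subspace W" "closed W" "\<And>x. x \<in> W \<Longrightarrow> A x \<in> W"
    and g: "g \<in> W" "\<kappa> * (norm g)\<^sup>2 < inner (A g) g" and "\<kappa> \<ge> 0"
  obtains h R where "h \<in> W" "h \<noteq> 0" "A h = R *\<^sub>R h" "\<kappa> < R"
proof -
  interpret A: bounded_linear A by (rule A(1))
  define V where "V = {inner (A x) x |x. x \<in> W \<and> norm x = 1}"
  obtain c where c: "\<And>x. norm (A x) \<le> norm x * c" using A.bounded by blast
  have bdd: "bdd_above V"
  proof (rule bdd_aboveI)
    fix y assume "y \<in> V"
    then obtain x where x: "y = inner (A x) x" "norm x = 1" by (auto simp: V_def)
    have "y \<le> norm (A x) * norm x" unfolding x(1) by (rule norm_cauchy_schwarz)
    then show "y \<le> c" using c[of x] x(2) by simp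
  qed
  have "g \<noteq> 0" using g(2) by auto
  define R where "R = Sup V"
  have gV: "inner (A g) g / (norm g)\<^sup>2 \<in> V"
    unfolding V_def using \<open>g \<noteq> 0\<close> g(1) W(1)
    by (auto intro!: exI[of _ "(1 / norm g) *\<^sub>R g"] simp: A.scaleR real_vector.subspace_scale power2_eq_square)
  have "\<kappa> < inner (A g) g / (norm g)\<^sup>2" using g(2) \<open>g \<noteq> 0\<close> by (simp add: field_simps)
  also have "\<dots> \<le> R" unfolding R_def by (rule cSup_upper[OF gV bdd])
  finally have R: "\<kappa> < R" .
  then have "R > 0" using \<open>\<kappa> \<ge> 0\<close> by linarith
  have le_R: "inner (A x) x \<le> R * (norm x)\<^sup>2" if "x \<in> W" for x
  proof (cases "x = 0")
    case False
    have "inner (A x) x / (norm x)\<^sup>2 \<in> V"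
      unfolding V_def using False that W(1)
      by (auto intro!: exI[of _ "(1 / norm x) *\<^sub>R x"] simp: A.scaleR real_vector.subspace_scale power2_eq_square)
    then have "inner (A x) x / (norm x)\<^sup>2 \<le> R" unfolding R_def by (rule cSup_upper[OF _ bdd])
    then show ?thesis using False by (simp add: field_simps)
  qed (simp add: A.zero)
  have "\<exists>x. x \<in> W \<and> norm x = 1 \<and> R - 1 / real (Suc n) < inner (A x) x" for n
  proof -
    have "\<exists>y\<in>V. R - 1 / real (Suc n) < y"
      using less_cSup_iff[of V "R - 1 / real (Suc n)"] bdd gV unfolding R_def by auto
    then show ?thesis by (auto simp: V_def)
  qed
  then obtain s where s: "\<And>n. s n \<in> W" "\<And>n. norm (s n) = 1"
      "\<And>n. R - 1 / real (Suc n) < inner (A (s n)) (s n)"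
    by metis
  have sq: "(norm (A (s n) - R *\<^sub>R s n))\<^sup>2 \<le> R * (1 / real (Suc n))" for n
  proof -
    define x where "x = s n"
    \<comment> \<open>Positivity at this vector, combined with \<open>le_R\<close> at
      \<open>A x\<close>, gives \<open>(norm (A x))\<^sup>2 \<le> R * inner (A x) x\<close>. That
      inequality turns vectors that nearly attain the supremum into approximate
      eigenvectors.\<close>
    have "0 \<le> inner (A (x - (1 / R) *\<^sub>R A x)) (x - (1 / R) *\<^sub>R A x)" by (rule A(3))
    also have "\<dots> = inner (A x) x - 2 / R * (norm (A x))\<^sup>2 + (1 / R)\<^sup>2 * inner (A (A x)) (A x)"
      using A(2)[of "A x" x] unfolding power2_norm_eq_inner
      by (simp add: A.diff A.scaleR inner_diff_left inner_diff_right
          power2_eq_square algebra_simps)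
    also have "\<dots> \<le> inner (A x) x - 2 / R * (norm (A x))\<^sup>2 + (1 / R)\<^sup>2 * (R * (norm (A x))\<^sup>2)"
      using s(1)[of n] W(3) by (intro add_left_mono mult_left_mono le_R) (auto simp: x_def)
    also have "\<dots> = inner (A x) x - (norm (A x))\<^sup>2 / R"
      using \<open>R > 0\<close> by (simp add: field_simps power2_eq_square)
    finally have "(norm (A x))\<^sup>2 \<le> R * inner (A x) x" using \<open>R > 0\<close> by (simp add: field_simps)
    moreover have "(norm (A x - R *\<^sub>R x))\<^sup>2 = (norm (A x))\<^sup>2 - 2 * R * inner (A x) x + R * R * (norm x)\<^sup>2"
      unfolding power2_norm_eq_inner
      by (simp add: inner_diff_left inner_diff_right inner_commute algebra_simps)
    ultimately have "(norm (A x - R *\<^sub>R x))\<^sup>2 \<le> R * (R - inner (A x) x)"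
      using s(2)[of n] by (simp add: x_def algebra_simps)
    also have "\<dots> \<le> R * (1 / real (Suc n))"
      using s(3)[of n] \<open>R > 0\<close> by (intro mult_left_mono) (auto simp: x_def)
    finally show ?thesis by (simp add: x_def)
  qed
  have "(\<lambda>n. R * (1 / real (Suc n))) \<longlonglongrightarrow> R * 0"
    by (intro tendsto_mult tendsto_const lim_1_over_n[THEN LIMSEQ_Suc])
  then have lim0: "(\<lambda>n. R * (1 / real (Suc n))) \<longlonglongrightarrow> 0" by simp
  have "(\<lambda>n. (norm (A (s n) - R *\<^sub>R s n))\<^sup>2) \<longlonglongrightarrow> 0"
    by (rule tendsto_sandwich[OF always_eventually always_eventually tendsto_const lim0])
      (rule allI, rule zero_le_power2, rule allI, rule sq)
  then have "(\<lambda>n. sqrt ((norm (A (s n) - R *\<^sub>R s n))\<^sup>2)) \<longlonglongrightarrow> sqrt 0"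
    by (rule tendsto_real_sqrt)
  then have res: "(\<lambda>n. A (s n) - R *\<^sub>R s n) \<longlonglongrightarrow> 0"
    by (simp add: tendsto_norm_zero_iff)
  obtain h r where r: "strict_mono r" "(\<lambda>n. A (s (r n))) \<longlonglongrightarrow> h"
    using cpt[of s, OF s(2)] by blast
  \<comment> \<open>Compactness makes the images converge; since
    \<open>A (s n) - R *\<^sub>R s n\<close> tends to zero and R is positive, the vectors themselves
    converge along the same subsequence.\<close>
  have "(\<lambda>n. (1 / R) *\<^sub>R (A (s (r n)) - (A (s (r n)) - R *\<^sub>R s (r n)))) \<longlonglongrightarrow> (1 / R) *\<^sub>R (h - 0)"
    using LIMSEQ_subseq_LIMSEQ[OF res r(1)]
    by (intro tendsto_scaleR tendsto_const tendsto_diff r(2)) (simp add: o_def)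
  then have lim: "(\<lambda>n. s (r n)) \<longlonglongrightarrow> (1 / R) *\<^sub>R h" using \<open>R > 0\<close> by simp
  have "(\<lambda>n. A (s (r n))) \<longlonglongrightarrow> A ((1 / R) *\<^sub>R h)" by (rule A.tendsto[OF lim])
  then have "h = A ((1 / R) *\<^sub>R h)" using r(2) LIMSEQ_unique by blast
  then have "A ((1 / R) *\<^sub>R h) = R *\<^sub>R ((1 / R) *\<^sub>R h)" using \<open>R > 0\<close> by simp
  moreover have "(1 / R) *\<^sub>R h \<in> W"
    by (rule closed_sequentially[OF W(2) _ lim]) (rule s(1))
  moreover have "norm ((1 / R) *\<^sub>R h) = 1"
    by (rule LIMSEQ_unique[OF tendsto_norm[OF lim]]) (simp add: s(2))
  then have "(1 / R) *\<^sub>R h \<noteq> 0" by (metis norm_zero zero_neq_one)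
  ultimately show thesis using R by (intro that)
qed

section \<open>The Hilbert space of square-integrable functions\<close>

lemma L2_D: "f \<in> L2 \<Longrightarrow> f \<in> borel_measurable leb01" "f \<in> L2 \<Longrightarrow> integrable leb01 (\<lambda>s. (f s)\<^sup>2)"
  by (auto simp: L2_def)

lemma L2_I: "f \<in> borel_measurable leb01 \<Longrightarrow> integrable leb01 (\<lambda>s. (f s)\<^sup>2) \<Longrightarrow> f \<in> L2"
  by (auto simp: L2_def)

lemma emeasure_leb01: "emeasure leb01 (space leb01) = 1"
  by (subst emeasure_restrict_space) (auto simp: space_restrict_space)

interpretation leb01: prob_space leb01
  by standard (rule emeasure_leb01)

lemma space_leb01 [simp]: "space leb01 = {0..1}"
  by (simp add: space_restrict_space)

lemma sets_leb01: "sets leb01 = sets (restrict_space borel {0..1})"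
  by (simp add: sets_restrict_space)

lemma integrable_mult_L2:
  assumes "f \<in> L2" "g \<in> L2"
  shows "integrable leb01 (\<lambda>s. f s * g s)"
proof (rule Bochner_Integration.integrable_bound)
  show "integrable leb01 (\<lambda>s. (f s)\<^sup>2 + (g s)\<^sup>2)"
    using assms by (intro Bochner_Integration.integrable_add L2_D)
  show "(\<lambda>s. f s * g s) \<in> borel_measurable leb01"
    using assms[THEN L2_D(1)] by measurable
  have "\<bar>a * b\<bar> \<le> \<bar>a\<^sup>2 + b\<^sup>2\<bar>" for a b :: real
  proof -
    have "0 \<le> \<bar>a\<bar> * \<bar>b\<bar>" by simp
    then show ?thesis
      using sum_squares_bound[of "\<bar>a\<bar>" "\<bar>b\<bar>"] unfolding abs_mult power2_abs by linarith
  qed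
  then show "AE s in leb01. norm (f s * g s) \<le> norm ((f s)\<^sup>2 + (g s)\<^sup>2)" by simp
qed

lemma L2_add:
  assumes "f \<in> L2" "g \<in> L2"
  shows "(\<lambda>s. f s + g s) \<in> L2"
proof (rule L2_I)
  show "(\<lambda>s. f s + g s) \<in> borel_measurable leb01"
    using assms[THEN L2_D(1)] by measurable
  have "integrable leb01 (\<lambda>s. (f s)\<^sup>2 + (g s)\<^sup>2 + 2 * (f s * g s))"
    using assms by (intro Bochner_Integration.integrable_add L2_D integrable_mult_right integrable_mult_L2)
  then show "integrable leb01 (\<lambda>s. (f s + g s)\<^sup>2)"
    by (simp add: power2_sum mult.assoc)
qed

lemma L2_scale: "f \<in> L2 \<Longrightarrow> (\<lambda>s. c * f s) \<in> L2"
  by (intro L2_I) (auto simp: power_mult_distrib L2_D intro: borel_measurable_times)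

lemma L2_zero: "(\<lambda>s. 0) \<in> L2"
  by (intro L2_I) auto

lemma L2_diff: "f \<in> L2 \<Longrightarrow> g \<in> L2 \<Longrightarrow> (\<lambda>s. f s - g s) \<in> L2"
  using L2_add[OF _ L2_scale[of g "-1"]] by simp

definition L2_eq :: "(real \<Rightarrow> real) \<Rightarrow> (real \<Rightarrow> real) \<Rightarrow> bool" where
  "L2_eq f g \<longleftrightarrow> f \<in> L2 \<and> g \<in> L2 \<and> (AE s in leb01. f s = g s)"

\<comment> \<open>A type rather than a carrier set, so that the class-based theory of inner product
  spaces, their topology and their Borel sets applies. The relation is partial because only
  square-integrable functions have a class.\<close>
quotient_type l2 = "real \<Rightarrow> real" / partial: L2_eq
proof (rule part_equivpI)
  show "\<exists>f. L2_eq f f" using L2_zero by (auto simp: L2_eq_def)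
  show "symp L2_eq" by (auto simp: symp_def L2_eq_def elim: AE_mp)
  show "transp L2_eq"
  proof (rule transpI)
    fix f g h assume fg: "L2_eq f g" and gh: "L2_eq g h"
    then have "AE s in leb01. f s = g s" "AE s in leb01. g s = h s" by (auto simp: L2_eq_def)
    then have "AE s in leb01. f s = h s" by eventually_elim simp
    then show "L2_eq f h" using fg gh by (auto simp: L2_eq_def)
  qed
qed

instantiation l2 :: real_inner
begin

lift_definition zero_l2 :: l2 is "\<lambda>s. 0"
  by (auto simp: L2_eq_def L2_zero)

lift_definition plus_l2 :: "l2 \<Rightarrow> l2 \<Rightarrow> l2" is "\<lambda>f g s. f s + g s"
  by (auto simp: L2_eq_def L2_add elim: AE_mp)

lift_definition minus_l2 :: "l2 \<Rightarrow> l2 \<Rightarrow> l2" is "\<lambda>f g s. f s - g s"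
  by (auto simp: L2_eq_def L2_diff elim: AE_mp)

lift_definition scaleR_l2 :: "real \<Rightarrow> l2 \<Rightarrow> l2" is "\<lambda>c f s. c * f s"
  by (auto simp: L2_eq_def L2_scale elim: AE_mp)

definition uminus_l2 :: "l2 \<Rightarrow> l2" where "uminus_l2 x = (-1) *\<^sub>R x"

lift_definition inner_l2 :: "l2 \<Rightarrow> l2 \<Rightarrow> real" is L2_inner
proof -
  fix f g f' g' assume "L2_eq f g" "L2_eq f' g'"
  then have AE: "AE s in leb01. f s = g s" "AE s in leb01. f' s = g' s"
    and m: "f \<in> L2" "g \<in> L2" "f' \<in> L2" "g' \<in> L2" by (auto simp: L2_eq_def)
  show "L2_inner f f' = L2_inner g g'"
    unfolding L2_inner_def
  proof (rule integral_cong_AE)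
    show "AE s in leb01. f s * f' s = g s * g' s" using AE by eventually_elim simp
  qed (use m[THEN L2_D(1)] in measurable)
qed

definition norm_l2 :: "l2 \<Rightarrow> real" where "norm_l2 x = sqrt (inner x x)"

definition dist_l2 :: "l2 \<Rightarrow> l2 \<Rightarrow> real" where "dist_l2 x y = norm (x - y)"

definition sgn_l2 :: "l2 \<Rightarrow> l2" where "sgn_l2 x = inverse (norm x) *\<^sub>R x"

definition uniformity_l2 :: "(l2 \<times> l2) filter" where
  "uniformity_l2 = (INF e\<in>{0 <..}. principal {(x, y). dist x y < e})"

definition open_l2 :: "l2 set \<Rightarrow> bool" where
  "open_l2 U \<longleftrightarrow> (\<forall>x\<in>U. \<forall>\<^sub>F (x', y) in uniformity. x' = x \<longrightarrow> y \<in> U)"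

instance
proof
  fix x y z :: l2 and a b :: real
  show "x + y + z = x + (y + z)" by transfer (auto simp: L2_eq_def L2_add add.assoc)
  show "x + y = y + x" by transfer (auto simp: L2_eq_def L2_add add.commute)
  show "0 + x = x" by transfer (auto simp: L2_eq_def)
  show "- x + x = 0" unfolding uminus_l2_def by transfer (auto simp: L2_eq_def L2_zero L2_add L2_scale)
  show "x - y = x + - y" unfolding uminus_l2_def by transfer (auto simp: L2_eq_def L2_diff L2_add L2_scale)
  show "a *\<^sub>R (x + y) = a *\<^sub>R x + a *\<^sub>R y"
    by transfer (auto simp: L2_eq_def L2_add L2_scale distrib_left)
  show "(a + b) *\<^sub>R x = a *\<^sub>R x + b *\<^sub>R x"
    by transfer (auto simp: L2_eq_def L2_add L2_scale distrib_right)
  show "a *\<^sub>R b *\<^sub>R x = (a * b) *\<^sub>R x"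
    by transfer (auto simp: L2_eq_def L2_scale mult.assoc)
  show "1 *\<^sub>R x = x" by transfer (auto simp: L2_eq_def)
  show "dist x y = norm (x - y)" by (rule dist_l2_def)
  show "sgn x = inverse (norm x) *\<^sub>R x" by (rule sgn_l2_def)
  show "norm x = sqrt (inner x x)" by (rule norm_l2_def)
  show "inner x y = inner y x" by transfer (simp add: L2_inner_def mult.commute)
  show "inner (x + y) z = inner x z + inner y z"
    by transfer (auto simp: L2_inner_def L2_eq_def distrib_right integrable_mult_L2)
  show "inner (a *\<^sub>R x) y = a * inner x y"
    by transfer (auto simp: L2_inner_def mult.assoc)
  show "0 \<le> inner x x" by transfer (auto simp: L2_inner_def)
  show "inner x x = 0 \<longleftrightarrow> x = 0"
  proof transfer
    fix f assume "L2_eq f f"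
    then have f: "f \<in> L2" by (simp add: L2_eq_def)
    have "L2_inner f f = 0 \<longleftrightarrow> (AE s in leb01. f s * f s = 0)"
      unfolding L2_inner_def using integrable_mult_L2[OF f f]
      by (intro integral_nonneg_eq_0_iff_AE) auto
    then show "L2_inner f f = 0 \<longleftrightarrow> L2_eq f (\<lambda>s. 0)" using f by (auto simp: L2_eq_def L2_zero)
  qed
qed (simp_all add: uniformity_l2_def open_l2_def)

end

definition l2_class :: "(real \<Rightarrow> real) \<Rightarrow> l2" where "l2_class f = abs_l2 f"

lemma L2_eq_refl: "L2_eq f f \<longleftrightarrow> f \<in> L2"
  by (auto simp: L2_eq_def)

lemma l2_class_eq_iff: "f \<in> L2 \<Longrightarrow> g \<in> L2 \<Longrightarrow> l2_class f = l2_class g \<longleftrightarrow> (AE s in leb01. f s = g s)"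
  unfolding l2_class_def using Quotient3_rel[OF Quotient3_l2, of f g] by (auto simp: L2_eq_def)

lemma l2_class_cases:
  obtains f where "f \<in> L2" "x = l2_class f"
  using Quotient3_rep_reflp[OF Quotient3_l2, of x] Quotient3_abs_rep[OF Quotient3_l2, of x]
  by (metis L2_eq_refl l2_class_def)

lemma l2_class_zero: "l2_class (\<lambda>s. 0) = 0"
  by (simp add: l2_class_def zero_l2_def)

lemma l2_class_add: "f \<in> L2 \<Longrightarrow> g \<in> L2 \<Longrightarrow> l2_class (\<lambda>s. f s + g s) = l2_class f + l2_class g"
  unfolding l2_class_def by (subst plus_l2.abs_eq) (auto simp: L2_eq_refl)

lemma l2_class_diff: "f \<in> L2 \<Longrightarrow> g \<in> L2 \<Longrightarrow> l2_class (\<lambda>s. f s - g s) = l2_class f - l2_class g"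
  unfolding l2_class_def by (subst minus_l2.abs_eq) (auto simp: L2_eq_refl)

lemma l2_class_scale: "f \<in> L2 \<Longrightarrow> l2_class (\<lambda>s. c * f s) = c *\<^sub>R l2_class f"
  unfolding l2_class_def by (subst scaleR_l2.abs_eq) (auto simp: L2_eq_refl)

lemma inner_l2_class: "f \<in> L2 \<Longrightarrow> g \<in> L2 \<Longrightarrow> inner (l2_class f) (l2_class g) = L2_inner f g"
  unfolding l2_class_def by (subst inner_l2.abs_eq) (auto simp: L2_eq_refl)

lemma norm_l2_class: "f \<in> L2 \<Longrightarrow> norm (l2_class f) = L2_norm f"
  by (simp add: norm_l2_def inner_l2_class L2_norm_def L2_inner_def power2_eq_square)

lemma L2_sum: "(\<And>i. i \<in> I \<Longrightarrow> f i \<in> L2) \<Longrightarrow> (\<lambda>s. \<Sum>i\<in>I. f i s) \<in> L2"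
  by (induction I rule: infinite_finite_induct) (auto simp: L2_zero L2_add)

lemma l2_class_sum:
  "(\<And>i. i \<in> I \<Longrightarrow> f i \<in> L2) \<Longrightarrow> l2_class (\<lambda>s. \<Sum>i\<in>I. f i s) = (\<Sum>i\<in>I. l2_class (f i))"
  by (induction I rule: infinite_finite_induct) (auto simp: l2_class_zero l2_class_add L2_sum)

lemma L2_bounded:
  assumes "f \<in> borel_measurable leb01" "\<And>s. s \<in> {0..1} \<Longrightarrow> \<bar>f s\<bar> \<le> c"
  shows "f \<in> L2"
proof (rule L2_I[OF assms(1)])
  show "integrable leb01 (\<lambda>s. (f s)\<^sup>2)"
  proof (rule leb01.integrable_const_bound[of _ "c\<^sup>2"])
    show "AE s in leb01. norm ((f s)\<^sup>2) \<le> c\<^sup>2"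
    proof (rule AE_I2)
      fix s assume "s \<in> space leb01"
      then have "\<bar>f s\<bar> \<le> \<bar>c\<bar>" using assms(2)[of s] by simp
      then show "norm ((f s)\<^sup>2) \<le> c\<^sup>2" by (simp add: abs_le_square_iff)
    qed
  qed (use assms(1) in measurable)
qed

lemma indicator_L2: "A \<in> sets borel \<Longrightarrow> indicator A \<in> L2"
  by (rule L2_bounded[of _ 1, OF measurable_restrict_space1]) (simp_all add: indicator_le_1)

lemma L2_dominated:
  assumes "f \<in> borel_measurable leb01" "g \<in> L2" "AE s in leb01. \<bar>f s\<bar> \<le> g s"
  shows "f \<in> L2"
proof (rule L2_I[OF assms(1)])
  show "integrable leb01 (\<lambda>s. (f s)\<^sup>2)"
  proof (rule Bochner_Integration.integrable_bound[OF L2_D(2)[OF assms(2)]])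
    show "AE s in leb01. norm ((f s)\<^sup>2) \<le> norm ((g s)\<^sup>2)"
      using assms(3)
    proof eventually_elim
      case (elim s)
      then have "\<bar>f s\<bar> \<le> \<bar>g s\<bar>" by simp
      then show ?case by (simp add: abs_le_square_iff)
    qed
  qed (use assms(1) in measurable)
qed

text \<open>The squared differences are dominated by \<open>4 * (g s)\<^sup>2\<close>, so dominated
  convergence applied to them gives convergence in norm.\<close>

lemma l2_class_dominated_convergence:
  assumes f: "\<And>i. f i \<in> borel_measurable leb01" "f' \<in> borel_measurable leb01" and g: "g \<in> L2"
    and le: "\<And>i. AE s in leb01. \<bar>f i s\<bar> \<le> g s"
    and lim: "AE s in leb01. (\<lambda>i. f i s) \<longlonglongrightarrow> f' s"
  shows "(\<lambda>i. l2_class (f i)) \<longlonglongrightarrow> l2_class f'"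
proof -
  have all: "AE s in leb01. \<forall>i. \<bar>f i s\<bar> \<le> g s" using le by (simp add: AE_all_countable)
  have le': "AE s in leb01. \<bar>f' s\<bar> \<le> g s"
    using all lim
  proof eventually_elim
    case (elim s)
    show ?case
      by (rule LIMSEQ_le_const2[OF tendsto_rabs[OF elim(2)]]) (use elim(1) in auto)
  qed
  have fL: "f i \<in> L2" for i using L2_dominated[OF f(1) g le] .
  have f'L: "f' \<in> L2" using L2_dominated[OF f(2) g le'] .
  have [measurable]: "f i \<in> borel_measurable leb01" "f' \<in> borel_measurable leb01" "g \<in> borel_measurable leb01" for i
    using f L2_D(1)[OF g] by auto
  have "(\<lambda>i. \<integral>s. (f i s - f' s)\<^sup>2 \<partial>leb01) \<longlonglongrightarrow> (\<integral>s. 0 \<partial>leb01)"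
  proof (rule integral_dominated_convergence)
    show "integrable leb01 (\<lambda>s. 4 * (g s)\<^sup>2)" using L2_D(2)[OF g] by simp
    show "AE s in leb01. (\<lambda>i. (f i s - f' s)\<^sup>2) \<longlonglongrightarrow> 0"
      using lim
    proof eventually_elim
      case (elim s)
      have "(\<lambda>i. (f i s - f' s)\<^sup>2) \<longlonglongrightarrow> (f' s - f' s)\<^sup>2" by (intro tendsto_intros elim)
      then show ?case by simp
    qed
    show "AE s in leb01. norm ((f i s - f' s)\<^sup>2) \<le> 4 * (g s)\<^sup>2" for i
      using all le'
    proof eventually_elim
      case (elim s)
      then have "\<bar>f i s - f' s\<bar> \<le> 2 * g s" using elim(1)[rule_format, of i] elim(2) by linarith
      then have "\<bar>f i s - f' s\<bar>\<^sup>2 \<le> (2 * g s)\<^sup>2" by (intro power_mono) auto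
      then show ?case by (simp add: power_mult_distrib)
    qed
  qed measurable
  then have "(\<lambda>i. (L2_norm (\<lambda>s. f i s - f' s))) \<longlonglongrightarrow> sqrt 0"
    unfolding L2_norm_def by (intro tendsto_real_sqrt) simp
  then have "(\<lambda>i. norm (l2_class (f i) - l2_class f')) \<longlonglongrightarrow> 0"
    by (simp add: norm_l2_class fL f'L L2_diff flip: l2_class_diff)
  then show ?thesis by (simp add: LIM_zero_iff tendsto_norm_zero_iff)
qed

section \<open>Separability of the space of square-integrable functions\<close>

definition rat_steps :: "l2 set" where
  "rat_steps = range (\<lambda>xs :: (rat \<times> rat) list. \<Sum>(r, q)\<leftarrow>xs. of_rat r *\<^sub>R l2_class (indicator {..of_rat q}))"

lemma countable_rat_steps: "countable rat_steps"
  unfolding rat_steps_def by (intro countable_image) simp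

text \<open>Sums stay inside \<open>rat_steps\<close> because lists can be appended. Real multiples
  leave it and are reached only in the closure, as limits of rational multiples.\<close>

lemma subspace_closure_rat_steps: "real_vector.subspace (closure rat_steps)"
proof (rule real_vector.subspaceI)
  have "0 \<in> rat_steps" unfolding rat_steps_def by (rule range_eqI[of _ _ "[]"]) simp
  then show "0 \<in> closure rat_steps" using closure_subset by blast
next
  fix x y assume "x \<in> closure rat_steps" "y \<in> closure rat_steps"
  then obtain u v where u: "\<And>n. u n \<in> rat_steps" "u \<longlonglongrightarrow> x" and v: "\<And>n. v n \<in> rat_steps" "v \<longlonglongrightarrow> y"
    by (auto simp: closure_sequential)
  have add: "a + b \<in> rat_steps" if a: "a \<in> rat_steps" and b: "b \<in> rat_steps" for a b
  proof -
    obtain xs ys :: "(rat \<times> rat) list" where "a = (\<Sum>(r, q)\<leftarrow>xs. of_rat r *\<^sub>R l2_class (indicator {..of_rat q}))"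
      "b = (\<Sum>(r, q)\<leftarrow>ys. of_rat r *\<^sub>R l2_class (indicator {..of_rat q}))"
      using a b unfolding rat_steps_def by blast
    then show ?thesis unfolding rat_steps_def by (intro range_eqI[of _ _ "xs @ ys"]) simp
  qed
  show "x + y \<in> closure rat_steps"
    unfolding closure_sequential
    using tendsto_add[OF u(2) v(2)] add[OF u(1) v(1)] by (intro exI[of _ "\<lambda>n. u n + v n"]) auto
next
  fix c :: real and x assume "x \<in> closure rat_steps"
  then obtain u where u: "\<And>n. u n \<in> rat_steps" "u \<longlonglongrightarrow> x" by (auto simp: closure_sequential)
  obtain d where d: "\<And>n. d n \<in> \<rat>" "d \<longlonglongrightarrow> c"
    using Rats_closure_real closure_sequential[of c \<rat>] by auto
  have scale: "a *\<^sub>R b \<in> rat_steps" if a: "a \<in> \<rat>" and b: "b \<in> rat_steps" for a b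
  proof -
    obtain a' where a': "a = of_rat a'" using a by (auto elim: Rats_cases)
    obtain xs :: "(rat \<times> rat) list" where xs: "b = (\<Sum>(r, q)\<leftarrow>xs. of_rat r *\<^sub>R l2_class (indicator {..of_rat q}))"
      using b unfolding rat_steps_def by blast
    have "a *\<^sub>R b = (\<Sum>(r, q)\<leftarrow>map (\<lambda>(r, q). (a' * r, q)) xs. of_rat r *\<^sub>R l2_class (indicator {..of_rat q}))"
      unfolding a' xs by (induction xs) (auto simp: scaleR_add_right of_rat_mult)
    then show ?thesis unfolding rat_steps_def by blast
  qed
  show "c *\<^sub>R x \<in> closure rat_steps"
    unfolding closure_sequential
    using tendsto_scaleR[OF d(2) u(2)] scale[OF d(1) u(1)] by (intro exI[of _ "\<lambda>n. d n *\<^sub>R u n"]) auto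
qed

lemma closure_rat_stepsI: "(\<And>n :: nat. u n \<in> closure rat_steps) \<Longrightarrow> u \<longlonglongrightarrow> x \<Longrightarrow> x \<in> closure rat_steps"
  by (rule closed_sequentially[OF closed_closure])

lemma indicator_measurable_leb01: "A \<in> sets borel \<Longrightarrow> (indicator A :: real \<Rightarrow> real) \<in> borel_measurable leb01"
  by (rule L2_D(1)[OF indicator_L2])

text \<open>A Dynkin argument: the half-lines are an intersection-stable generator, and the sets
  with the stated property are closed under complements and countable disjoint unions.\<close>

lemma indicator_in_closure_rat_steps:
  fixes A :: "real set"
  assumes "A \<in> sets borel"
  shows "l2_class (indicator A) \<in> closure rat_steps"
proof -
  have rat: "l2_class (indicator {..of_rat q}) \<in> closure rat_steps" for q
  proof -
    have "l2_class (indicator {..of_rat q}) \<in> rat_steps"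
      unfolding rat_steps_def by (rule range_eqI[of _ _ "[(1, q)]"]) simp
    then show ?thesis using closure_subset by blast
  qed
  have one: "(\<lambda>s. 1 :: real) \<in> L2" by (rule L2_bounded[of _ 1]) auto
  have "A \<in> sigma_sets UNIV (range (\<lambda>a. {..a}))"
    using assms unfolding borel_eq_atMost by simp
  have "Int_stable (range (\<lambda>a :: real. {..a}))"
    by (auto simp: Int_stable_def)
  moreover have "range (\<lambda>a :: real. {..a}) \<subseteq> Pow UNIV" by simp
  moreover note \<open>A \<in> sigma_sets _ _\<close>
  ultimately have "A \<in> sets borel \<and> l2_class (indicator A) \<in> closure rat_steps"
  proof (induction rule: sigma_sets_induct_disjoint)
    case (basic A)
    then obtain a where A: "A = {..a}" by auto
    \<comment> \<open>The endpoint is approached from above, so that the indicators converge at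
      every point, including \<open>a\<close> itself.\<close>
    have "\<exists>q. a < of_rat q \<and> of_rat q < a + 1 / real (Suc n)" for n
      using Rats_dense_in_real[of a "a + 1 / real (Suc n)"] by (auto elim!: Rats_cases)
    then obtain q where q: "\<And>n. a < of_rat (q n)" "\<And>n. of_rat (q n) < a + 1 / real (Suc n)" by metis
    have "(\<lambda>n. a + 1 / real (Suc n)) \<longlonglongrightarrow> a + 0"
      by (intro tendsto_add tendsto_const lim_1_over_n[THEN LIMSEQ_Suc])
    then have lim: "(\<lambda>n. a + 1 / real (Suc n)) \<longlonglongrightarrow> a" by simp
    have "(\<lambda>n. l2_class (indicator {..of_rat (q n)})) \<longlonglongrightarrow> l2_class (indicator A)"
    proof (rule l2_class_dominated_convergence[OF _ _ one])
      show "AE s in leb01. (\<lambda>n. indicator {..of_rat (q n)} s :: real) \<longlonglongrightarrow> indicator A s"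
      proof (rule AE_I2)
        fix s
        show "(\<lambda>n. indicator {..of_rat (q n)} s :: real) \<longlonglongrightarrow> indicator A s"
        proof (cases "s \<le> a")
          case True
          then have "s \<le> of_rat (q n)" for n using q(1)[of n] by linarith
          then show ?thesis using True by (simp add: A)
        next
          case False
          then have "\<forall>\<^sub>F n in sequentially. a + 1 / real (Suc n) < s"
            using order_tendstoD(2)[OF lim, of s] by simp
          then have "\<forall>\<^sub>F n in sequentially. indicator {..of_rat (q n)} s = (indicator A s :: real)"
          proof eventually_elim
            case (elim n)
            then show ?case using q(2)[of n] False by (simp add: A)
          qed
          then show ?thesis by (rule tendsto_eventually)
        qed
      qed
    qed (auto simp: A intro: indicator_measurable_leb01 indicator_le_1)
    then show ?case using closure_rat_stepsI[OF rat] by (auto simp: A)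
  next
    case empty
    have "indicator {} = (\<lambda>s. 0 :: real)" by auto
    then show ?case
      using real_vector.subspace_0[OF subspace_closure_rat_steps] by (simp add: l2_class_zero)
  next
    case (compl A)
    then have A: "A \<in> sets borel" "l2_class (indicator A) \<in> closure rat_steps" by auto
    \<comment> \<open>The half-line up to 1 contains the unit interval, so its indicator stands for
      the constant 1 and has a rational endpoint.\<close>
    have "l2_class (indicator (UNIV - A)) = l2_class (\<lambda>s. indicator {..1} s - indicator A s)"
    proof (subst l2_class_eq_iff)
      show "AE s in leb01. indicator (UNIV - A) s = (indicator {..1} s - indicator A s :: real)"
        by (rule AE_I2) (auto simp: indicator_def)
    qed (use A(1) in \<open>auto intro!: L2_diff indicator_L2\<close>)
    also have "\<dots> = l2_class (indicator {..of_rat 1}) - l2_class (indicator A)"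
      using A by (subst l2_class_diff) (auto intro: indicator_L2)
    finally show ?case
      using A real_vector.subspace_diff[OF subspace_closure_rat_steps rat[of 1]] by auto
  next
    case (union A)
    then have A: "A i \<in> sets borel" "l2_class (indicator (A i)) \<in> closure rat_steps" for i by auto
    have U: "\<Union>(range A) \<in> sets borel" using A(1) by auto
    have "(\<lambda>n. l2_class (\<lambda>s. \<Sum>i<n. indicator (A i) s)) \<longlonglongrightarrow> l2_class (indicator (\<Union>(range A)))"
    proof (rule l2_class_dominated_convergence[OF _ _ one])
      have eq: "(\<Sum>i<n. indicator (A i) s) = (indicator (\<Union>i<n. A i) s :: real)" for n s
        using union(1) by (subst indicator_UN_disjoint) (auto simp: disjoint_family_on_def)
      show "AE s in leb01. \<bar>\<Sum>i<n. indicator (A i) s\<bar> \<le> (1 :: real)" for n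
        unfolding eq by (auto simp: indicator_le_1)
      show "AE s in leb01. (\<lambda>n. \<Sum>i<n. indicator (A i) s :: real) \<longlonglongrightarrow> indicator (\<Union>(range A)) s"
        unfolding eq by (intro AE_I2 LIMSEQ_indicator_UN)
      show "(\<lambda>s. \<Sum>i<n. indicator (A i) s :: real) \<in> borel_measurable leb01" for n
        using A(1) by (intro borel_measurable_sum indicator_measurable_leb01)
    qed (use U in \<open>auto intro: indicator_measurable_leb01\<close>)
    moreover have "l2_class (\<lambda>s. \<Sum>i<n. indicator (A i) s) \<in> closure rat_steps" for n
      using A by (subst l2_class_sum)
        (auto intro: indicator_L2 real_vector.subspace_sum[OF subspace_closure_rat_steps])
    ultimately show ?case
      using U closure_rat_stepsI[of "\<lambda>n. l2_class (\<lambda>s. \<Sum>i<n. indicator (A i) s)"] by blast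
  qed
  then show ?thesis by simp
qed

text \<open>Simple functions dominated by twice the modulus approximate a square-integrable function
  in norm, and each of them is a finite combination of indicators of Borel sets.\<close>

lemma closure_rat_steps: "closure rat_steps = UNIV"
proof -
  have "x \<in> closure rat_steps" for x
  proof -
    obtain f where f: "f \<in> L2" "x = l2_class f" using l2_class_cases by blast
    obtain F where F: "\<And>i. simple_function leb01 (F i)"
        "\<And>s. s \<in> space leb01 \<Longrightarrow> (\<lambda>i. F i s) \<longlonglongrightarrow> f s"
        "\<And>i s. s \<in> space leb01 \<Longrightarrow> dist (F i s) 0 \<le> 2 * dist (f s) 0"
      using borel_measurable_implies_sequence_metric[OF L2_D(1)[OF f(1)], of 0] by blast
    have simple: "l2_class (F i) \<in> closure rat_steps" for i
    proof -
      let ?A = "\<lambda>y. F i -` {y} \<inter> {0..1}"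
      have A: "?A y \<in> sets borel" for y
        using simple_functionD(2)[OF F(1), of i "{y}"] by (auto simp: sets_leb01 sets_restrict_space)
      have fin: "finite (F i ` {0..1})" using simple_functionD(1)[OF F(1), of i] by simp
      have "l2_class (F i) = l2_class (\<lambda>s. \<Sum>y\<in>F i ` {0..1}. y * indicator (?A y) s)"
      proof (subst l2_class_eq_iff)
        have b: "\<bar>F i s\<bar> \<le> Max (abs ` F i ` {0..1})" if "s \<in> {0..1}" for s
          using that fin by (intro Max_ge) auto
        show "F i \<in> L2" using b by (intro L2_bounded borel_measurable_simple_function F(1))
        show "(\<lambda>s. \<Sum>y\<in>F i ` {0..1}. y * indicator (?A y) s) \<in> L2"
          by (intro L2_sum L2_scale indicator_L2 A)
        show "AE s in leb01. F i s = (\<Sum>y\<in>F i ` {0..1}. y * indicator (?A y) s)"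
        proof (rule AE_I2)
          fix s assume "s \<in> space leb01"
          from simple_function_indicator_representation_banach[OF F(1)[of i] this]
          show "F i s = (\<Sum>y\<in>F i ` {0..1}. y * indicator (?A y) s)"
            by (simp only: space_leb01 real_scaleR_def mult.commute)
        qed
      qed
      also have "\<dots> = (\<Sum>y\<in>F i ` {0..1}. y *\<^sub>R l2_class (indicator (?A y)))"
        by (simp only: l2_class_sum[OF L2_scale[OF indicator_L2[OF A]]] l2_class_scale[OF indicator_L2[OF A]])
      also have "\<dots> \<in> closure rat_steps"
        by (intro real_vector.subspace_sum[OF subspace_closure_rat_steps]
            real_vector.subspace_scale[OF subspace_closure_rat_steps] indicator_in_closure_rat_steps A)
      finally show ?thesis .
    qed
    have "(\<lambda>i. l2_class (F i)) \<longlonglongrightarrow> l2_class f"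
    proof (rule l2_class_dominated_convergence)
      show "(\<lambda>s. 2 * \<bar>f s\<bar>) \<in> L2"
        by (rule L2_scale, rule L2_I) (use f(1) L2_D in auto)
      show "F i \<in> borel_measurable leb01" for i by (rule borel_measurable_simple_function[OF F(1)])
      show "f \<in> borel_measurable leb01" by (rule L2_D(1)[OF f(1)])
      show "AE s in leb01. \<bar>F i s\<bar> \<le> 2 * \<bar>f s\<bar>" for i
        using F(3)[of _ i] by (intro AE_I2) (simp add: dist_real_def)
      show "AE s in leb01. (\<lambda>i. F i s) \<longlonglongrightarrow> f s"
        by (rule AE_I2) (rule F(2))
    qed
    then show ?thesis using closure_rat_stepsI[of "\<lambda>i. l2_class (F i)", OF simple] f(2) by blast
  qed
  then show ?thesis by blast
qed

text \<open>Balls with rational radii around a countable dense set form a base. The countable base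
  is what makes differences and inner products of measurable maps into \<open>l2\<close>
  measurable.\<close>

instance l2 :: second_countable_topology
proof
  define B where "B = (\<lambda>(x :: l2, r :: rat). ball x (of_rat r)) ` (rat_steps \<times> UNIV)"
  have "topological_basis B"
  proof (rule topological_basisI)
    fix G and x :: l2 assume "open G" "x \<in> G"
    then obtain e where e: "e > 0" "ball x e \<subseteq> G" by (auto simp: open_contains_ball)
    obtain r :: rat where r: "0 < real_of_rat r" "real_of_rat r < e / 2"
      using of_rat_dense[OF half_gt_zero[OF e(1)]] by blast
    obtain y where y: "y \<in> rat_steps" "dist y x < of_rat r"
      using closure_rat_steps r(1) by (metis UNIV_I closure_approachable)
    have "ball y (of_rat r) \<subseteq> ball x e"
    proof
      fix z assume "z \<in> ball y (of_rat r)"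
      then show "z \<in> ball x e"
        using y(2) r(2) dist_triangle[of x z y] by (simp add: dist_commute)
    qed
    then show "\<exists>b\<in>B. x \<in> b \<and> b \<subseteq> G"
      using y e(2) by (intro bexI[of _ "ball y (of_rat r)"]) (auto simp: B_def)
  qed (auto simp: B_def)
  moreover have "countable B"
    unfolding B_def by (intro countable_image countable_SIGMA countable_rat_steps) auto
  ultimately show "\<exists>B :: l2 set set. countable B \<and> open = generate_topology B"
    using topological_basis_imp_subbasis by blast
qed

text \<open>Preimages of open sets are generators of \<open>L2_borel\<close>. The lemma carries the
  measurability of \<open>f\<close> in the dependence condition over to \<open>l2\<close>.\<close>

lemma l2_class_measurable: "l2_class \<in> measurable L2_borel borel"
proof (rule borel_measurableI)
  fix G :: "l2 set" assume "open G"
  have sp: "space L2_borel = L2"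
    unfolding L2_borel_def by (rule space_measure_of) auto
  have "l2_class -` G \<inter> L2 \<in> {G. G \<subseteq> L2 \<and> (\<forall>f\<in>G. \<exists>e>0. \<forall>g\<in>L2. L2_norm (\<lambda>s. g s - f s) < e \<longrightarrow> g \<in> G)}"
  proof (intro CollectI conjI ballI)
    fix f assume f: "f \<in> l2_class -` G \<inter> L2"
    then obtain e where e: "e > 0" "ball (l2_class f) e \<subseteq> G" using \<open>open G\<close> by (auto simp: open_contains_ball)
    show "\<exists>e>0. \<forall>g\<in>L2. L2_norm (\<lambda>s. g s - f s) < e \<longrightarrow> g \<in> l2_class -` G \<inter> L2"
    proof (intro exI[of _ e] conjI ballI impI)
      fix g assume g: "g \<in> L2" "L2_norm (\<lambda>s. g s - f s) < e"
      then have "dist (l2_class f) (l2_class g) < e"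
        using f unfolding dist_commute[of "l2_class f"]
        by (simp add: dist_norm norm_l2_class L2_diff flip: l2_class_diff)
      then show "g \<in> l2_class -` G \<inter> L2" using e(2) g(1) by auto
    qed (use e in auto)
  qed auto
  then show "l2_class -` G \<inter> space L2_borel \<in> sets L2_borel"
    unfolding sp by (simp only: L2_borel_def) (rule sets_measure_of_conv[THEN equalityD2, THEN subsetD], auto)
qed

text \<open>An open set is a countable union of balls with rational radii around points of
  \<open>rat_steps\<close>, so distances to fixed points decide measurability. In this way a jointly
  measurable process becomes a random element of \<open>l2\<close>.\<close>

lemma borel_measurable_l2I:
  fixes F :: "'a \<Rightarrow> l2"
  assumes "\<And>g. (\<lambda>\<omega>. dist g (F \<omega>)) \<in> borel_measurable M"
  shows "F \<in> borel_measurable M"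
proof (rule borel_measurableI)
  fix G :: "l2 set" assume "open G"
  define B where "B = {(x, r :: rat). x \<in> rat_steps \<and> ball x (of_rat r) \<subseteq> G}"
  have "G = (\<Union>(x, r)\<in>B. ball x (of_rat r))"
  proof (rule antisym)
    show "G \<subseteq> (\<Union>(x, r)\<in>B. ball x (of_rat r))"
    proof
      fix x assume "x \<in> G"
      then obtain e where e: "e > 0" "ball x e \<subseteq> G" using \<open>open G\<close> by (auto simp: open_contains_ball)
      obtain r :: rat where r: "0 < real_of_rat r" "real_of_rat r < e / 2"
        using of_rat_dense[OF half_gt_zero[OF e(1)]] by blast
      obtain y where y: "y \<in> rat_steps" "dist y x < of_rat r"
        using closure_rat_steps r(1) by (metis UNIV_I closure_approachable)
      have "ball y (of_rat r) \<subseteq> ball x e"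
      proof
        fix z assume "z \<in> ball y (of_rat r)"
        then show "z \<in> ball x e"
          using y(2) r(2) dist_triangle[of x z y] by (simp add: dist_commute)
      qed
      then show "x \<in> (\<Union>(x, r)\<in>B. ball x (of_rat r))"
        using y e(2) by (auto simp: B_def intro!: bexI[of _ "(y, r)"])
    qed
  qed (auto simp: B_def)
  then have "y \<in> G \<longleftrightarrow> (\<exists>(x, r)\<in>B. dist x y < of_rat r)" for y
    by (simp only: UN_iff mem_ball split_beta')
  then have "F -` G \<inter> space M = (\<Union>(x, r)\<in>B. {\<omega> \<in> space M. dist x (F \<omega>) < of_rat r})"
    by fastforce
  moreover have "countable B"
    by (rule countable_subset[of _ "rat_steps \<times> UNIV"]) (auto simp: B_def countable_rat_steps)
  moreover have "{\<omega> \<in> space M. dist x (F \<omega>) < of_rat r} \<in> sets M" for x and r :: rat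
    using assms[of x] by measurable
  ultimately show "F -` G \<inter> space M \<in> sets M" by auto
qed

lemma l2_class_rep: "rep_l2 x \<in> L2" "l2_class (rep_l2 x) = x"
  using Quotient3_rep_reflp[OF Quotient3_l2, of x] Quotient3_abs_rep[OF Quotient3_l2, of x]
  by (auto simp: L2_eq_refl l2_class_def)

section \<open>Covariance operators with continuous kernel\<close>

lemma (in pair_sigma_finite)
  fixes f :: "'a \<Rightarrow> real" and g :: "'b \<Rightarrow> real"
  assumes "integrable M1 f" "integrable M2 g"
  shows integrable_product: "integrable (M1 \<Otimes>\<^sub>M M2) (\<lambda>z. f (fst z) * g (snd z))"
    and integral_product: "(\<integral>z. f (fst z) * g (snd z) \<partial>(M1 \<Otimes>\<^sub>M M2)) = (\<integral>x. f x \<partial>M1) * (\<integral>y. g y \<partial>M2)"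
proof -
  have [measurable]: "f \<in> borel_measurable M1" "g \<in> borel_measurable M2" using assms by auto
  show int: "integrable (M1 \<Otimes>\<^sub>M M2) (\<lambda>z. f (fst z) * g (snd z))"
  proof (rule Fubini_integrable)
    have "integrable M1 (\<lambda>x. \<bar>f x\<bar> * (\<integral>y. \<bar>g y\<bar> \<partial>M2))" using assms by simp
    then show "integrable M1 (\<lambda>x. \<integral>y. norm (f (fst (x, y)) * g (snd (x, y))) \<partial>M2)"
      by (simp add: abs_mult)
  qed (use assms in auto)
  show "(\<integral>z. f (fst z) * g (snd z) \<partial>(M1 \<Otimes>\<^sub>M M2)) = (\<integral>x. f x \<partial>M1) * (\<integral>y. g y \<partial>M2)"
    using integral_fst'[OF int] by simp
qed

lemma L2_Cauchy_Schwarz: "f \<in> L2 \<Longrightarrow> g \<in> L2 \<Longrightarrow> \<bar>L2_inner f g\<bar> \<le> L2_norm f * L2_norm g"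
  using Cauchy_Schwarz_ineq2[of "l2_class f" "l2_class g"] by (simp add: inner_l2_class norm_l2_class)

lemma L2_norm_bounded:
  assumes "f \<in> borel_measurable leb01" "\<And>s. s \<in> {0..1} \<Longrightarrow> \<bar>f s\<bar> \<le> c"
  shows "L2_norm f \<le> c"
proof -
  have c: "0 \<le> c" using assms(2)[of 0] by simp
  have "(\<integral>s. (f s)\<^sup>2 \<partial>leb01) \<le> (\<integral>s. c\<^sup>2 \<partial>leb01)"
  proof (rule integral_mono)
    show "integrable leb01 (\<lambda>s. (f s)\<^sup>2)" using L2_bounded[OF assms] by (rule L2_D)
    show "(f s)\<^sup>2 \<le> c\<^sup>2" if "s \<in> space leb01" for s
      using assms(2)[of s] c that by (simp flip: abs_le_square_iff)
  qed simp
  also have "\<dots> = c\<^sup>2" using leb01.prob_space by simp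
  finally show ?thesis unfolding L2_norm_def using c real_sqrt_le_mono real_sqrt_unique by fastforce
qed

lemma continuous_on_measurable_leb01:
  fixes f :: "real \<Rightarrow> real"
  shows "continuous_on {0..1} f \<Longrightarrow> f \<in> borel_measurable leb01"
  using borel_measurable_continuous_on_restrict[of "{0..1}" f]
  by (simp add: measurable_cong_sets[OF sets_leb01 refl])

lemma continuous_on_L2:
  fixes f :: "real \<Rightarrow> real"
  assumes "continuous_on {0..1} f"
  shows "f \<in> L2"
proof -
  have "bounded (f ` {0..1})" using assms by (intro compact_imp_bounded compact_continuous_image) auto
  then obtain c where c: "\<forall>s\<in>{0..1}. \<bar>f s\<bar> \<le> c" by (fastforce simp: bounded_iff)
  then show ?thesis by (intro L2_bounded[of f c] continuous_on_measurable_leb01[OF assms]) auto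
qed

lemma measurable_continuous_square:
  fixes K :: "real \<Rightarrow> real \<Rightarrow> real"
  assumes cont: "continuous_on ({0..1} \<times> {0..1}) (\<lambda>(s, s'). K s s')"
  shows "(\<lambda>z. K (fst z) (snd z)) \<in> borel_measurable (leb01 \<Otimes>\<^sub>M leb01)"
proof -
  have "(\<lambda>z. if z \<in> {0..1} \<times> {0..1} then (\<lambda>(s, s'). K s s') z else 0) \<in> borel_measurable borel"
    by (rule borel_measurable_continuous_on_if) (auto intro: cont continuous_on_const borel_closed closed_Times)
  then have "(\<lambda>z. if z \<in> {0..1} \<times> {0..1} then (\<lambda>(s, s'). K s s') z else 0) \<in> borel_measurable (borel \<Otimes>\<^sub>M borel)"
    by (simp only: borel_prod)
  moreover have "(\<lambda>z. z) \<in> measurable (leb01 \<Otimes>\<^sub>M leb01) (borel \<Otimes>\<^sub>M borel)"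
  proof -
    have id: "(\<lambda>s. s) \<in> borel_measurable leb01" by (rule measurable_restrict_space1) simp
    have "(\<lambda>z. (fst z, snd z)) \<in> measurable (leb01 \<Otimes>\<^sub>M leb01) (borel \<Otimes>\<^sub>M borel)"
      by (intro measurable_Pair measurable_compose[OF measurable_fst id] measurable_compose[OF measurable_snd id])
    then show ?thesis by simp
  qed
  ultimately have "(\<lambda>z. if z \<in> {0..1} \<times> {0..1} then (\<lambda>(s, s'). K s s') z else 0) \<in> borel_measurable (leb01 \<Otimes>\<^sub>M leb01)"
    by (rule measurable_compose[rotated])
  then show ?thesis
    by (rule measurable_cong[THEN iffD1, rotated]) (auto simp: space_pair_measure)
qed

text \<open>The properties from which compactness, symmetry and positivity of the operator follow.
  For the signal, \<open>psd\<close> will hold because the form is a second moment.\<close>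

locale covariance_kernel =
  fixes K :: "real \<Rightarrow> real \<Rightarrow> real"
  assumes cont: "continuous_on ({0..1} \<times> {0..1}) (\<lambda>(s, s'). K s s')"
    and sym: "\<And>s s'. s \<in> {0..1} \<Longrightarrow> s' \<in> {0..1} \<Longrightarrow> K s s' = K s' s"
    and psd: "\<And>g. g \<in> L2 \<Longrightarrow> 0 \<le> L2_inner (integral_operator K g) g"
begin

lemma bound_exists: "\<exists>c. \<forall>s\<in>{0..1}. \<forall>s'\<in>{0..1}. \<bar>K s s'\<bar> \<le> c"
proof -
  have "bounded ((\<lambda>(s, s'). K s s') ` ({0..1} \<times> {0..1}))"
    by (intro compact_imp_bounded compact_continuous_image cont compact_Times) auto
  then show ?thesis by (auto simp: bounded_iff)
qed

definition bound :: real where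
  "bound = (SOME c. \<forall>s\<in>{0..1}. \<forall>s'\<in>{0..1}. \<bar>K s s'\<bar> \<le> c)"

lemma le_bound: "s \<in> {0..1} \<Longrightarrow> s' \<in> {0..1} \<Longrightarrow> \<bar>K s s'\<bar> \<le> bound"
  using someI_ex[OF bound_exists] unfolding bound_def by blast

lemma section_continuous:
  assumes "s \<in> {0..1}"
  shows "continuous_on {0..1} (K s)"
proof -
  have "Pair s ` {0..1} \<subseteq> {0..1} \<times> {0..1}" using assms by auto
  from continuous_on_compose2[OF cont continuous_on_Pair[OF continuous_on_const continuous_on_id] this]
  show ?thesis by simp
qed

lemma section_L2: "s \<in> {0..1} \<Longrightarrow> K s \<in> L2"
  by (intro continuous_on_L2 section_continuous)

lemma norm_section_le: "s \<in> {0..1} \<Longrightarrow> L2_norm (K s) \<le> bound"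
  by (intro L2_norm_bounded L2_D section_L2 le_bound)

lemma integral_operator_eq: "integral_operator K g s = L2_inner (K s) g"
  by (simp add: integral_operator_def L2_inner_def)

text \<open>Uniform continuity of the kernel and Cauchy-Schwarz. One \<open>d\<close> serves all
  \<open>g\<close>, which is the equicontinuity that the Arzela-Ascoli argument for
  \<open>op_compact\<close> requires.\<close>

lemma equicontinuous:
  assumes "e > 0"
  obtains d where "d > 0"
    "\<And>s t g. s \<in> {0..1} \<Longrightarrow> t \<in> {0..1} \<Longrightarrow> \<bar>s - t\<bar> < d \<Longrightarrow> g \<in> L2 \<Longrightarrow>
       \<bar>integral_operator K g s - integral_operator K g t\<bar> \<le> e * L2_norm g"
proof -
  have "uniformly_continuous_on ({0..1} \<times> {0..1}) (\<lambda>(s, s'). K s s')"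
    by (intro compact_uniformly_continuous cont compact_Times) auto
  then obtain d where d: "d > 0" "\<And>x y. x \<in> {0..1} \<times> {0..1} \<Longrightarrow> y \<in> {0..1} \<times> {0..1} \<Longrightarrow> dist y x < d \<Longrightarrow>
      dist ((\<lambda>(s, s'). K s s') y) ((\<lambda>(s, s'). K s s') x) < e"
    using assms unfolding uniformly_continuous_on_def by metis
  have "\<bar>integral_operator K g s - integral_operator K g t\<bar> \<le> e * L2_norm g"
    if st: "s \<in> {0..1}" "t \<in> {0..1}" "\<bar>s - t\<bar> < d" and g: "g \<in> L2" for s t g
  proof -
    have close: "\<bar>K s s' - K t s'\<bar> \<le> e" if "s' \<in> {0..1}" for s'
      using d(2)[of "(t, s')" "(s, s')"] st that by (simp add: dist_Pair_Pair dist_real_def)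
    have "integral_operator K g s - integral_operator K g t = L2_inner (\<lambda>s'. K s s' - K t s') g"
      unfolding integral_operator_eq using st(1,2) g
      by (simp add: section_L2 L2_diff l2_class_diff inner_diff_left flip: inner_l2_class)
    also have "\<bar>\<dots>\<bar> \<le> L2_norm (\<lambda>s'. K s s' - K t s') * L2_norm g"
      using st g by (intro L2_Cauchy_Schwarz L2_diff section_L2)
    also have "\<dots> \<le> e * L2_norm g"
    proof (intro mult_right_mono L2_norm_bounded close)
      show "(\<lambda>s'. K s s' - K t s') \<in> borel_measurable leb01"
        using st by (intro L2_D(1) L2_diff section_L2)
    qed (auto simp: L2_norm_def)
    finally show ?thesis .
  qed
  then show thesis using d(1) that by blast
qed

lemma integral_operator_continuous:
  assumes g: "g \<in> L2"
  shows "continuous_on {0..1} (integral_operator K g)"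
  unfolding continuous_on_iff
proof (intro ballI allI impI)
  fix s e :: real assume s: "s \<in> {0..1}" and e: "e > 0"
  \<comment> \<open>Adding 1 avoids division by zero and makes the final inequality strict.\<close>
  define e' where "e' = e / (L2_norm g + 1)"
  have n: "0 \<le> L2_norm g" by (simp add: L2_norm_def)
  then have "e' > 0" using e by (simp add: e'_def)
  from equicontinuous[OF this] obtain d where d: "d > 0" "\<And>s t g. s \<in> {0..1} \<Longrightarrow> t \<in> {0..1} \<Longrightarrow>
      \<bar>s - t\<bar> < d \<Longrightarrow> g \<in> L2 \<Longrightarrow> \<bar>integral_operator K g s - integral_operator K g t\<bar> \<le> e' * L2_norm g"
    by blast
  have "e' * L2_norm g < e" using n e by (simp add: e'_def field_simps)
  then show "\<exists>d>0. \<forall>t\<in>{0..1}. dist t s < d \<longrightarrow> dist (integral_operator K g t) (integral_operator K g s) < e"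
    using d s g by (intro exI[of _ d]) (fastforce simp: dist_real_def)
qed

lemma integral_operator_L2: "g \<in> L2 \<Longrightarrow> integral_operator K g \<in> L2"
  by (rule continuous_on_L2[OF integral_operator_continuous])

text \<open>The choice of representative does not matter: by \<open>integral_operator_inner\<close>
  the value at every point of the unit interval is an inner product of classes.\<close>

definition op :: "l2 \<Rightarrow> l2" where
  "op x = l2_class (integral_operator K (rep_l2 x))"

lemma integral_operator_inner:
  "s \<in> {0..1} \<Longrightarrow> g \<in> L2 \<Longrightarrow> integral_operator K g s = inner (l2_class (K s)) (l2_class g)"
  by (simp add: integral_operator_eq inner_l2_class section_L2)

lemma op_l2_class: "g \<in> L2 \<Longrightarrow> op (l2_class g) = l2_class (integral_operator K g)"
  unfolding op_def
  by (subst l2_class_eq_iff)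
     (auto simp: integral_operator_L2 l2_class_rep integral_operator_inner intro!: AE_I2)

lemma linear_op: "linear op"
proof (rule linearI)
  fix x y :: l2 and c :: real
  have "op x + op y = l2_class (\<lambda>s. integral_operator K (rep_l2 x) s + integral_operator K (rep_l2 y) s)"
    unfolding op_def by (subst l2_class_add) (auto intro: integral_operator_L2 l2_class_rep)
  also have "\<dots> = op (x + y)"
    unfolding op_def
    by (subst l2_class_eq_iff) (auto simp: integral_operator_L2 L2_add l2_class_rep integral_operator_inner
        inner_add_right intro!: AE_I2)
  finally show "op (x + y) = op x + op y" ..
  have "c *\<^sub>R op x = l2_class (\<lambda>s. c * integral_operator K (rep_l2 x) s)"
    unfolding op_def by (subst l2_class_scale) (auto intro: integral_operator_L2 l2_class_rep)
  also have "\<dots> = op (c *\<^sub>R x)"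
    unfolding op_def
    by (subst l2_class_eq_iff) (auto simp: integral_operator_L2 L2_scale l2_class_rep integral_operator_inner
        intro!: AE_I2)
  finally show "op (c *\<^sub>R x) = c *\<^sub>R op x" ..
qed

lemmas measurable_kernel = measurable_continuous_square[OF cont]

text \<open>Fubini, with a bounded kernel and functions that are integrable because the measure is
  finite. The double integral is the shape in which the operator is later compared with moments of
  the signal.\<close>

lemma inner_op:
  assumes "f \<in> L2" "g \<in> L2"
  shows "integrable (leb01 \<Otimes>\<^sub>M leb01) (\<lambda>z. K (fst z) (snd z) * (f (snd z) * g (fst z)))"
    and "inner (op (l2_class f)) (l2_class g)
       = (\<integral>z. K (fst z) (snd z) * (f (snd z) * g (fst z)) \<partial>(leb01 \<Otimes>\<^sub>M leb01))"
proof -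
  interpret pair_sigma_finite leb01 leb01 ..
  have [measurable]: "f \<in> borel_measurable leb01" "g \<in> borel_measurable leb01"
    "(\<lambda>z. K (fst z) (snd z)) \<in> borel_measurable (leb01 \<Otimes>\<^sub>M leb01)"
    using assms measurable_kernel by (auto intro: L2_D)
  have f1: "integrable leb01 f" "integrable leb01 g"
    using assms[THEN integrable_mult_L2, OF L2_bounded[of "\<lambda>_. 1" 1]] by auto
  have "integrable (leb01 \<Otimes>\<^sub>M leb01) (\<lambda>z. g (fst z) * f (snd z))"
    using f1 by (intro integrable_product)
  then have "integrable (leb01 \<Otimes>\<^sub>M leb01) (\<lambda>z. bound * (f (snd z) * g (fst z)))"
    by (simp add: mult.commute)
  then show int: "integrable (leb01 \<Otimes>\<^sub>M leb01) (\<lambda>z. K (fst z) (snd z) * (f (snd z) * g (fst z)))"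
  proof (rule Bochner_Integration.integrable_bound)
    show "AE z in leb01 \<Otimes>\<^sub>M leb01. norm (K (fst z) (snd z) * (f (snd z) * g (fst z)))
        \<le> norm (bound * (f (snd z) * g (fst z)))"
    proof (rule AE_I2)
      fix z assume "z \<in> space (leb01 \<Otimes>\<^sub>M leb01)"
      then have "\<bar>K (fst z) (snd z)\<bar> \<le> bound" by (intro le_bound) (auto simp: space_pair_measure)
      then have "\<bar>K (fst z) (snd z)\<bar> \<le> \<bar>bound\<bar>" by linarith
      then show "norm (K (fst z) (snd z) * (f (snd z) * g (fst z))) \<le> norm (bound * (f (snd z) * g (fst z)))"
        unfolding real_norm_def abs_mult by (intro mult_right_mono) auto
    qed
  qed measurable
  have "inner (op (l2_class f)) (l2_class g) = (\<integral>s. integral_operator K f s * g s \<partial>leb01)"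
    using assms by (simp add: op_l2_class inner_l2_class integral_operator_L2 L2_inner_def)
  also have "\<dots> = (\<integral>s. (\<integral>s'. K s s' * (f s' * g s) \<partial>leb01) \<partial>leb01)"
    by (simp add: integral_operator_def mult.assoc[symmetric])
  also have "\<dots> = (\<integral>z. K (fst z) (snd z) * (f (snd z) * g (fst z)) \<partial>(leb01 \<Otimes>\<^sub>M leb01))"
    using integral_fst'[OF int] by simp
  finally show "inner (op (l2_class f)) (l2_class g)
       = (\<integral>z. K (fst z) (snd z) * (f (snd z) * g (fst z)) \<partial>(leb01 \<Otimes>\<^sub>M leb01))" .
qed

lemma op_symmetric: "inner (op x) y = inner x (op y)"
proof -
  interpret pair_sigma_finite leb01 leb01 ..
  obtain f g where fg: "f \<in> L2" "g \<in> L2" "x = l2_class f" "y = l2_class g"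
    using l2_class_cases[of x] l2_class_cases[of y] by metis
  have "inner (op y) x = (\<integral>z. K (snd z) (fst z) * (g (fst z) * f (snd z)) \<partial>(leb01 \<Otimes>\<^sub>M leb01))"
    unfolding fg inner_op(2)[OF fg(2,1)]
    using integral_product_swap[of "\<lambda>z. K (fst z) (snd z) * (g (snd z) * f (fst z))"]
      integrable_product_swap_iff inner_op(1)[OF fg(2,1)]
    by (subst integral_product_swap[symmetric]) (auto simp: split_beta')
  also have "\<dots> = inner (op x) y"
    unfolding fg inner_op(2)[OF fg(1,2)]
    by (intro Bochner_Integration.integral_cong refl) (auto simp: space_pair_measure sym mult.commute)
  finally show ?thesis by (simp add: inner_commute)
qed

lemma op_nonneg: "0 \<le> inner (op x) x"
  using l2_class_rep[of x] psd[of "rep_l2 x"]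
  by (metis inner_l2_class integral_operator_L2 op_l2_class)

lemma integral_operator_bound:
  "g \<in> L2 \<Longrightarrow> s \<in> {0..1} \<Longrightarrow> \<bar>integral_operator K g s\<bar> \<le> bound * L2_norm g"
  unfolding integral_operator_eq
  by (rule order_trans[OF L2_Cauchy_Schwarz mult_right_mono[OF norm_section_le]])
     (auto simp: section_L2 L2_norm_def)

lemma bounded_linear_op: "bounded_linear op"
proof (rule bounded_linear_intro[where K = bound])
  fix x
  define g where "g = rep_l2 x"
  have g: "g \<in> L2" "norm x = L2_norm g"
    using norm_l2_class[OF l2_class_rep(1)[of x]] by (simp_all add: g_def l2_class_rep)
  have "norm (op x) = L2_norm (integral_operator K g)"
    unfolding op_def g_def[symmetric] by (rule norm_l2_class[OF integral_operator_L2[OF g(1)]])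
  also have "\<dots> \<le> bound * L2_norm g"
    by (intro L2_norm_bounded L2_D(1)[OF integral_operator_L2] integral_operator_bound g)
  finally show "norm (op x) \<le> norm x * bound" by (simp add: g(2) mult.commute)
qed (auto simp: linear_add[OF linear_op] linear_scale[OF linear_op])

text \<open>Images of unit vectors have continuous representatives that are uniformly bounded and
  equicontinuous. Arzela-Ascoli yields a uniformly convergent subsequence, and uniform convergence
  on the unit interval implies convergence in norm.\<close>

lemma op_compact:
  fixes x :: "nat \<Rightarrow> l2"
  assumes "\<And>n. norm (x n) = 1"
  shows "\<exists>h r. strict_mono (r :: nat \<Rightarrow> nat) \<and> (\<lambda>n. op (x (r n))) \<longlonglongrightarrow> h"
proof -
  define u where "u n = integral_operator K (rep_l2 (x n))" for n
  have n1: "L2_norm (rep_l2 (x n)) = 1" for n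
    using assms[of n] l2_class_rep[of "x n"] by (metis norm_l2_class)
  obtain g k where g: "continuous_on {0..1} g" "strict_mono (k :: nat \<Rightarrow> nat)"
      "\<And>e. 0 < e \<Longrightarrow> \<exists>N. \<forall>n s. n \<ge> N \<and> s \<in> {0..1} \<longrightarrow> norm (u (k n) s - g s) < e"
  proof (rule Arzela_Ascoli[of "{0..1::real}" u bound])
    show "norm (u n s) \<le> bound" if "s \<in> {0..1}" for n s
      using integral_operator_bound[OF l2_class_rep(1)[of "x n"] that] n1 by (simp add: u_def)
    fix s e :: real assume s: "s \<in> {0..1}" and e: "0 < e"
    obtain d where d: "d > 0" "\<And>s t g. s \<in> {0..1} \<Longrightarrow> t \<in> {0..1} \<Longrightarrow> \<bar>s - t\<bar> < d \<Longrightarrow> g \<in> L2 \<Longrightarrow>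
       \<bar>integral_operator K g s - integral_operator K g t\<bar> \<le> (e / 2) * L2_norm g"
      using equicontinuous[OF half_gt_zero[OF e]] by blast
    show "\<exists>d>0. \<forall>n y. y \<in> {0..1} \<and> norm (s - y) < d \<longrightarrow> norm (u n s - u n y) < e"
    proof (intro exI[of _ d] conjI allI impI d(1))
      fix n y assume "y \<in> {0..1} \<and> norm (s - y) < d"
      then have "\<bar>u n s - u n y\<bar> \<le> e / 2"
        using d(2)[OF s, of y "rep_l2 (x n)"] n1 l2_class_rep(1) by (simp add: u_def)
      then show "norm (u n s - u n y) < e" using e by simp
    qed
  qed auto
  have "(\<lambda>n. op (x (k n))) \<longlonglongrightarrow> l2_class g"
  proof (rule LIMSEQ_I)
    fix e :: real assume "0 < e"
    then obtain N where N: "\<And>n s. n \<ge> N \<Longrightarrow> s \<in> {0..1} \<Longrightarrow> \<bar>u (k n) s - g s\<bar> < e / 2"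
      using g(3)[of "e / 2"] by auto
    have "norm (op (x (k n)) - l2_class g) < e" if "n \<ge> N" for n
    proof -
      have L: "u (k n) \<in> L2" "g \<in> L2"
        using integral_operator_L2[OF l2_class_rep(1)] continuous_on_L2[OF g(1)] by (auto simp: u_def)
      have "norm (op (x (k n)) - l2_class g) = L2_norm (\<lambda>s. u (k n) s - g s)"
        unfolding op_def u_def[symmetric] using L by (simp add: L2_diff flip: l2_class_diff norm_l2_class)
      also have "\<dots> \<le> e / 2"
        using N[OF that] L by (intro L2_norm_bounded L2_D L2_diff) (auto intro: less_imp_le)
      finally show ?thesis using \<open>0 < e\<close> by linarith
    qed
    then show "\<exists>N. \<forall>n\<ge>N. norm (op (x (k n)) - l2_class g) < e" by blast
  qed
  then show ?thesis using g(2) by blast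
qed

section \<open>Variational bounds from an eigensystem\<close>

context
  fixes lam :: "nat \<Rightarrow> real" and phi :: "nat \<Rightarrow> real \<Rightarrow> real"
  assumes eigensystem: "eigensystem K lam phi"
begin

lemma eigensystemD:
  assumes "k \<ge> 1"
  shows lam_nonneg: "0 \<le> lam k" and lam_Suc: "lam (Suc k) \<le> lam k" and phi_L2: "phi k \<in> L2"
    and eigenfunction: "AE s in leb01. integral_operator K (phi k) s = lam k * phi k s"
    and L2_inner_phi: "\<And>j. j \<ge> 1 \<Longrightarrow> L2_inner (phi j) (phi k) = (if j = k then 1 else 0)"
  using eigensystem assms unfolding eigensystem_def by blast+

lemma lam_decreasing: "j \<le> k \<Longrightarrow> 1 \<le> j \<Longrightarrow> lam k \<le> lam j"
proof (induction k rule: dec_induct)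
  case (step k)
  then show ?case using lam_Suc[of k] by simp
qed simp

lemma orthonormal_phi: "orthonormal_on {1..} (\<lambda>k. l2_class (phi k))"
  by (simp add: orthonormal_on_def inner_l2_class phi_L2 L2_inner_phi)

lemma op_phi: "k \<ge> 1 \<Longrightarrow> op (l2_class (phi k)) = lam k *\<^sub>R l2_class (phi k)"
  using eigenfunction[of k] phi_L2[of k]
  by (simp add: op_l2_class integral_operator_L2 L2_scale l2_class_eq_iff flip: l2_class_scale)

text \<open>A violation would give, by \<open>top_eigenvector\<close> on the complement
  \<open>W\<close> of the first l - 1 eigenfunctions, an eigenvector with eigenvalue
  \<open>R\<close> above \<open>lam l\<close>. It is orthogonal to the earlier eigenfunctions by
  membership in \<open>W\<close> and to the later ones because their eigenvalues are smaller than
  \<open>R\<close>. The last clause of \<open>eigensystem\<close> then forces it to be zero.\<close>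

lemma quadratic_form_le:
  assumes "l \<ge> 1" and g: "\<And>j. j \<in> {1..<l} \<Longrightarrow> inner g (l2_class (phi j)) = 0"
  shows "inner (op g) g \<le> lam l * (norm g)\<^sup>2"
proof (rule ccontr)
  assume less: "\<not> ?thesis"
  define W where "W = {x. \<forall>j\<in>{1..<l}. inner x (l2_class (phi j)) = 0}"
  have W_eq: "W = (\<Inter>j\<in>{1..<l}. {x. inner x (l2_class (phi j)) = 0})" by (auto simp: W_def)
  have sub: "real_vector.subspace W"
    by (rule real_vector.subspaceI) (auto simp: W_def inner_add_left)
  have closed: "closed W"
    unfolding W_eq by (intro closed_INT ballI closed_Collect_eq continuous_intros)
  have inv: "op x \<in> W" if "x \<in> W" for x
    using that by (auto simp: W_def op_symmetric op_phi)
  obtain h R where h: "h \<in> W" "h \<noteq> 0" "op h = R *\<^sub>R h" "lam l < R"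
    using top_eigenvector[OF bounded_linear_op op_symmetric op_nonneg op_compact sub closed inv, of g "lam l"]
      less g lam_nonneg[OF \<open>l \<ge> 1\<close>] by (auto simp: W_def not_le)
  have orth: "inner h (l2_class (phi k)) = 0" if k: "k \<ge> 1" for k
  proof (cases "k < l")
    case True
    then show ?thesis using h(1) k by (auto simp: W_def)
  next
    case False
    then have "lam k < R" using lam_decreasing[of l k] \<open>l \<ge> 1\<close> h(4) by linarith
    moreover have "R * inner h (l2_class (phi k)) = lam k * inner h (l2_class (phi k))"
      using op_symmetric[of h "l2_class (phi k)"] by (simp add: h(3) op_phi[OF k])
    ultimately show ?thesis by simp
  qed
  define f where "f = rep_l2 h"
  have f: "f \<in> L2" "h = l2_class f" using l2_class_rep[of h] by (auto simp: f_def)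
  have "AE s in leb01. integral_operator K f s = R * f s"
    using h(3) f by (simp add: op_l2_class integral_operator_L2 L2_scale l2_class_eq_iff flip: l2_class_scale)
  moreover have "R \<noteq> 0" using h(4) lam_nonneg[OF \<open>l \<ge> 1\<close>] by simp
  moreover have "\<forall>k\<ge>1. L2_inner f (phi k) = 0"
    using orth f phi_L2 by (simp add: inner_l2_class)
  ultimately have "AE s in leb01. f s = 0"
    using eigensystem f(1) unfolding eigensystem_def by blast
  then have "h = 0" using f l2_class_eq_iff[OF f(1) L2_zero] by (simp add: l2_class_zero)
  then show False using h(2) by simp
qed

end

end

section \<open>Step functions and the empirical operator\<close>

abbreviation cell :: "nat \<Rightarrow> nat \<Rightarrow> real set" where
  "cell p i \<equiv> {real i / real p ..< (real i + 1) / real p}"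

text \<open>The factor makes the indicators of cells of length 1/p unit vectors.\<close>

definition grid :: "nat \<Rightarrow> nat \<Rightarrow> l2" where
  "grid p i = l2_class (\<lambda>s. sqrt (real p) * indicator (cell p i) s)"

lemma cell_subset: "i < p \<Longrightarrow> cell p i \<subseteq> {0..1}"
proof
  fix s assume i: "i < p" and s: "s \<in> cell p i"
  then have "(real i + 1) / real p \<le> 1" by (simp add: field_simps)
  moreover have "0 \<le> real i / real p" by simp
  ultimately show "s \<in> {0..1}" using s unfolding atLeastLessThan_iff atLeastAtMost_iff by linarith
qed

lemma cell_disjoint:
  assumes "i \<noteq> j"
  shows "cell p i \<inter> cell p j = {}"
proof -
  have *: "cell p i \<inter> cell p j = {}" if "i < j" for i j
  proof -
    have "(real i + 1) / real p \<le> real j / real p" using that by (intro divide_right_mono) auto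
    then show ?thesis by auto
  qed
  show ?thesis using assms *[of i j] *[of j i] by (cases i j rule: linorder_cases) auto
qed

lemma measure_cell: "i < p \<Longrightarrow> measure leb01 (cell p i) = 1 / real p"
  using cell_subset[of i p]
  by (subst measure_restrict_space) (auto simp: field_simps divide_right_mono)

lemma grid_L2: "(\<lambda>s. sqrt (real p) * indicator (cell p i) s) \<in> L2"
  by (intro L2_scale indicator_L2) simp

lemma orthonormal_grid: "orthonormal_on {..<p} (grid p)"
  unfolding orthonormal_on_def
proof (intro ballI)
  fix i j assume i: "i \<in> {..<p}" and "j \<in> {..<p}"
  have sq: "sqrt (real p) * a * (sqrt (real p) * b) = real p * (a * b)" for a b
  proof -
    have "sqrt (real p) * a * (sqrt (real p) * b) = sqrt (real p) * sqrt (real p) * (a * b)"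
      by (simp only: mult_ac)
    then show ?thesis by simp
  qed
  have "inner (grid p i) (grid p j) = (\<integral>s. real p * indicator (cell p i \<inter> cell p j) s \<partial>leb01)"
    unfolding grid_def inner_l2_class[OF grid_L2 grid_L2] L2_inner_def sq indicator_inter_arith ..
  also have "\<dots> = real p * measure leb01 (cell p i \<inter> cell p j \<inter> space leb01)"
    by (simp only: integral_mult_right_zero Bochner_Integration.integral_indicator)
  also have "\<dots> = (if i = j then 1 else 0)"
  proof (cases "i = j")
    case True
    have "cell p i \<inter> cell p i \<inter> space leb01 = cell p i" using cell_subset[of i p] i by auto
    then show ?thesis using measure_cell[of i p] i True by simp
  next
    case False
    show ?thesis unfolding cell_disjoint[OF False] using False by simp
  qed
  finally show "inner (grid p i) (grid p j) = (if i = j then 1 else 0)" .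
qed

definition embed :: "nat \<Rightarrow> (nat \<Rightarrow> real) \<Rightarrow> l2" where
  "embed p v = (\<Sum>i<p. v i *\<^sub>R grid p i)"

lemma step_function_L2: "step_function p v \<in> L2"
proof -
  have "step_function p v = (\<lambda>s. \<Sum>i<p. (v $ i) * (sqrt (real p) * indicator (cell p i) s))"
    by (auto simp: step_function_def mult_ac)
  then show ?thesis by (auto intro!: L2_sum L2_scale indicator_L2)
qed

lemma l2_class_step_function: "l2_class (step_function p v) = embed p (\<lambda>i. v $ i)"
proof -
  have "step_function p v = (\<lambda>s. \<Sum>i<p. (v $ i) * (sqrt (real p) * indicator (cell p i) s))"
    by (auto simp: step_function_def mult_ac)
  then show ?thesis
    by (simp add: embed_def grid_def l2_class_sum L2_scale[OF grid_L2] l2_class_scale[OF grid_L2])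
qed

lemma inner_embed: "inner (embed p v) (embed p w) = (\<Sum>i<p. v i * w i)"
  unfolding embed_def by (rule inner_orthonormal_sums[OF orthonormal_grid finite_lessThan])

lemma inner_embed_grid: "i < p \<Longrightarrow> inner (embed p v) (grid p i) = v i"
  unfolding embed_def by (rule inner_orthonormal_sum[OF orthonormal_grid finite_lessThan]) simp

lemma embed_cong: "(\<And>i. i < p \<Longrightarrow> v i = w i) \<Longrightarrow> embed p v = embed p w"
  unfolding embed_def by (intro sum.cong) auto

lemma embed_sum: "embed p (\<lambda>i. \<Sum>k\<in>I. c k * v k i) = (\<Sum>k\<in>I. c k *\<^sub>R embed p (v k))"
  unfolding embed_def scaleR_sum_right scaleR_sum_left by (subst sum.swap) simp

lemma embed_scale: "embed p (\<lambda>i. c * v i) = c *\<^sub>R embed p v"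
  unfolding embed_def scaleR_sum_right by simp

text \<open>The matrix acting on step functions in the orthonormal coordinates
  \<open>grid p\<close>; on their orthogonal complement the operator is zero.\<close>

definition grid_op :: "nat \<Rightarrow> real mat \<Rightarrow> l2 \<Rightarrow> l2" where
  "grid_op p A x = embed p (\<lambda>i. \<Sum>j<p. A $$ (i, j) * inner x (grid p j))"

lemma linear_grid_op: "linear (grid_op p A)"
  by (rule linearI)
     (auto simp: grid_op_def embed_def inner_add_left distrib_left sum.distrib scaleR_add_left
        scaleR_sum_right sum_distrib_left mult_ac)

lemma inner_grid_op: "inner (grid_op p A x) y = (\<Sum>i<p. \<Sum>j<p. A $$ (i, j) * inner x (grid p j) * inner y (grid p i))"
  unfolding grid_op_def embed_def inner_sum_left
  by (simp add: sum_distrib_right inner_commute)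

lemma grid_op_symmetric:
  assumes "\<And>i j. i < p \<Longrightarrow> j < p \<Longrightarrow> A $$ (i, j) = A $$ (j, i)"
  shows "inner (grid_op p A x) y = inner x (grid_op p A y)"
  unfolding inner_commute[of x] inner_grid_op
  by (subst sum.swap) (auto simp: assms mult_ac intro!: sum.cong)

lemma grid_op_embed: "grid_op p A (embed p v) = embed p (\<lambda>i. \<Sum>j<p. A $$ (i, j) * v j)"
  unfolding grid_op_def by (intro embed_cong sum.cong) (auto simp: inner_embed_grid)

text \<open>In a Schur decomposition of \<open>A\<close> with diagonal \<open>es\<close> the
  embedded columns of \<open>P\<close> are a triangular basis, and orthonormalising it keeps the
  order of \<open>es\<close>. The order matters because the l-th entry must be the l-th largest
  eigenvalue. Vectors orthogonal to the basis are orthogonal to all grid vectors, whence the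
  statement on the kernel.\<close>

lemma symmetric_matrix_eigenbasis:
  fixes A :: "real mat"
  assumes A: "A \<in> carrier_mat p p" and sym: "\<And>i j. i < p \<Longrightarrow> j < p \<Longrightarrow> A $$ (i, j) = A $$ (j, i)"
    and cp: "char_poly A = (\<Prod>e\<leftarrow>es. [:- e, 1:])"
  obtains q where "orthonormal_on {1..p} q" "\<And>j. j \<in> {1..p} \<Longrightarrow> grid_op p A (q j) = (es ! (j - 1)) *\<^sub>R q j"
    "\<And>w. (\<And>j. j \<in> {1..p} \<Longrightarrow> inner w (q j) = 0) \<Longrightarrow> grid_op p A w = 0"
    "length es = p"
proof -
  obtain B P Q where "schur_decomposition A es = (B, P, Q)" by (cases "schur_decomposition A es") auto
  from schur_decomposition[OF A cp this]
  have sim: "similar_mat_wit A B P Q" and ut: "upper_triangular B" and diag: "diag_mat B = es" by auto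
  note D = similar_mat_witD2[OF A sim]
  have len: "length es = p" using D diag by (auto simp: diag_mat_def)
  have Bjj: "B $$ (j, j) = es ! j" if "j < p" for j
    using diag[symmetric] that D by (simp add: diag_mat_def)
  have AP: "A * P = P * B"
  proof -
    have "A * P = P * B * (Q * P)" using D by (simp add: assoc_mult_mat[of _ p p _ p _ p])
    then show ?thesis using D by simp
  qed
  have entry: "(\<Sum>k<p. M $$ (i, k) * N $$ (k, j)) = (M * N) $$ (i, j)"
    if "M \<in> carrier_mat p p" "N \<in> carrier_mat p p" "i < p" "j < p" for M N :: "real mat" and i j
    using that by (auto simp: scalar_prod_def atLeast0LessThan)
  \<comment> \<open>Basis vectors are counted from 1 and matrix columns from 0.\<close>
  define b where "b j = embed p (\<lambda>i. P $$ (i, j - 1))" for j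
  have tri: "grid_op p A (b j) - (es ! (j - 1)) *\<^sub>R b j \<in> span (b ` {1..<j})" if j: "j \<in> {1..p}" for j
  proof -
    have j1: "j - 1 < p" using j by auto
    have "grid_op p A (b j) = embed p (\<lambda>i. \<Sum>k<p. B $$ (k, j - 1) * P $$ (i, k))"
      unfolding b_def grid_op_embed
    proof (rule embed_cong)
      fix i assume i: "i < p"
      have "(\<Sum>k<p. A $$ (i, k) * P $$ (k, j - 1)) = (P * B) $$ (i, j - 1)"
        using entry[OF A D(6) i j1] AP by simp
      also have "\<dots> = (\<Sum>k<p. B $$ (k, j - 1) * P $$ (i, k))"
        using entry[OF D(6) D(5) i j1] by (simp add: mult.commute)
      finally show "(\<Sum>k<p. A $$ (i, k) * P $$ (k, j - 1)) = (\<Sum>k<p. B $$ (k, j - 1) * P $$ (i, k))" .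
    qed
    also have "\<dots> = (\<Sum>k<p. B $$ (k, j - 1) *\<^sub>R b (Suc k))"
      unfolding b_def by (subst embed_sum) simp
    also have "\<dots> = (\<Sum>k\<in>{..<p} \<inter> {..j - 1}. B $$ (k, j - 1) *\<^sub>R b (Suc k))"
    proof (rule sum.mono_neutral_right)
      have "B $$ (k, j - 1) = 0" if "k < p" "j - 1 < k" for k
        using ut D(5) that by (auto simp: upper_triangular_def)
      then show "\<forall>k\<in>{..<p} - {..<p} \<inter> {..j - 1}. B $$ (k, j - 1) *\<^sub>R b (Suc k) = 0"
        by (auto simp: not_le)
    qed auto
    also have "{..<p} \<inter> {..j - 1} = insert (j - 1) {..<j - 1}" using j by auto
    also have "(\<Sum>k\<in>insert (j - 1) {..<j - 1}. B $$ (k, j - 1) *\<^sub>R b (Suc k))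
        = (es ! (j - 1)) *\<^sub>R b j + (\<Sum>k<j - 1. B $$ (k, j - 1) *\<^sub>R b (Suc k))"
      using j Bjj[OF j1] by simp
    finally have "grid_op p A (b j) - (es ! (j - 1)) *\<^sub>R b j = (\<Sum>k<j - 1. B $$ (k, j - 1) *\<^sub>R b (Suc k))"
      by simp
    also have "\<dots> \<in> span (b ` {1..<j})"
      by (intro span_sum span_scale span_base) auto
    finally show ?thesis .
  qed
  have indep: "b j \<notin> span (b ` {1..<j})" if j: "j \<in> {1..p}" for j
  proof
    assume mem: "b j \<in> span (b ` {1..<j})"
    \<comment> \<open>Row \<open>j - 1\<close> of \<open>Q\<close>, the inverse of \<open>P\<close>,
      is the functional dual to \<open>b j\<close>: it is 1 there and 0 on the other basis
      vectors.\<close>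
    define f where "f x = (\<Sum>i<p. Q $$ (j - 1, i) * inner x (grid p i))" for x
    have f_b: "f (b k) = (if k = j then 1 else 0)" if k: "k \<in> {1..p}" for k
    proof -
      have "f (b k) = (\<Sum>i<p. Q $$ (j - 1, i) * P $$ (i, k - 1))"
        unfolding f_def b_def by (intro sum.cong) (auto simp: inner_embed_grid)
      also have "\<dots> = (Q * P) $$ (j - 1, k - 1)" using entry[OF D(7) D(6)] j k by auto
      also have "\<dots> = (if k = j then 1 else 0)" using D(2) j k by auto
      finally show ?thesis .
    qed
    have "linear f"
      by (rule linearI) (auto simp: f_def inner_add_left distrib_left sum.distrib sum_distrib_left mult_ac)
    moreover have "f x = 0" if "x \<in> b ` {1..<j}" for x
      using that f_b j by auto
    ultimately have "f (b j) = 0" using mem linear_eq_0_on_span by blast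
    then show False using f_b[OF j] by simp
  qed
  obtain q where q: "orthonormal_on {1..p} q" "\<forall>j\<in>{1..p}. grid_op p A (q j) = (es ! (j - 1)) *\<^sub>R q j"
      "span (q ` {1..p}) = span (b ` {1..p})"
    using triangular_orthonormal_eigenbasis[OF linear_grid_op grid_op_symmetric[OF sym] indep tri] by blast
  have kernel: "grid_op p A w = 0" if w: "\<And>j. j \<in> {1..p} \<Longrightarrow> inner w (q j) = 0" for w
  proof -
    have lin: "linear (\<lambda>x. inner w x)" by (rule linearI) (auto simp: inner_add_right)
    have wb: "inner w x = 0" if "x \<in> span (b ` {1..p})" for x
      using that unfolding q(3)[symmetric] by (rule linear_eq_0_on_span[OF lin, rotated]) (use w in auto)
    have "inner w (grid p i) = 0" if i: "i < p" for i
    proof -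
      \<comment> \<open>Since \<open>P * Q\<close> is the identity, column i of \<open>Q\<close>
        holds the coordinates of the i-th grid vector in the basis \<open>b\<close>.\<close>
      have "embed p (\<lambda>i'. \<Sum>k<p. Q $$ (k, i) * P $$ (i', k)) = embed p (\<lambda>i'. if i' = i then 1 else 0)"
      proof (rule embed_cong)
        fix i' assume i': "i' < p"
        have "(\<Sum>k<p. Q $$ (k, i) * P $$ (i', k)) = (P * Q) $$ (i', i)"
          using entry[OF D(6) D(7) i' i] by (simp add: mult.commute)
        then show "(\<Sum>k<p. Q $$ (k, i) * P $$ (i', k)) = (if i' = i then 1 else 0)" using D(1) i i' by simp
      qed
      also have "\<dots> = grid p i" unfolding embed_def using i by (simp add: if_distrib[of "\<lambda>x. x *\<^sub>R _"] cong: if_cong)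
      finally have "grid p i = (\<Sum>k<p. Q $$ (k, i) *\<^sub>R b (Suc k))" unfolding b_def by (subst (asm) embed_sum) simp
      also have "\<dots> \<in> span (b ` {1..p})" by (intro span_sum span_scale span_base) auto
      finally show ?thesis by (rule wb)
    qed
    then show ?thesis by (simp add: grid_op_def embed_def)
  qed
  show thesis using q kernel len by (intro that[of q]) auto
qed

text \<open>The factor cancels the one in \<open>grid\<close>: this is the step function with value
  \<open>y i\<close> on cell i, as \<open>data_curve_class\<close> confirms.\<close>

definition data_curve :: "nat \<Rightarrow> (nat \<Rightarrow> real) \<Rightarrow> l2" where
  "data_curve p y = (1 / sqrt (real p)) *\<^sub>R embed p y"

lemma inner_data_curve: "inner (data_curve p y) g = (1 / sqrt (real p)) * (\<Sum>i<p. y i * inner g (grid p i))"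
  by (simp add: data_curve_def embed_def inner_sum_left inner_commute[of "grid p _" g])

text \<open>The two factors \<open>1 / sqrt p\<close> of the data curves combine to 1/p. Thus the
  sample covariance matrix divided by p is exactly the empirical covariance operator of the step
  functions built from the data.\<close>

lemma inner_empirical_operator:
  assumes Y: "Y \<in> carrier_mat p T"
  shows "inner ((1 / real p) *\<^sub>R grid_op p (sample_cov T Y) g) h
    = (\<Sum>t<T. inner (data_curve p (\<lambda>i. Y $$ (i, t))) g * inner (data_curve p (\<lambda>i. Y $$ (i, t))) h) / real T"
proof -
  have entry: "sample_cov T Y $$ (i, j) = (\<Sum>t<T. Y $$ (i, t) * Y $$ (j, t)) / real T" if "i < p" "j < p" for i j
    using that Y by (auto simp: sample_cov_def scalar_prod_def atLeast0LessThan)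
  define c where "c i = inner g (grid p i)" for i
  define d where "d i = inner h (grid p i)" for i
  have "inner ((1 / real p) *\<^sub>R grid_op p (sample_cov T Y) g) h
      = (1 / real p) * (\<Sum>i<p. \<Sum>j<p. (\<Sum>t<T. Y $$ (i, t) * Y $$ (j, t)) / real T * c j * d i)"
    unfolding inner_scaleR_left inner_grid_op c_def d_def by (intro arg_cong2[of _ _ _ _ "(*)"] sum.cong) (auto simp: entry)
  also have "\<dots> = (\<Sum>i<p. \<Sum>j<p. \<Sum>t<T. (1 / real p) * (Y $$ (i, t) * Y $$ (j, t)) * c j * d i) / real T"
    by (simp add: sum_distrib_left sum_distrib_right sum_divide_distrib mult_ac)
  also have "(\<Sum>i<p. \<Sum>j<p. \<Sum>t<T. (1 / real p) * (Y $$ (i, t) * Y $$ (j, t)) * c j * d i)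
      = (\<Sum>i<p. \<Sum>t<T. \<Sum>j<p. (1 / real p) * (Y $$ (i, t) * Y $$ (j, t)) * c j * d i)"
    by (intro sum.cong refl sum.swap)
  also have "\<dots> = (\<Sum>t<T. \<Sum>i<p. \<Sum>j<p. (1 / real p) * (Y $$ (i, t) * Y $$ (j, t)) * c j * d i)"
    by (rule sum.swap)
  also have "\<dots> = (\<Sum>t<T. inner (data_curve p (\<lambda>i. Y $$ (i, t))) g * inner (data_curve p (\<lambda>i. Y $$ (i, t))) h)"
  proof (rule sum.cong[OF refl])
    fix t
    have "inner (data_curve p (\<lambda>i. Y $$ (i, t))) g * inner (data_curve p (\<lambda>i. Y $$ (i, t))) h
        = (1 / sqrt (real p) * (1 / sqrt (real p))) * ((\<Sum>i<p. Y $$ (i, t) * d i) * (\<Sum>j<p. Y $$ (j, t) * c j))"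
      unfolding inner_data_curve c_def d_def by (simp add: mult_ac)
    also have "\<dots> = (\<Sum>i<p. \<Sum>j<p. (1 / real p) * (Y $$ (i, t) * Y $$ (j, t)) * c j * d i)"
      unfolding sum_product unfolding sum_distrib_left
      by (intro sum.cong refl) (simp add: mult_ac flip: real_sqrt_mult)
    finally show "(\<Sum>i<p. \<Sum>j<p. (1 / real p) * (Y $$ (i, t) * Y $$ (j, t)) * c j * d i)
        = inner (data_curve p (\<lambda>i. Y $$ (i, t))) g * inner (data_curve p (\<lambda>i. Y $$ (i, t))) h" ..
  qed
  finally show ?thesis .
qed

lemma sample_cov_symmetric:
  "Y \<in> carrier_mat p T \<Longrightarrow> i < p \<Longrightarrow> j < p \<Longrightarrow> sample_cov T Y $$ (i, j) = sample_cov T Y $$ (j, i)"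
  by (auto simp: sample_cov_def scalar_prod_def mult.commute)

lemma form_le_imp_norm_le:
  fixes x :: "'a::real_inner"
  assumes "0 \<le> c" "\<And>y. \<bar>inner x y\<bar> \<le> c * norm y"
  shows "norm x \<le> c"
proof (cases "x = 0")
  case False
  have "norm x * norm x \<le> c * norm x"
    using assms(2)[of x] by (simp add: dot_square_norm power2_eq_square)
  then show ?thesis using False by simp
qed (use assms in simp)

section \<open>Estimation error for a fixed outcome\<close>

context covariance_kernel
begin

text \<open>Davis-Kahan for \<open>op\<close> and the embedded matrix divided by p. The premise on
  \<delta> bounds bilinear forms; it becomes a bound in operator norm by
  \<open>form_le_imp_norm_le\<close>.\<close>

lemma estimator_error:
  assumes eigensystem: "eigensystem K lam phi" and "l \<ge> 1" and gap: "eigengap lam l \<noteq> 0"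
    and Y: "Y \<in> carrier_mat p T" and "l \<le> p"
    and psi: "unit_eigenvector (sample_cov T Y) l \<psi>"
    and sign: "L2_inner (phi l) (step_function p \<psi>) \<ge> 0"
    and "0 \<le> \<delta>"
    and \<delta>: "\<And>g h. \<bar>(\<Sum>t<T. inner (data_curve p (\<lambda>i. Y $$ (i, t))) g
                  * inner (data_curve p (\<lambda>i. Y $$ (i, t))) h) / real T - inner (op g) h\<bar> \<le> \<delta> * norm g * norm h"
  shows "L2_norm (\<lambda>s. phi l s - step_function p \<psi> s) \<le> 2 * sqrt 2 * \<delta> / eigengap lam l"
proof -
  let ?A = "sample_cov T Y"
  have "p > 0" using \<open>l \<ge> 1\<close> \<open>l \<le> p\<close> by simp
  have A: "?A \<in> carrier_mat p p" using Y by (auto simp: sample_cov_def)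
  obtain \<mu> where \<mu>: "nth_largest_eigenvalue ?A l \<mu>" "eigenvector ?A \<psi> \<mu>"
      and unit: "(\<Sum>i<dim_vec \<psi>. (\<psi> $ i)\<^sup>2) = 1"
    using psi by (auto simp: unit_eigenvector_def)
  have \<psi>: "\<psi> \<in> carrier_vec p" "?A *\<^sub>v \<psi> = \<mu> \<cdot>\<^sub>v \<psi>"
    using \<mu>(2) A by (auto simp: eigenvector_def)
  obtain es where es: "char_poly ?A = (\<Prod>e\<leftarrow>es. [:- e, 1:])" "sorted_wrt (\<ge>) es" "\<mu> = es ! (l - 1)"
    using \<mu>(1) by (auto simp: nth_largest_eigenvalue_def)
  obtain q where q: "orthonormal_on {1..p} q"
      "\<And>j. j \<in> {1..p} \<Longrightarrow> grid_op p ?A (q j) = (es ! (j - 1)) *\<^sub>R q j"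
      "\<And>w. (\<And>j. j \<in> {1..p} \<Longrightarrow> inner w (q j) = 0) \<Longrightarrow> grid_op p ?A w = 0"
      and len: "length es = p"
    using symmetric_matrix_eigenbasis[OF A sample_cov_symmetric[OF Y] es(1)] by blast
  define B where "B x = (1 / real p) *\<^sub>R grid_op p ?A x" for x
  define \<kappa> where "\<kappa> j = es ! (j - 1) / real p" for j
  have linB: "linear B"
    by (rule linearI) (simp_all add: B_def linear_add[OF linear_grid_op] linear_scale[OF linear_grid_op] scaleR_add_right)
  have form: "inner (B g) h = (\<Sum>t<T. inner (data_curve p (\<lambda>i. Y $$ (i, t))) g
                  * inner (data_curve p (\<lambda>i. Y $$ (i, t))) h) / real T" for g h
    unfolding B_def by (rule inner_empirical_operator[OF Y])
  have Bq: "B (q j) = \<kappa> j *\<^sub>R q j" if "j \<in> {1..p}" for j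
    using q(2)[OF that] by (simp add: B_def \<kappa>_def)
  \<comment> \<open>Needed for \<open>B_le\<close>: the component of \<open>g\<close> outside the
    span of the basis adds nothing to the form of \<open>B\<close> but does add to the norm, so the
    bound survives only for a nonnegative eigenvalue.\<close>
  have \<kappa>_nonneg: "0 \<le> \<kappa> j" if "j \<in> {1..p}" for j
  proof -
    have "0 \<le> inner (B (q j)) (q j)"
      unfolding form by (intro divide_nonneg_nonneg sum_nonneg) auto
    also have "\<dots> = \<kappa> j" using Bq[OF that] orthonormal_onD[OF q(1) that that] by simp
    finally show ?thesis .
  qed
  have \<kappa>_dec: "\<kappa> k \<le> \<kappa> j" if "1 \<le> j" "j \<le> k" "k \<le> p" for j k
  proof (cases "j = k")
    case False
    then have "j - 1 < k - 1" "k - 1 < length es" using that len by auto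
    then have "es ! (k - 1) \<le> es ! (j - 1)" using sorted_wrt_nth_less[OF es(2)] by blast
    then show ?thesis unfolding \<kappa>_def by (intro divide_right_mono) auto
  qed simp
  have B_le: "inner (B g) g \<le> \<kappa> l * (norm g)\<^sup>2" if g: "\<And>j. j \<in> {1..<l} \<Longrightarrow> inner g (q j) = 0" for g
  proof -
    obtain w where w: "g = (\<Sum>j\<in>{1..p}. inner g (q j) *\<^sub>R q j) + w" "\<And>j. j \<in> {1..p} \<Longrightarrow> inner w (q j) = 0"
        "(norm g)\<^sup>2 = (\<Sum>j\<in>{1..p}. (inner g (q j))\<^sup>2) + (norm w)\<^sup>2"
      using orthonormal_decomposition[OF q(1), of g] by blast
    have "B w = 0" using q(3)[OF w(2)] by (simp add: B_def)
    then have "B g = (\<Sum>j\<in>{1..p}. B (inner g (q j) *\<^sub>R q j))"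
      by (subst w(1)) (simp add: linear_add[OF linB] linear_sum[OF linB])
    also have "\<dots> = (\<Sum>j\<in>{1..p}. (inner g (q j) * \<kappa> j) *\<^sub>R q j)"
      by (intro sum.cong refl) (simp add: linear_scale[OF linB] Bq)
    finally have "inner (B g) g = (\<Sum>j\<in>{1..p}. \<kappa> j * (inner g (q j))\<^sup>2)"
      by (simp add: inner_sum_left inner_commute[of "q _" g] power2_eq_square mult_ac)
    also have "\<dots> \<le> (\<Sum>j\<in>{1..p}. \<kappa> l * (inner g (q j))\<^sup>2)"
    proof (rule sum_mono)
      fix j assume j: "j \<in> {1..p}"
      show "\<kappa> j * (inner g (q j))\<^sup>2 \<le> \<kappa> l * (inner g (q j))\<^sup>2"
      proof (cases "j < l")
        case False
        then show ?thesis using j \<open>l \<ge> 1\<close> by (intro mult_right_mono \<kappa>_dec) auto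
      qed (use g[of j] j in simp)
    qed
    also have "\<dots> \<le> \<kappa> l * (norm g)\<^sup>2"
      unfolding w(3) sum_distrib_left[symmetric] using \<kappa>_nonneg[of l] \<open>l \<ge> 1\<close> \<open>l \<le> p\<close>
      by (intro mult_left_mono) auto
    finally show ?thesis .
  qed
  define v where "v = l2_class (step_function p \<psi>)"
  have v_embed: "v = embed p (\<lambda>i. \<psi> $ i)" by (simp add: v_def l2_class_step_function)
  have "B v = (1 / real p) *\<^sub>R embed p (\<lambda>i. (?A *\<^sub>v \<psi>) $ i)"
    unfolding B_def v_embed grid_op_embed using A \<psi>(1)
    by (intro arg_cong[of _ _ "scaleR _"] embed_cong) (auto simp: scalar_prod_def atLeast0LessThan)
  also have "\<dots> = (1 / real p) *\<^sub>R embed p (\<lambda>i. \<mu> * \<psi> $ i)"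
    unfolding \<psi>(2) using \<psi>(1) by (intro arg_cong[of _ _ "scaleR _"] embed_cong) auto
  also have "\<dots> = \<kappa> l *\<^sub>R v" by (simp add: embed_scale v_embed \<kappa>_def es(3))
  finally have Bv: "B v = \<kappa> l *\<^sub>R v" .
  have "(norm v)\<^sup>2 = 1"
    using unit \<psi>(1) unfolding power2_norm_eq_inner v_embed inner_embed by (simp add: power2_eq_square)
  then have nv: "norm v = 1" using real_sqrt_unique[of "norm v" 1] by simp
  have phi: "phi l \<in> L2" using phi_L2[OF eigensystem \<open>l \<ge> 1\<close>] .
  define \<alpha> where "\<alpha> = eigengap lam l"
  have dec: "lam k \<le> lam j" if "1 \<le> j" "j \<le> k" for j k
    using lam_decreasing[OF eigensystem] that by blast
  have \<alpha>1: "\<alpha> \<le> lam l - lam (l + 1)" by (auto simp: \<alpha>_def eigengap_def)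
  \<comment> \<open>For \<open>l = 1\<close> the range is empty, in accordance with the convention
    in \<open>eigengap\<close>.\<close>
  have \<alpha>2: "lam l + \<alpha> \<le> lam k" if "k \<in> {1..<l}" for k
  proof -
    have "\<alpha> \<le> lam (l - 1) - lam l" using that by (auto simp: \<alpha>_def eigengap_def)
    moreover have "lam (l - 1) \<le> lam k" using that by (intro dec) auto
    ultimately show ?thesis by linarith
  qed
  have "\<alpha> \<ge> 0"
    using dec[of l "l + 1"] dec[of "l - 1" l] \<open>l \<ge> 1\<close> by (auto simp: \<alpha>_def eigengap_def)
  then have "\<alpha> > 0" using gap by (simp add: \<alpha>_def)
  have "norm (l2_class (phi l) - v) \<le> 2 * sqrt 2 * \<delta> / \<alpha>"
  proof (rule davis_kahan[where A = op and B = B and l = l and \<phi> = "\<lambda>k. l2_class (phi k)" and \<psi> = q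
        and la = lam and \<kappa> = \<kappa>, OF linear_op op_symmetric linB _ _ \<open>l \<ge> 1\<close> \<open>\<alpha> > 0\<close>])
    show "orthonormal_on {1..l} (\<lambda>k. l2_class (phi k))"
      by (rule orthonormal_on_subset[OF orthonormal_phi[OF eigensystem]]) auto
    show "orthonormal_on {1..l} q"
      using \<open>l \<le> p\<close> by (intro orthonormal_on_subset[OF q(1)]) auto
    show "op (l2_class (phi k)) = lam k *\<^sub>R l2_class (phi k)" if "k \<in> {1..l}" for k
      using that by (intro op_phi[OF eigensystem]) auto
    show "lam l + \<alpha> \<le> lam k" if "k \<in> {1..<l}" for k using \<alpha>2[OF that] .
    show "inner (op g) g \<le> lam l * (norm g)\<^sup>2" if "\<And>j. j \<in> {1..<l} \<Longrightarrow> inner g (l2_class (phi j)) = 0" for g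
      using quadratic_form_le[OF eigensystem \<open>l \<ge> 1\<close> that] .
    show "inner (op g) g \<le> (lam l - \<alpha>) * (norm g)\<^sup>2"
      if "\<And>j. j \<in> {1..l} \<Longrightarrow> inner g (l2_class (phi j)) = 0" for g
    proof -
      have "inner (op g) g \<le> lam (l + 1) * (norm g)\<^sup>2"
        by (rule quadratic_form_le[OF eigensystem]) (use that in auto)
      also have "\<dots> \<le> (lam l - \<alpha>) * (norm g)\<^sup>2"
        using \<alpha>1 by (intro mult_right_mono) auto
      finally show ?thesis .
    qed
    show "B (q k) = \<kappa> k *\<^sub>R q k" if "k \<in> {1..l}" for k
      using that \<open>l \<le> p\<close> by (intro Bq) auto
    show "\<kappa> l \<le> \<kappa> k" if "k \<in> {1..l}" for k using that \<open>l \<le> p\<close> by (intro \<kappa>_dec) auto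
    show "inner (B g) g \<le> \<kappa> l * (norm g)\<^sup>2" if "\<And>j. j \<in> {1..<l} \<Longrightarrow> inner g (q j) = 0" for g
      using B_le[OF that] .
    show "norm (op g - B g) \<le> \<delta> * norm g" for g
    proof (rule form_le_imp_norm_le)
      show "\<bar>inner (op g - B g) y\<bar> \<le> \<delta> * norm g * norm y" for y
        using \<delta>[of g y] unfolding form[symmetric] inner_diff_left by linarith
    qed (use \<open>0 \<le> \<delta>\<close> in simp)
    show "B v = \<kappa> l *\<^sub>R v" by fact
    show "norm v = 1" by fact
    show "0 \<le> inner (l2_class (phi l)) v"
      using sign by (simp add: v_def inner_l2_class phi step_function_L2)
  qed
  then show ?thesis
    unfolding v_def \<alpha>_def using phi
    by (simp add: step_function_L2 L2_diff norm_l2_class flip: l2_class_diff)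
qed

end

section \<open>Second-order structure of the signal\<close>

lemma integrable_mult_squares:
  fixes f g :: "'a \<Rightarrow> real"
  assumes "f \<in> borel_measurable N" "g \<in> borel_measurable N"
    "integrable N (\<lambda>x. (f x)\<^sup>2)" "integrable N (\<lambda>x. (g x)\<^sup>2)"
  shows "integrable N (\<lambda>x. f x * g x)"
proof (rule Bochner_Integration.integrable_bound)
  show "integrable N (\<lambda>x. (f x)\<^sup>2 + (g x)\<^sup>2)"
    using assms by (intro Bochner_Integration.integrable_add)
  show "(\<lambda>x. f x * g x) \<in> borel_measurable N"
    using assms by measurable
  have "\<bar>a * b\<bar> \<le> \<bar>a\<^sup>2 + b\<^sup>2\<bar>" for a b :: real
  proof -
    have "0 \<le> \<bar>a\<bar> * \<bar>b\<bar>" by simp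
    then show ?thesis
      using sum_squares_bound[of "\<bar>a\<bar>" "\<bar>b\<bar>"] unfolding abs_mult power2_abs by linarith
  qed
  then show "AE x in N. norm (f x * g x) \<le> norm ((f x)\<^sup>2 + (g x)\<^sup>2)" by simp
qed

text \<open>The integral of the square of \<open>r * f + g\<close> is a nonnegative polynomial in r.
  Evaluating it at its minimum gives the claim; if the leading coefficient vanishes, the polynomial
  is linear and must be constant.\<close>

lemma integral_Cauchy_Schwarz:
  fixes f g :: "'a \<Rightarrow> real"
  assumes "f \<in> borel_measurable N" "g \<in> borel_measurable N"
    "integrable N (\<lambda>x. (f x)\<^sup>2)" "integrable N (\<lambda>x. (g x)\<^sup>2)"
  shows "\<bar>\<integral>x. f x * g x \<partial>N\<bar> \<le> sqrt (\<integral>x. (f x)\<^sup>2 \<partial>N) * sqrt (\<integral>x. (g x)\<^sup>2 \<partial>N)"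
proof -
  note fg = integrable_mult_squares[OF assms]
  define a b c where "a = (\<integral>x. (f x)\<^sup>2 \<partial>N)" and "b = (\<integral>x. f x * g x \<partial>N)" and "c = (\<integral>x. (g x)\<^sup>2 \<partial>N)"
  have quad: "0 \<le> r\<^sup>2 * a + 2 * r * b + c" for r
  proof -
    have "0 \<le> (\<integral>x. (r * f x + g x)\<^sup>2 \<partial>N)" by simp
    also have "\<dots> = (\<integral>x. r\<^sup>2 * (f x)\<^sup>2 + 2 * r * (f x * g x) + (g x)\<^sup>2 \<partial>N)"
      by (simp add: power2_sum power_mult_distrib algebra_simps)
    also have "\<dots> = r\<^sup>2 * a + 2 * r * b + c"
      using assms(3,4) fg by (simp add: a_def b_def c_def)
    finally show ?thesis .
  qed
  have "a \<ge> 0" "c \<ge> 0" by (auto simp: a_def c_def)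
  have "b\<^sup>2 \<le> a * c"
  proof (cases "a = 0")
    case True
    have "b = 0"
    proof (rule ccontr)
      assume "b \<noteq> 0"
      \<comment> \<open>At this r the linear polynomial would take the value -1.\<close>
      have "0 \<le> 2 * (- (c + 1) / (2 * b)) * b + c" using quad[of "- (c + 1) / (2 * b)"] True by simp
      also have "\<dots> = - 1" using \<open>b \<noteq> 0\<close> by (simp add: field_simps)
      finally show False by simp
    qed
    then show ?thesis using True by simp
  next
    case False
    then have "a > 0" using \<open>a \<ge> 0\<close> by simp
    have "0 \<le> (- b / a)\<^sup>2 * a + 2 * (- b / a) * b + c" by (rule quad)
    also have "\<dots> = c - b\<^sup>2 / a" using \<open>a > 0\<close> by (simp add: field_simps power2_eq_square)
    finally show ?thesis using \<open>a > 0\<close> by (simp add: field_simps)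
  qed
  then have "sqrt (b\<^sup>2) \<le> sqrt (a * c)" by (rule real_sqrt_le_mono)
  then show ?thesis by (simp add: a_def b_def c_def real_sqrt_mult)
qed

locale functional_signal = prob_space M for M :: "'w measure" +
  fixes X :: "nat \<Rightarrow> 'w \<Rightarrow> real \<Rightarrow> real"
    and S :: "'s measure" and eps :: "int \<Rightarrow> 'w \<Rightarrow> 's" and f :: "(nat \<Rightarrow> 's) \<Rightarrow> real \<Rightarrow> real"
    and C_X :: real
  assumes curve: "\<And>t. t \<ge> 1 \<Longrightarrow> random_curve M (X t)"
    and stationary: "stationary_curves M X"
    and signal_a: "signal_cond_a M S eps f X"
    and signal_b: "signal_cond_b M X C_X"
begin

lemma joint_measurable: "t \<ge> 1 \<Longrightarrow> (\<lambda>z. X t (fst z) (snd z)) \<in> borel_measurable (M \<Otimes>\<^sub>M leb01)"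
  using curve[of t] by (simp add: random_curve_def split_beta')

lemma X_L2: "t \<ge> 1 \<Longrightarrow> \<omega> \<in> space M \<Longrightarrow> X t \<omega> \<in> L2"
  using curve[of t] by (simp add: random_curve_def)

lemma X_measurable:
  assumes "t \<ge> 1" "s \<in> {0..1}"
  shows "(\<lambda>\<omega>. X t \<omega> s) \<in> borel_measurable M"
proof -
  have "(\<lambda>\<omega>. (\<omega>, s)) \<in> measurable M (M \<Otimes>\<^sub>M leb01)"
    using assms(2) by (intro measurable_Pair2') simp
  from measurable_compose[OF this joint_measurable[OF assms(1)]] show ?thesis by simp
qed

lemma curve_values_measurable: "(\<lambda>\<omega>. curve_values (\<lambda>t. X (t + h)) \<omega>) \<in> measurable M (PiM curve_index (\<lambda>_. borel))"
  unfolding curve_values_def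
  by (rule measurable_restrict) (auto intro: X_measurable)

text \<open>Reading two points of the curve at time 1 after a shift by \<open>t - 1\<close> gives
  the pair at time \<open>t\<close>; stationarity of the point values says that the shift does not
  change the law.\<close>

lemma pair_law:
  assumes "t \<ge> 1" "s \<in> {0..1}" "s' \<in> {0..1}"
  shows "distr M (borel \<Otimes>\<^sub>M borel) (\<lambda>\<omega>. (X t \<omega> s, X t \<omega> s')) = distr M (borel \<Otimes>\<^sub>M borel) (\<lambda>\<omega>. (X 1 \<omega> s, X 1 \<omega> s'))"
proof -
  let ?P = "PiM curve_index (\<lambda>_. borel :: real measure)"
  define \<Psi> where "\<Psi> y = (y (1, s), y (1, s'))" for y :: "nat \<times> real \<Rightarrow> real"
  have \<Psi>: "\<Psi> \<in> measurable ?P (borel \<Otimes>\<^sub>M borel)"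
    unfolding \<Psi>_def using assms by (intro measurable_Pair measurable_component_singleton) auto
  have eq: "\<Psi> (curve_values (\<lambda>u. X (u + h)) \<omega>) = (X (1 + h) \<omega> s, X (1 + h) \<omega> s')" for h \<omega>
    using assms by (simp add: \<Psi>_def curve_values_def)
  have "distr M (borel \<Otimes>\<^sub>M borel) (\<lambda>\<omega>. \<Psi> (curve_values (\<lambda>u. X (u + h)) \<omega>)) =
      distr (distr M ?P (curve_values (\<lambda>u. X (u + h)))) (borel \<Otimes>\<^sub>M borel) \<Psi>" for h
    using distr_distr[OF \<Psi> curve_values_measurable] by (simp add: o_def)
  then have *: "distr M (borel \<Otimes>\<^sub>M borel) (\<lambda>\<omega>. \<Psi> (curve_values (\<lambda>u. X (u + h)) \<omega>)) =
      distr (distr M ?P (curve_values X)) (borel \<Otimes>\<^sub>M borel) \<Psi>" for h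
    using stationary unfolding stationary_curves_def by presburger
  show ?thesis using *[of "t - 1"] *[of 0] assms(1) unfolding eq by simp
qed

lemma pair_expectation:
  fixes g :: "real \<times> real \<Rightarrow> real"
  assumes "t \<ge> 1" "s \<in> {0..1}" "s' \<in> {0..1}" "g \<in> borel_measurable (borel \<Otimes>\<^sub>M borel)"
  shows "integrable M (\<lambda>\<omega>. g (X t \<omega> s, X t \<omega> s')) \<longleftrightarrow> integrable M (\<lambda>\<omega>. g (X 1 \<omega> s, X 1 \<omega> s'))"
    and "(\<integral>\<omega>. g (X t \<omega> s, X t \<omega> s') \<partial>M) = (\<integral>\<omega>. g (X 1 \<omega> s, X 1 \<omega> s') \<partial>M)"
proof -
  have m: "(\<lambda>\<omega>. (X u \<omega> s, X u \<omega> s')) \<in> measurable M (borel \<Otimes>\<^sub>M borel)" if "u \<ge> 1" for u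
    using that assms by (intro measurable_Pair X_measurable)
  show "integrable M (\<lambda>\<omega>. g (X t \<omega> s, X t \<omega> s')) \<longleftrightarrow> integrable M (\<lambda>\<omega>. g (X 1 \<omega> s, X 1 \<omega> s'))"
    by (simp only: integrable_distr_eq[OF m[OF assms(1)] assms(4), symmetric]
        integrable_distr_eq[OF m[OF order_refl] assms(4), symmetric] pair_law[OF assms(1-3)])
  show "(\<integral>\<omega>. g (X t \<omega> s, X t \<omega> s') \<partial>M) = (\<integral>\<omega>. g (X 1 \<omega> s, X 1 \<omega> s') \<partial>M)"
    by (simp only: integral_distr[OF m[OF assms(1)] assms(4), symmetric]
        integral_distr[OF m[OF order_refl] assms(4), symmetric] pair_law[OF assms(1-3)])
qed

definition kernel :: "real \<Rightarrow> real \<Rightarrow> real" where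
  "kernel s s' = cov_kernel M (X 1) s s'"

text \<open>A bound for second moments of point values, from
  \<open>x\<^sup>2 \<le> 1 + x ^ 4\<close>.\<close>

definition c\<^sub>2 :: real where "c\<^sub>2 = 1 + C_X"

lemma square_moment:
  assumes "t \<ge> 1" "s \<in> {0..1}"
  shows "integrable M (\<lambda>\<omega>. (X t \<omega> s)\<^sup>2)" and "(\<integral>\<omega>. (X t \<omega> s)\<^sup>2 \<partial>M) \<le> c\<^sub>2"
proof -
  have x1: "integrable M (\<lambda>\<omega>. X 1 \<omega> s ^ 4)" "(\<integral>\<omega>. X 1 \<omega> s ^ 4 \<partial>M) \<le> C_X"
    using signal_b assms(2) by (auto simp: signal_cond_b_def)
  have le: "x\<^sup>2 \<le> 1 + x ^ 4" for x :: real
  proof -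
    have "(x\<^sup>2)\<^sup>2 = x ^ 4" "0 \<le> x ^ 4" by simp_all
    then have "2 * x\<^sup>2 \<le> x ^ 4 + 1" using sum_squares_bound[of "x\<^sup>2" 1] by simp
    then show ?thesis using zero_le_power2[of x] by linarith
  qed
  have int1: "integrable M (\<lambda>\<omega>. (X 1 \<omega> s)\<^sup>2)"
  proof (rule Bochner_Integration.integrable_bound)
    show "integrable M (\<lambda>\<omega>. 1 + X 1 \<omega> s ^ 4)" using x1 by simp
    show "(\<lambda>\<omega>. (X 1 \<omega> s)\<^sup>2) \<in> borel_measurable M"
      using X_measurable[of 1 s] assms(2) by (intro borel_measurable_power) auto
    show "AE \<omega> in M. norm ((X 1 \<omega> s)\<^sup>2) \<le> norm (1 + X 1 \<omega> s ^ 4)"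
    proof (rule AE_I2)
      fix \<omega>
      show "norm ((X 1 \<omega> s)\<^sup>2) \<le> norm (1 + X 1 \<omega> s ^ 4)"
        using le[of "X 1 \<omega> s"] by simp
    qed
  qed
  have "(\<integral>\<omega>. (X 1 \<omega> s)\<^sup>2 \<partial>M) \<le> (\<integral>\<omega>. 1 + X 1 \<omega> s ^ 4 \<partial>M)"
    using x1 int1 le by (intro integral_mono) auto
  also have "\<dots> \<le> c\<^sub>2" using x1 prob_space by (simp add: c\<^sub>2_def)
  finally have "(\<integral>\<omega>. (X 1 \<omega> s)\<^sup>2 \<partial>M) \<le> c\<^sub>2" .
  with int1 show "integrable M (\<lambda>\<omega>. (X t \<omega> s)\<^sup>2)" and "(\<integral>\<omega>. (X t \<omega> s)\<^sup>2 \<partial>M) \<le> c\<^sub>2"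
    using pair_expectation[OF assms(1) assms(2) assms(2), of "\<lambda>z. (fst z)\<^sup>2"] by auto
qed

lemma c\<^sub>2_nonneg: "0 \<le> c\<^sub>2"
  by (rule order_trans[OF _ square_moment(2)[of 1 0]]) simp_all

lemma product_moment:
  assumes "t \<ge> 1" "s \<in> {0..1}" "s' \<in> {0..1}"
  shows "integrable M (\<lambda>\<omega>. X t \<omega> s * X t \<omega> s')"
    and "(\<integral>\<omega>. X t \<omega> s * X t \<omega> s' \<partial>M) = kernel s s'"
    and "(\<integral>\<omega>. \<bar>X t \<omega> s * X t \<omega> s'\<bar> \<partial>M) \<le> c\<^sub>2"
proof -
  show int: "integrable M (\<lambda>\<omega>. X t \<omega> s * X t \<omega> s')"
    using assms by (intro integrable_mult_squares X_measurable square_moment)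
  have zero: "(\<integral>\<omega>. X 1 \<omega> u \<partial>M) = 0" if "u \<in> {0..1}" for u
    using signal_a that by (simp add: signal_cond_a_def)
  have "(\<integral>\<omega>. X t \<omega> s * X t \<omega> s' \<partial>M) = (\<integral>\<omega>. X 1 \<omega> s * X 1 \<omega> s' \<partial>M)"
    using pair_expectation(2)[OF assms, of "\<lambda>z. fst z * snd z"] by simp
  also have "\<dots> = kernel s s'"
    unfolding kernel_def cov_kernel_def cov_def using zero[OF assms(2)] zero[OF assms(3)] by simp
  finally show "(\<integral>\<omega>. X t \<omega> s * X t \<omega> s' \<partial>M) = kernel s s'" .
  have "(\<integral>\<omega>. \<bar>X t \<omega> s * X t \<omega> s'\<bar> \<partial>M) \<le> (\<integral>\<omega>. ((X t \<omega> s)\<^sup>2 + (X t \<omega> s')\<^sup>2) / 2 \<partial>M)"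
  proof (rule integral_mono)
    show "integrable M (\<lambda>\<omega>. ((X t \<omega> s)\<^sup>2 + (X t \<omega> s')\<^sup>2) / 2)"
      using assms square_moment(1) by simp
    show "\<bar>X t \<omega> s * X t \<omega> s'\<bar> \<le> ((X t \<omega> s)\<^sup>2 + (X t \<omega> s')\<^sup>2) / 2" for \<omega>
      using sum_squares_bound[of "\<bar>X t \<omega> s\<bar>" "\<bar>X t \<omega> s'\<bar>"] by (simp add: abs_mult)
  qed (use int in simp)
  also have "\<dots> \<le> c\<^sub>2"
    using square_moment[OF assms(1,2)] square_moment[OF assms(1,3)] by simp
  finally show "(\<integral>\<omega>. \<bar>X t \<omega> s * X t \<omega> s'\<bar> \<partial>M) \<le> c\<^sub>2" .
qed

text \<open>Fubini for expectation and double integral: absolute product moments are at most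
  \<open>c\<^sub>2\<close> at all pairs of points, so an integrable weight suffices. The weight is
  later a product of test functions or the kernel itself.\<close>

lemma second_moment_form:
  fixes h :: "real \<times> real \<Rightarrow> real"
  assumes t: "t \<ge> 1" and h: "integrable (leb01 \<Otimes>\<^sub>M leb01) h"
  shows "integrable M (\<lambda>\<omega>. \<integral>z. X t \<omega> (fst z) * X t \<omega> (snd z) * h z \<partial>(leb01 \<Otimes>\<^sub>M leb01))"
    and "(\<integral>\<omega>. (\<integral>z. X t \<omega> (fst z) * X t \<omega> (snd z) * h z \<partial>(leb01 \<Otimes>\<^sub>M leb01)) \<partial>M)
       = (\<integral>z. kernel (fst z) (snd z) * h z \<partial>(leb01 \<Otimes>\<^sub>M leb01))"
proof -
  let ?sq = "leb01 \<Otimes>\<^sub>M leb01"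
  interpret sq: pair_prob_space leb01 leb01 ..
  interpret Q: pair_sigma_finite ?sq M ..
  have [measurable]: "h \<in> borel_measurable ?sq" using h by simp
  have [measurable]: "(\<lambda>z. X t (snd z) (fst (fst z))) \<in> borel_measurable (?sq \<Otimes>\<^sub>M M)"
    "(\<lambda>z. X t (snd z) (snd (fst z))) \<in> borel_measurable (?sq \<Otimes>\<^sub>M M)"
    using measurable_compose[OF _ joint_measurable[OF t], of "\<lambda>z. (snd z, fst (fst z))" "?sq \<Otimes>\<^sub>M M"]
      measurable_compose[OF _ joint_measurable[OF t], of "\<lambda>z. (snd z, snd (fst z))" "?sq \<Otimes>\<^sub>M M"] by simp_all
  define G where "G z \<omega> = X t \<omega> (fst z) * X t \<omega> (snd z) * h z" for z \<omega>
  have Gm [measurable]: "case_prod G \<in> borel_measurable (?sq \<Otimes>\<^sub>M M)"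
    unfolding G_def split_beta' by measurable
  have mem: "fst z \<in> {0..1}" "snd z \<in> {0..1}" if "z \<in> space ?sq" for z
    using that by (auto simp: space_pair_measure)
  have Gint: "integrable M (G z)" if "z \<in> space ?sq" for z
    unfolding G_def using product_moment(1)[OF t mem[OF that]] by simp
  have int: "integrable (?sq \<Otimes>\<^sub>M M) (case_prod G)"
  proof (rule Q.Fubini_integrable[OF Gm])
    show "AE z in ?sq. integrable M (\<lambda>\<omega>. case_prod G (z, \<omega>))" using Gint by (intro AE_I2) simp
    show "integrable ?sq (\<lambda>z. \<integral>\<omega>. norm (case_prod G (z, \<omega>)) \<partial>M)"
    proof (rule Bochner_Integration.integrable_bound)
      show "integrable ?sq (\<lambda>z. c\<^sub>2 * h z)" using h by simp
      show "(\<lambda>z. \<integral>\<omega>. norm (case_prod G (z, \<omega>)) \<partial>M) \<in> borel_measurable ?sq" by measurable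
      show "AE z in ?sq. norm (\<integral>\<omega>. norm (case_prod G (z, \<omega>)) \<partial>M) \<le> norm (c\<^sub>2 * h z)"
      proof (rule AE_I2)
        fix z assume z: "z \<in> space ?sq"
        have "(\<integral>\<omega>. norm (case_prod G (z, \<omega>)) \<partial>M) = (\<integral>\<omega>. \<bar>X t \<omega> (fst z) * X t \<omega> (snd z)\<bar> \<partial>M) * \<bar>h z\<bar>"
          by (simp add: G_def abs_mult)
        also have "\<dots> \<le> c\<^sub>2 * \<bar>h z\<bar>" by (intro mult_right_mono product_moment(3) t mem[OF z]) simp
        finally show "norm (\<integral>\<omega>. norm (case_prod G (z, \<omega>)) \<partial>M) \<le> norm (c\<^sub>2 * h z)"
          using c\<^sub>2_nonneg by (simp add: abs_mult)
      qed
    qed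
  qed
  show "integrable M (\<lambda>\<omega>. \<integral>z. X t \<omega> (fst z) * X t \<omega> (snd z) * h z \<partial>?sq)"
    using Q.integrable_snd[OF int] by (simp add: G_def)
  have "(\<integral>\<omega>. (\<integral>z. X t \<omega> (fst z) * X t \<omega> (snd z) * h z \<partial>?sq) \<partial>M) = (\<integral>\<omega>. (\<integral>z. G z \<omega> \<partial>?sq) \<partial>M)"
    by (simp only: G_def)
  also have "\<dots> = (\<integral>z. (\<integral>\<omega>. G z \<omega> \<partial>M) \<partial>?sq)"
    using Q.integral_fst[OF int] Q.integral_snd[OF int] by simp
  also have "\<dots> = (\<integral>z. kernel (fst z) (snd z) * h z \<partial>?sq)"
    by (intro Bochner_Integration.integral_cong refl) (simp add: G_def product_moment(2)[OF t mem])
  finally show "(\<integral>\<omega>. (\<integral>z. X t \<omega> (fst z) * X t \<omega> (snd z) * h z \<partial>?sq) \<partial>M)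
       = (\<integral>z. kernel (fst z) (snd z) * h z \<partial>?sq)" .
qed

lemma integral_square_product:
  assumes "u \<in> L2" "v \<in> L2" "g \<in> L2" "h \<in> L2"
  shows "integrable (leb01 \<Otimes>\<^sub>M leb01) (\<lambda>z. u (fst z) * v (snd z) * (h (snd z) * g (fst z)))"
    and "(\<integral>z. u (fst z) * v (snd z) * (h (snd z) * g (fst z)) \<partial>(leb01 \<Otimes>\<^sub>M leb01)) = L2_inner u g * L2_inner v h"
proof -
  interpret sq: pair_prob_space leb01 leb01 ..
  have eq: "(\<lambda>z. u (fst z) * v (snd z) * (h (snd z) * g (fst z))) = (\<lambda>z. (u (fst z) * g (fst z)) * (v (snd z) * h (snd z)))"
    by (auto simp: mult_ac)
  show "integrable (leb01 \<Otimes>\<^sub>M leb01) (\<lambda>z. u (fst z) * v (snd z) * (h (snd z) * g (fst z)))"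
    unfolding eq by (intro sq.integrable_product integrable_mult_L2 assms)
  show "(\<integral>z. u (fst z) * v (snd z) * (h (snd z) * g (fst z)) \<partial>(leb01 \<Otimes>\<^sub>M leb01)) = L2_inner u g * L2_inner v h"
    unfolding eq L2_inner_def by (intro sq.integral_product integrable_mult_L2 assms)
qed

lemma expectation_inner_squared:
  assumes t: "t \<ge> 1" and g: "g \<in> L2"
  shows "integrable M (\<lambda>\<omega>. (L2_inner (X t \<omega>) g)\<^sup>2)"
    and "(\<integral>\<omega>. (L2_inner (X t \<omega>) g)\<^sup>2 \<partial>M) = (\<integral>z. kernel (fst z) (snd z) * (g (snd z) * g (fst z)) \<partial>(leb01 \<Otimes>\<^sub>M leb01))"
proof -
  interpret sq: pair_prob_space leb01 leb01 ..
  have h: "integrable (leb01 \<Otimes>\<^sub>M leb01) (\<lambda>z. g (snd z) * g (fst z))"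
    using integral_square_product(1)[of "\<lambda>_. 1" "\<lambda>_. 1" g g] g L2_bounded[of "\<lambda>_. 1" 1] by simp
  have eq: "(L2_inner (X t \<omega>) g)\<^sup>2 = (\<integral>z. X t \<omega> (fst z) * X t \<omega> (snd z) * (g (snd z) * g (fst z)) \<partial>(leb01 \<Otimes>\<^sub>M leb01))"
    if "\<omega> \<in> space M" for \<omega>
    using integral_square_product(2)[OF X_L2[OF t that] X_L2[OF t that] g g] by (simp add: power2_eq_square)
  show "integrable M (\<lambda>\<omega>. (L2_inner (X t \<omega>) g)\<^sup>2)"
    using second_moment_form(1)[OF t h] by (rule Bochner_Integration.integrable_cong[THEN iffD2, rotated 2]) (auto simp: eq)
  show "(\<integral>\<omega>. (L2_inner (X t \<omega>) g)\<^sup>2 \<partial>M) = (\<integral>z. kernel (fst z) (snd z) * (g (snd z) * g (fst z)) \<partial>(leb01 \<Otimes>\<^sub>M leb01))"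
    unfolding second_moment_form(2)[OF t h, symmetric]
    by (intro Bochner_Integration.integral_cong refl eq)
qed

text \<open>Positivity holds because the form at \<open>g\<close> is the second moment of the inner
  product of \<open>g\<close> with the curve. The double integral is computed by hand here, as
  \<open>inner_op\<close> becomes available only with the interpretation.\<close>

sublocale K: covariance_kernel kernel
proof
  show cont: "continuous_on ({0..1} \<times> {0..1}) (\<lambda>(s, s'). kernel s s')"
    using signal_b by (simp add: signal_cond_b_def kernel_def)
  show sym: "kernel s s' = kernel s' s" if "s \<in> {0..1}" "s' \<in> {0..1}" for s s'
    unfolding kernel_def cov_kernel_def cov_def by (simp add: mult.commute)
  fix g assume g: "g \<in> L2"
  interpret sq: pair_prob_space leb01 leb01 ..
  have meas: "(\<lambda>z. kernel (fst z) (snd z)) \<in> borel_measurable (leb01 \<Otimes>\<^sub>M leb01)"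
    by (rule measurable_continuous_square[OF cont])
  have h: "integrable (leb01 \<Otimes>\<^sub>M leb01) (\<lambda>z. g (snd z) * g (fst z))"
    using integral_square_product(1)[of "\<lambda>_. 1" "\<lambda>_. 1" g g] g L2_bounded[of "\<lambda>_. 1" 1] by simp
  have int: "integrable (leb01 \<Otimes>\<^sub>M leb01) (\<lambda>z. kernel (fst z) (snd z) * (g (snd z) * g (fst z)))"
  proof (rule Bochner_Integration.integrable_bound)
    show "integrable (leb01 \<Otimes>\<^sub>M leb01) (\<lambda>z. c\<^sub>2 * (g (snd z) * g (fst z)))" using h by simp
    show "(\<lambda>z. kernel (fst z) (snd z) * (g (snd z) * g (fst z))) \<in> borel_measurable (leb01 \<Otimes>\<^sub>M leb01)"
      by (intro borel_measurable_times[OF meas borel_measurable_integrable[OF h]])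
    show "AE z in leb01 \<Otimes>\<^sub>M leb01. norm (kernel (fst z) (snd z) * (g (snd z) * g (fst z))) \<le> norm (c\<^sub>2 * (g (snd z) * g (fst z)))"
    proof (rule AE_I2)
      fix z assume "z \<in> space (leb01 \<Otimes>\<^sub>M leb01)"
      then have z: "fst z \<in> {0..1}" "snd z \<in> {0..1}" by (auto simp: space_pair_measure)
      have "\<bar>kernel (fst z) (snd z)\<bar> \<le> c\<^sub>2"
        using product_moment(2,3)[of 1, OF _ z] integral_abs_bound[of M "\<lambda>\<omega>. X 1 \<omega> (fst z) * X 1 \<omega> (snd z)"] by simp
      then show "norm (kernel (fst z) (snd z) * (g (snd z) * g (fst z))) \<le> norm (c\<^sub>2 * (g (snd z) * g (fst z)))"
        using c\<^sub>2_nonneg unfolding real_norm_def abs_mult by (intro mult_right_mono) auto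
    qed
  qed
  have "L2_inner (integral_operator kernel g) g = (\<integral>s. (\<integral>s'. kernel s s' * (g s' * g s) \<partial>leb01) \<partial>leb01)"
    by (simp add: L2_inner_def integral_operator_def mult.assoc[symmetric])
  also have "\<dots> = (\<integral>z. kernel (fst z) (snd z) * (g (snd z) * g (fst z)) \<partial>(leb01 \<Otimes>\<^sub>M leb01))"
    using sq.integral_fst'[OF int] by simp
  also have "\<dots> = (\<integral>\<omega>. (L2_inner (X 1 \<omega>) g)\<^sup>2 \<partial>M)"
    using expectation_inner_squared(2)[OF _ g, of 1] by simp
  finally show "0 \<le> L2_inner (integral_operator kernel g) g" by simp
qed

section \<open>Curves as random elements of \<open>l2\<close>\<close>

definition Xc :: "nat \<Rightarrow> 'w \<Rightarrow> l2" where "Xc t \<omega> = l2_class (X t \<omega>)"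

lemma L2_norm_measurable:
  assumes "(\<lambda>z. Z (fst z) (snd z)) \<in> borel_measurable (M \<Otimes>\<^sub>M leb01)"
  shows "(\<lambda>\<omega>. L2_norm (Z \<omega>)) \<in> borel_measurable M"
proof -
  have [measurable]: "(\<lambda>(\<omega>, s). (Z \<omega> s)\<^sup>2) \<in> borel_measurable (M \<Otimes>\<^sub>M leb01)"
    using assms by (simp add: split_beta')
  show ?thesis unfolding L2_norm_def by measurable
qed

lemma Xc_measurable [measurable]: "t \<ge> 1 \<Longrightarrow> Xc t \<in> borel_measurable M"
proof (rule borel_measurable_l2I)
  fix x assume t: "t \<ge> 1"
  define g where "g = rep_l2 x"
  have g: "g \<in> L2" "x = l2_class g" using l2_class_rep[of x] by (auto simp: g_def)
  have [measurable]: "g \<in> borel_measurable leb01" "(\<lambda>z. X t (fst z) (snd z)) \<in> borel_measurable (M \<Otimes>\<^sub>M leb01)"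
    using g L2_D joint_measurable[OF t] by auto
  have "(\<lambda>\<omega>. L2_norm (\<lambda>s. g s - X t \<omega> s)) \<in> borel_measurable M"
    by (rule L2_norm_measurable) measurable
  then show "(\<lambda>\<omega>. dist x (Xc t \<omega>)) \<in> borel_measurable M"
    by (rule measurable_cong[THEN iffD1, rotated])
       (use g X_L2[OF t] in \<open>simp add: Xc_def dist_norm L2_diff flip: l2_class_diff norm_l2_class\<close>)
qed

lemma expectation_inner_Xc_squared:
  assumes "t \<ge> 1"
  shows "integrable M (\<lambda>\<omega>. (inner (Xc t \<omega>) g)\<^sup>2)"
    and "(\<integral>\<omega>. (inner (Xc t \<omega>) g)\<^sup>2 \<partial>M) = inner (K.op g) g"
proof -
  define u where "u = rep_l2 g"
  have u: "u \<in> L2" "g = l2_class u" using l2_class_rep[of g] by (auto simp: u_def)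
  have eq: "inner (Xc t \<omega>) g = L2_inner (X t \<omega>) u" if "\<omega> \<in> space M" for \<omega>
    using X_L2[OF assms that] u by (simp add: Xc_def inner_l2_class)
  show "integrable M (\<lambda>\<omega>. (inner (Xc t \<omega>) g)\<^sup>2)"
    using expectation_inner_squared(1)[OF assms u(1)]
    by (rule Bochner_Integration.integrable_cong[THEN iffD2, rotated 2]) (auto simp: eq)
  have "(\<integral>\<omega>. (inner (Xc t \<omega>) g)\<^sup>2 \<partial>M) = (\<integral>\<omega>. (L2_inner (X t \<omega>) u)\<^sup>2 \<partial>M)"
    by (intro Bochner_Integration.integral_cong refl) (simp add: eq)
  also have "\<dots> = inner (K.op g) g"
    unfolding u(2) expectation_inner_squared(2)[OF assms u(1)] by (rule K.inner_op(2)[OF u(1) u(1), symmetric])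
  finally show "(\<integral>\<omega>. (inner (Xc t \<omega>) g)\<^sup>2 \<partial>M) = inner (K.op g) g" .
qed

text \<open>The squared Hilbert-Schmidt norm of \<open>K.op\<close>.\<close>

definition kernel_norm2 :: real where
  "kernel_norm2 = (\<integral>z. (kernel (fst z) (snd z))\<^sup>2 \<partial>(leb01 \<Otimes>\<^sub>M leb01))"

text \<open>The case of \<open>second_moment_form\<close> in which the kernel is its own weight. It
  evaluates the mixed term of the Hilbert-Schmidt distance.\<close>

lemma expectation_op_Xc:
  assumes "t \<ge> 1"
  shows "integrable M (\<lambda>\<omega>. inner (K.op (Xc t \<omega>)) (Xc t \<omega>))"
    and "(\<integral>\<omega>. inner (K.op (Xc t \<omega>)) (Xc t \<omega>) \<partial>M) = kernel_norm2"
proof -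
  have h: "integrable (leb01 \<Otimes>\<^sub>M leb01) (\<lambda>z. kernel (fst z) (snd z))"
    using K.inner_op(1)[of "\<lambda>_. 1" "\<lambda>_. 1"] L2_bounded[of "\<lambda>_. 1" 1] by simp
  have eq: "inner (K.op (Xc t \<omega>)) (Xc t \<omega>) =
      (\<integral>z. X t \<omega> (fst z) * X t \<omega> (snd z) * kernel (fst z) (snd z) \<partial>(leb01 \<Otimes>\<^sub>M leb01))" if "\<omega> \<in> space M" for \<omega>
    unfolding Xc_def K.inner_op(2)[OF X_L2[OF assms that] X_L2[OF assms that]]
    by (intro Bochner_Integration.integral_cong refl) (simp add: mult_ac)
  show "integrable M (\<lambda>\<omega>. inner (K.op (Xc t \<omega>)) (Xc t \<omega>))"
    using second_moment_form(1)[OF assms h]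
    by (rule Bochner_Integration.integrable_cong[THEN iffD2, rotated 2]) (auto simp: eq)
  have "(\<integral>\<omega>. inner (K.op (Xc t \<omega>)) (Xc t \<omega>) \<partial>M) =
      (\<integral>\<omega>. (\<integral>z. X t \<omega> (fst z) * X t \<omega> (snd z) * kernel (fst z) (snd z) \<partial>(leb01 \<Otimes>\<^sub>M leb01)) \<partial>M)"
    by (intro Bochner_Integration.integral_cong refl eq)
  then show "(\<integral>\<omega>. inner (K.op (Xc t \<omega>)) (Xc t \<omega>) \<partial>M) = kernel_norm2"
    unfolding second_moment_form(2)[OF assms h] kernel_norm2_def by (simp add: power2_eq_square)
qed

lemma fourth_moment: "t \<ge> 1 \<Longrightarrow> integrable M (\<lambda>\<omega>. norm (Xc t \<omega>) ^ 4)"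
proof -
  assume t: "t \<ge> 1"
  then have "integrable M (\<lambda>\<omega>. L2_norm (X t \<omega>) ^ 4)"
    using signal_a by (simp add: signal_cond_a_def L4_m_approximable_def)
  then show ?thesis
    by (rule Bochner_Integration.integrable_cong[THEN iffD2, rotated 2])
       (auto simp: Xc_def norm_l2_class X_L2[OF t])
qed

text \<open>The squared Hilbert-Schmidt distance of the empirical covariance operator of the first \<open>n\<close>
  curves to \<open>K.op\<close>, written out in inner products.\<close>

definition hs_dist2 :: "nat \<Rightarrow> 'w \<Rightarrow> real" where
  "hs_dist2 n \<omega> = (\<Sum>t\<in>{1..n}. \<Sum>t'\<in>{1..n}. (inner (Xc t \<omega>) (Xc t' \<omega>))\<^sup>2) / (real n)\<^sup>2
     - 2 * (\<Sum>t\<in>{1..n}. inner (K.op (Xc t \<omega>)) (Xc t \<omega>)) / real n + kernel_norm2"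

lemma kernel_square_integrable: "integrable (leb01 \<Otimes>\<^sub>M leb01) (\<lambda>z. (kernel (fst z) (snd z))\<^sup>2)"
proof -
  interpret sq: pair_prob_space leb01 leb01 ..
  show ?thesis
  proof (rule sq.integrable_const_bound[of _ "K.bound\<^sup>2"])
    show "AE z in leb01 \<Otimes>\<^sub>M leb01. norm ((kernel (fst z) (snd z))\<^sup>2) \<le> K.bound\<^sup>2"
    proof (rule AE_I2)
      fix z assume "z \<in> space (leb01 \<Otimes>\<^sub>M leb01)"
      then have "\<bar>kernel (fst z) (snd z)\<bar> \<le> \<bar>K.bound\<bar>"
        by (intro order_trans[OF K.le_bound]) (auto simp: space_pair_measure)
      then show "norm ((kernel (fst z) (snd z))\<^sup>2) \<le> K.bound\<^sup>2" by (simp add: abs_le_square_iff)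
    qed
  qed (use K.measurable_kernel in simp)
qed

text \<open>\<open>hs_dist2\<close> is the squared norm, in the space of square-integrable functions
  on the unit square, of the empirical kernel \<open>E\<close> minus the covariance kernel. The
  difference of the forms is the integral of that difference against the product \<open>w\<close> of
  the test functions, so Cauchy-Schwarz on the square applies, and the norm of \<open>w\<close> is
  \<open>norm g * norm h\<close>.\<close>

lemma empirical_form_bound:
  assumes \<omega>: "\<omega> \<in> space M" and "n \<ge> 1"
  shows "0 \<le> hs_dist2 n \<omega>"
    and "\<bar>(\<Sum>t\<in>{1..n}. inner (Xc t \<omega>) g * inner (Xc t \<omega>) h) / real n - inner (K.op g) h\<bar>
      \<le> sqrt (hs_dist2 n \<omega>) * norm g * norm h"
proof -
  let ?sq = "leb01 \<Otimes>\<^sub>M leb01"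
  interpret sq: pair_prob_space leb01 leb01 ..
  define x where "x t = X t \<omega>" for t
  have x: "x t \<in> L2" if "t \<in> {1..n}" for t using X_L2[OF _ \<omega>, of t] that by (simp add: x_def)
  have Xcx: "Xc t \<omega> = l2_class (x t)" for t by (simp add: Xc_def x_def)
  define E where "E z = (\<Sum>t\<in>{1..n}. x t (fst z) * x t (snd z)) / real n" for z
  define k where "k z = kernel (fst z) (snd z)" for z
  have prod_int: "integrable ?sq (\<lambda>z. u (fst z) * v (snd z))" if "u \<in> L2" "v \<in> L2" for u v
    using that[THEN integrable_mult_L2, OF L2_bounded[of "\<lambda>_. 1" 1]] by (intro sq.integrable_product) auto
  have Em: "E \<in> borel_measurable ?sq"
    unfolding E_def using x by (intro borel_measurable_divide borel_measurable_sum) (auto intro: borel_measurable_integrable[OF prod_int])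
  have km: "k \<in> borel_measurable ?sq" using K.measurable_kernel by (simp add: k_def[abs_def])
  have k2: "integrable ?sq (\<lambda>z. (k z)\<^sup>2)" using kernel_square_integrable by (simp add: k_def)
  have EE: "(E z)\<^sup>2 = (\<Sum>t\<in>{1..n}. \<Sum>t'\<in>{1..n}. x t (fst z) * x t (snd z) * (x t' (snd z) * x t' (fst z))) / (real n)\<^sup>2" for z
    by (simp add: E_def power2_eq_square sum_product mult_ac)
  have E2: "integrable ?sq (\<lambda>z. (E z)\<^sup>2)"
    unfolding EE by (intro integrable_divide Bochner_Integration.integrable_sum integral_square_product x)
  have "(\<integral>z. (E z)\<^sup>2 \<partial>?sq) = (\<integral>z. (\<Sum>t\<in>{1..n}. \<Sum>t'\<in>{1..n}.
      x t (fst z) * x t (snd z) * (x t' (snd z) * x t' (fst z))) \<partial>?sq) / (real n)\<^sup>2"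
    unfolding EE by (rule integral_divide_zero)
  also have "(\<integral>z. (\<Sum>t\<in>{1..n}. \<Sum>t'\<in>{1..n}. x t (fst z) * x t (snd z) * (x t' (snd z) * x t' (fst z))) \<partial>?sq)
      = (\<Sum>t\<in>{1..n}. \<integral>z. (\<Sum>t'\<in>{1..n}. x t (fst z) * x t (snd z) * (x t' (snd z) * x t' (fst z))) \<partial>?sq)"
    by (intro Bochner_Integration.integral_sum Bochner_Integration.integrable_sum integral_square_product x)
  also have "\<dots> = (\<Sum>t\<in>{1..n}. \<Sum>t'\<in>{1..n}. \<integral>z. x t (fst z) * x t (snd z) * (x t' (snd z) * x t' (fst z)) \<partial>?sq)"
    by (intro sum.cong refl Bochner_Integration.integral_sum integral_square_product x)
  also have "\<dots> = (\<Sum>t\<in>{1..n}. \<Sum>t'\<in>{1..n}. (inner (Xc t \<omega>) (Xc t' \<omega>))\<^sup>2)"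
    by (intro sum.cong refl) (simp add: integral_square_product x Xcx inner_l2_class power2_eq_square)
  finally have E2_int: "(\<integral>z. (E z)\<^sup>2 \<partial>?sq) = (\<Sum>t\<in>{1..n}. \<Sum>t'\<in>{1..n}. (inner (Xc t \<omega>) (Xc t' \<omega>))\<^sup>2) / (real n)\<^sup>2" .
  have kE: "k z * E z = (\<Sum>t\<in>{1..n}. k z * (x t (snd z) * x t (fst z))) / real n" for z
    by (simp add: E_def sum_distrib_left mult_ac)
  have int_kx: "integrable ?sq (\<lambda>z. k z * (x t (snd z) * x t (fst z)))" if "t \<in> {1..n}" for t
    unfolding k_def by (rule K.inner_op(1)[OF x[OF that] x[OF that]])
  have kE_int: "(\<integral>z. k z * E z \<partial>?sq) = (\<Sum>t\<in>{1..n}. inner (K.op (Xc t \<omega>)) (Xc t \<omega>)) / real n"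
  proof -
    have "(\<integral>z. k z * E z \<partial>?sq) = (\<integral>z. (\<Sum>t\<in>{1..n}. k z * (x t (snd z) * x t (fst z))) \<partial>?sq) / real n"
      unfolding kE by (rule integral_divide_zero)
    also have "(\<integral>z. (\<Sum>t\<in>{1..n}. k z * (x t (snd z) * x t (fst z))) \<partial>?sq)
        = (\<Sum>t\<in>{1..n}. \<integral>z. k z * (x t (snd z) * x t (fst z)) \<partial>?sq)"
      by (intro Bochner_Integration.integral_sum int_kx)
    also have "\<dots> = (\<Sum>t\<in>{1..n}. inner (K.op (Xc t \<omega>)) (Xc t \<omega>))"
      by (intro sum.cong refl) (simp only: Xcx K.inner_op(2)[OF x x] k_def)
    finally show ?thesis .
  qed
  have k2_int: "kernel_norm2 = (\<integral>z. (k z)\<^sup>2 \<partial>?sq)" by (simp add: kernel_norm2_def k_def)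
  have hs: "hs_dist2 n \<omega> = (\<integral>z. (E z)\<^sup>2 \<partial>?sq) - 2 * (\<integral>z. k z * E z \<partial>?sq) + (\<integral>z. (k z)\<^sup>2 \<partial>?sq)"
    unfolding hs_dist2_def E2_int kE_int k2_int by simp
  have intkE: "integrable ?sq (\<lambda>z. k z * E z)" by (rule integrable_mult_squares[OF km Em k2 E2])
  have D2_eq: "(E z - k z)\<^sup>2 = (E z)\<^sup>2 - 2 * (k z * E z) + (k z)\<^sup>2" for z
    by (simp add: power2_diff algebra_simps)
  have D2: "integrable ?sq (\<lambda>z. (E z - k z)\<^sup>2)"
    unfolding D2_eq using E2 k2 intkE by simp
  have hs': "hs_dist2 n \<omega> = (\<integral>z. (E z - k z)\<^sup>2 \<partial>?sq)"
    unfolding hs D2_eq using E2 k2 intkE by simp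
  show "0 \<le> hs_dist2 n \<omega>" unfolding hs' by simp
  define u v where "u = rep_l2 g" and "v = rep_l2 h"
  have u: "u \<in> L2" "g = l2_class u" and v: "v \<in> L2" "h = l2_class v"
    using l2_class_rep[of g] l2_class_rep[of h] by (auto simp: u_def v_def)
  define w where "w z = u (snd z) * v (fst z)" for z :: "real \<times> real"
  have w2_eq: "(w z)\<^sup>2 = v (fst z) * u (snd z) * (u (snd z) * v (fst z))" for z
    by (simp add: w_def power2_eq_square mult_ac)
  have w2: "integrable ?sq (\<lambda>z. (w z)\<^sup>2)" "(\<integral>z. (w z)\<^sup>2 \<partial>?sq) = (norm h)\<^sup>2 * (norm g)\<^sup>2"
    unfolding w2_eq power2_norm_eq_inner u(2) v(2)
    using integral_square_product[OF v(1) u(1) v(1) u(1)] by (simp_all add: inner_l2_class u v)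
  have wm: "w \<in> borel_measurable ?sq"
    using borel_measurable_integrable[OF prod_int[OF v(1) u(1)]] by (simp add: w_def[abs_def] mult.commute)
  have Ew_eq: "E z * w z = (\<Sum>t\<in>{1..n}. x t (fst z) * x t (snd z) * (u (snd z) * v (fst z))) / real n" for z
    unfolding E_def w_def times_divide_eq_left sum_distrib_right ..
  have Ew: "integrable ?sq (\<lambda>z. E z * w z)"
    "(\<integral>z. E z * w z \<partial>?sq) = (\<Sum>t\<in>{1..n}. inner (Xc t \<omega>) g * inner (Xc t \<omega>) h) / real n"
  proof -
    show "integrable ?sq (\<lambda>z. E z * w z)"
      unfolding Ew_eq
      by (intro integrable_divide Bochner_Integration.integrable_sum integral_square_product x u v)
    have "(\<integral>z. E z * w z \<partial>?sq)
        = (\<integral>z. (\<Sum>t\<in>{1..n}. x t (fst z) * x t (snd z) * (u (snd z) * v (fst z))) \<partial>?sq) / real n"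
      unfolding Ew_eq by (rule integral_divide_zero)
    also have "(\<integral>z. (\<Sum>t\<in>{1..n}. x t (fst z) * x t (snd z) * (u (snd z) * v (fst z))) \<partial>?sq)
        = (\<Sum>t\<in>{1..n}. \<integral>z. x t (fst z) * x t (snd z) * (u (snd z) * v (fst z)) \<partial>?sq)"
      by (intro Bochner_Integration.integral_sum integral_square_product x u v)
    also have "\<dots> = (\<Sum>t\<in>{1..n}. inner (Xc t \<omega>) g * inner (Xc t \<omega>) h)"
    proof (intro sum.cong refl)
      fix t assume t: "t \<in> {1..n}"
      show "(\<integral>z. x t (fst z) * x t (snd z) * (u (snd z) * v (fst z)) \<partial>?sq) = inner (Xc t \<omega>) g * inner (Xc t \<omega>) h"
        unfolding integral_square_product(2)[OF x[OF t] x[OF t] v(1) u(1)] u(2) v(2) Xcx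
        by (simp add: inner_l2_class x[OF t] u(1) v(1))
    qed
    finally show "(\<integral>z. E z * w z \<partial>?sq) = (\<Sum>t\<in>{1..n}. inner (Xc t \<omega>) g * inner (Xc t \<omega>) h) / real n" .
  qed
  have kw: "integrable ?sq (\<lambda>z. k z * w z)" "(\<integral>z. k z * w z \<partial>?sq) = inner (K.op g) h"
    unfolding k_def w_def u(2) v(2) using K.inner_op[OF u(1) v(1)] by simp_all
  have "(\<Sum>t\<in>{1..n}. inner (Xc t \<omega>) g * inner (Xc t \<omega>) h) / real n - inner (K.op g) h = (\<integral>z. (E z - k z) * w z \<partial>?sq)"
    using Ew kw by (simp add: left_diff_distrib)
  also have "\<bar>\<dots>\<bar> \<le> sqrt (\<integral>z. (E z - k z)\<^sup>2 \<partial>?sq) * sqrt (\<integral>z. (w z)\<^sup>2 \<partial>?sq)"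
    using Em km wm by (intro integral_Cauchy_Schwarz D2 w2 borel_measurable_diff)
  also have "\<dots> = sqrt (hs_dist2 n \<omega>) * norm g * norm h"
    unfolding w2(2) hs' by (simp add: real_sqrt_mult)
  finally show "\<bar>(\<Sum>t\<in>{1..n}. inner (Xc t \<omega>) g * inner (Xc t \<omega>) h) / real n - inner (K.op g) h\<bar>
      \<le> sqrt (hs_dist2 n \<omega>) * norm g * norm h" .
qed

subsection \<open>Weak dependence\<close>

lemma approximable: "L4_m_approximable M S eps f X"
  using signal_a by (simp add: signal_cond_a_def)

lemma
  shows eps_indep: "indep_vars (\<lambda>_. S) eps UNIV"
    and eps_identical: "distr M S (eps i) = distr M S (eps 0)"
    and f_measurable: "f \<in> measurable (PiM UNIV (\<lambda>_. S)) L2_borel"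
    and X_representation: "t \<ge> 1 \<Longrightarrow> AE \<omega> in M. AE s in leb01. X t \<omega> s = f (\<lambda>k. eps (int t - int k) \<omega>) s"
    and coupling_integrable: "m \<ge> 1 \<Longrightarrow> integrable (M \<Otimes>\<^sub>M M)
      (\<lambda>z. L2_norm (\<lambda>s. X m (fst z) s - f (coupled eps m m z) s) ^ 4)"
    and coupling_summable: "summable (\<lambda>n. (\<integral>z. L2_norm (\<lambda>s. X (Suc n) (fst z) s
      - f (coupled eps (Suc n) (Suc n) z) s) ^ 4 \<partial>(M \<Otimes>\<^sub>M M)) powr (1 / 4))"
  using approximable unfolding L4_m_approximable_def Let_def by blast+

lemma eps_measurable: "eps i \<in> measurable M S"
  using eps_indep by (simp add: indep_vars_def)

lemma f_class_measurable: "(\<lambda>e. l2_class (f e)) \<in> borel_measurable (PiM UNIV (\<lambda>_. S))"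
  by (rule measurable_compose[OF f_measurable l2_class_measurable])

lemma f_L2: "e \<in> space (PiM UNIV (\<lambda>_. S)) \<Longrightarrow> f e \<in> L2"
  using measurable_space[OF f_measurable, of e] by (simp add: L2_borel_def space_measure_of_conv)

section \<open>Innovations, time shifts and the coupled copy\<close>

definition E :: "'w \<Rightarrow> int \<Rightarrow> 's" where "E \<omega> i = eps i \<omega>"

text \<open>Extends the curves to all integer times. Time 0, where nothing is assumed on
  \<open>X\<close>, is the convenient origin: the curve there depends on the innovations up to 0
  only.\<close>

definition causal :: "int \<Rightarrow> (int \<Rightarrow> 's) \<Rightarrow> l2" where
  "causal t e = l2_class (f (\<lambda>k. e (t - int k)))"

lemma E_measurable [measurable]: "E \<in> measurable M (PiM UNIV (\<lambda>_. S))"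
  unfolding E_def[abs_def] by (rule measurable_abs_UNIV) (rule eps_measurable)

lemma causal_measurable [measurable]: "causal t \<in> borel_measurable (PiM UNIV (\<lambda>_. S))"
proof -
  have "(\<lambda>e k. e (t - int k)) \<in> measurable (PiM UNIV (\<lambda>_ :: int. S)) (PiM UNIV (\<lambda>_ :: nat. S))"
    by (rule measurable_abs_UNIV) measurable
  from measurable_compose[OF this f_class_measurable] show ?thesis by (simp add: causal_def[abs_def])
qed

lemma E_law: "distr M (PiM UNIV (\<lambda>_. S)) E = PiM UNIV (\<lambda>_. distr M S (eps 0))"
proof -
  have "distr M (PiM UNIV (\<lambda>_. S)) (\<lambda>\<omega>. \<lambda>i\<in>UNIV. eps i \<omega>) = PiM UNIV (\<lambda>i. distr M S (eps i))"
    using indep_vars_iff_distr_eq_PiM[THEN iffD1, OF _ _ eps_indep] eps_measurable by simp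
  moreover have "(\<lambda>i. distr M S (eps i)) = (\<lambda>_. distr M S (eps 0))"
    by (rule ext) (rule eps_identical)
  moreover have "(\<lambda>\<omega>. \<lambda>i\<in>UNIV. eps i \<omega>) = E" by (auto simp: E_def fun_eq_iff)
  ultimately show ?thesis by simp
qed

text \<open>The law of the innovations is a product of identical factors, hence invariant under
  translation of the index.\<close>

lemma E_shift_law: "distr M (PiM UNIV (\<lambda>_. S)) (\<lambda>\<omega> i. E \<omega> (i + h)) = distr M (PiM UNIV (\<lambda>_. S)) E"
proof -
  interpret D: prob_space "distr M S (eps 0)" by (rule prob_space_distr[OF eps_measurable])
  have sh: "(\<lambda>e i. e (i + h)) \<in> measurable (PiM UNIV (\<lambda>_ :: int. S)) (PiM UNIV (\<lambda>_ :: int. S))"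
    by (rule measurable_abs_UNIV) measurable
  have "distr M (PiM UNIV (\<lambda>_. S)) (\<lambda>\<omega> i. E \<omega> (i + h)) =
      distr (distr M (PiM UNIV (\<lambda>_. S)) E) (PiM UNIV (\<lambda>_. S)) (\<lambda>e i. e (i + h))"
    by (subst distr_distr[OF sh E_measurable]) (simp add: o_def)
  also have "\<dots> = distr (PiM UNIV (\<lambda>_. distr M S (eps 0))) (PiM UNIV (\<lambda>_. distr M S (eps 0))) (\<lambda>e. \<lambda>i\<in>UNIV. e (i + h))"
    unfolding E_law by (intro distr_cong sets_PiM_cong) auto
  also have "\<dots> = PiM UNIV (\<lambda>_. distr M S (eps 0))"
    by (rule distr_PiM_reindex) (auto intro: D.prob_space_axioms)
  finally show ?thesis unfolding E_law .
qed

text \<open>Stated for nonnegative integrals, so that shifts and couplings can be carried out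
  without tracking integrability.\<close>

lemma nn_integral_shift:
  fixes G :: "(int \<Rightarrow> 's) \<Rightarrow> ennreal"
  assumes "G \<in> borel_measurable (PiM UNIV (\<lambda>_. S))"
  shows "(\<integral>\<^sup>+\<omega>. G (\<lambda>i. E \<omega> (i + h)) \<partial>M) = (\<integral>\<^sup>+\<omega>. G (E \<omega>) \<partial>M)"
proof -
  have sh: "(\<lambda>\<omega> i. E \<omega> (i + h)) \<in> measurable M (PiM UNIV (\<lambda>_ :: int. S))"
    unfolding E_def by (rule measurable_abs_UNIV) (rule eps_measurable)
  have "(\<integral>\<^sup>+\<omega>. G (\<lambda>i. E \<omega> (i + h)) \<partial>M) = (\<integral>\<^sup>+e. G e \<partial>distr M (PiM UNIV (\<lambda>_. S)) (\<lambda>\<omega> i. E \<omega> (i + h)))"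
    by (rule nn_integral_distr[OF sh, symmetric]) (simp add: assms)
  also have "\<dots> = (\<integral>\<^sup>+\<omega>. G (E \<omega>) \<partial>M)"
    unfolding E_shift_law by (rule nn_integral_distr[OF E_measurable]) (simp add: assms)
  finally show ?thesis .
qed

lemma causal_shift: "causal t (\<lambda>i. e (i + h)) = causal (t + h) e"
  by (simp add: causal_def algebra_simps)

lemma nn_integral_causal_shift:
  fixes G :: "l2 \<Rightarrow> l2 \<Rightarrow> ennreal"
  assumes [measurable]: "case_prod G \<in> borel_measurable (borel \<Otimes>\<^sub>M borel)"
  shows "(\<integral>\<^sup>+\<omega>. G (causal (t + h) (E \<omega>)) (causal (u + h) (E \<omega>)) \<partial>M) = (\<integral>\<^sup>+\<omega>. G (causal t (E \<omega>)) (causal u (E \<omega>)) \<partial>M)"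
  using nn_integral_shift[of "\<lambda>e. G (causal t e) (causal u e)" h] by (simp add: causal_shift)

text \<open>The representation holds up to null sets in s and in the outcome; it becomes an almost
  sure equality of classes. From here on laws of curves are computed from innovations.\<close>

lemma Xc_causal:
  assumes "t \<ge> 1"
  shows "AE \<omega> in M. Xc t \<omega> = causal (int t) (E \<omega>)"
proof -
  from X_representation[OF assms] show ?thesis
  proof (rule AE_mp, intro AE_I2 impI)
    fix \<omega> assume \<omega>: "\<omega> \<in> space M" and eq: "AE s in leb01. X t \<omega> s = f (\<lambda>k. eps (int t - int k) \<omega>) s"
    have "(\<lambda>k. eps (int t - int k) \<omega>) \<in> space (PiM UNIV (\<lambda>_. S))"
      using measurable_space[OF eps_measurable \<omega>] by (auto simp: space_PiM)
    then have "f (\<lambda>k. eps (int t - int k) \<omega>) \<in> L2" by (rule f_L2)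
    then show "Xc t \<omega> = causal (int t) (E \<omega>)"
      using eq X_L2[OF assms \<omega>] by (simp add: Xc_def causal_def E_def l2_class_eq_iff)
  qed
qed

text \<open>The innovations are split between times 0 and 1. The coupled copy at lag h mixes the
  future of one outcome with the past of another.\<close>

definition past :: "'w \<Rightarrow> int \<Rightarrow> 's" where "past \<omega> = restrict (E \<omega>) {..0}"
definition future :: "'w \<Rightarrow> int \<Rightarrow> 's" where "future \<omega> = restrict (E \<omega>) {1..}"

abbreviation "past_space \<equiv> PiM {..0 :: int} (\<lambda>_. S)"
abbreviation "future_space \<equiv> PiM {1 :: int ..} (\<lambda>_. S)"

lemma past_measurable [measurable]: "past \<in> measurable M past_space"
  unfolding past_def[abs_def] E_def by (intro measurable_restrict eps_measurable)

lemma future_measurable [measurable]: "future \<in> measurable M future_space"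
  unfolding future_def[abs_def] E_def by (intro measurable_restrict eps_measurable)

text \<open>Disjoint blocks of innovations are independent, so the pair has a product law and the
  future may be taken from a second outcome.\<close>

lemma past_future_indep:
  assumes [measurable]: "H \<in> borel_measurable (past_space \<Otimes>\<^sub>M future_space)"
  shows "(\<integral>\<^sup>+\<omega>. H (past \<omega>, future \<omega>) \<partial>M) = (\<integral>\<^sup>+\<omega>. \<integral>\<^sup>+\<omega>'. H (past \<omega>, future \<omega>') \<partial>M \<partial>M)"
proof -
  have "indep_var past_space past future_space future"
    unfolding past_def[abs_def] future_def[abs_def] E_def
    by (rule indep_var_restrict[OF eps_indep]) auto
  then have law: "distr M past_space past \<Otimes>\<^sub>M distr M future_space future
      = distr M (past_space \<Otimes>\<^sub>M future_space) (\<lambda>\<omega>. (past \<omega>, future \<omega>))"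
    by (simp add: indep_var_distribution_eq)
  interpret F: prob_space "distr M future_space future" by (rule prob_space_distr) simp
  have "(\<integral>\<^sup>+\<omega>. H (past \<omega>, future \<omega>) \<partial>M) = (\<integral>\<^sup>+z. H z \<partial>(distr M past_space past \<Otimes>\<^sub>M distr M future_space future))"
    unfolding law by (subst nn_integral_distr) auto
  also have "\<dots> = (\<integral>\<^sup>+a. \<integral>\<^sup>+b. H (a, b) \<partial>distr M future_space future \<partial>distr M past_space past)"
    by (rule F.nn_integral_fst[symmetric]) simp
  also have "\<dots> = (\<integral>\<^sup>+a. \<integral>\<^sup>+\<omega>'. H (a, future \<omega>') \<partial>M \<partial>distr M past_space past)"
    by (intro nn_integral_cong nn_integral_distr) auto
  also have "\<dots> = (\<integral>\<^sup>+\<omega>. \<integral>\<^sup>+\<omega>'. H (past \<omega>, future \<omega>') \<partial>M \<partial>M)"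
    by (rule nn_integral_distr) auto
  finally show ?thesis .
qed

definition from_past :: "(int \<Rightarrow> 's) \<Rightarrow> l2" where
  "from_past r = l2_class (f (\<lambda>k. r (- int k)))"

text \<open>The innovation index \<open>int h - int k\<close> is at least 1 exactly when
  \<open>k < h\<close>, so the first branch reads the future and the second the past.\<close>

definition from_both :: "nat \<Rightarrow> (int \<Rightarrow> 's) \<Rightarrow> (int \<Rightarrow> 's) \<Rightarrow> l2" where
  "from_both h r' r = l2_class (f (\<lambda>k. if k < h then r' (int h - int k) else r (int h - int k)))"

lemma from_past_measurable [measurable]: "from_past \<in> borel_measurable past_space"
proof -
  have "(\<lambda>r k. r (- int k)) \<in> measurable past_space (PiM UNIV (\<lambda>_ :: nat. S))"
    by (rule measurable_abs_UNIV) (simp add: measurable_component_singleton)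
  from measurable_compose[OF this f_class_measurable] show ?thesis by (simp add: from_past_def[abs_def])
qed

lemma from_both_measurable: "(\<lambda>z. from_both h (fst z) (snd z)) \<in> borel_measurable (future_space \<Otimes>\<^sub>M past_space)"
proof -
  have "(\<lambda>z k. if k < h then fst z (int h - int k) else snd z (int h - int k))
      \<in> measurable (future_space \<Otimes>\<^sub>M past_space) (PiM UNIV (\<lambda>_ :: nat. S))"
  proof (rule measurable_abs_UNIV)
    fix k
    show "(\<lambda>z. if k < h then fst z (int h - int k) else snd z (int h - int k)) \<in> measurable (future_space \<Otimes>\<^sub>M past_space) S"
    proof (cases "k < h")
      case True
      then show ?thesis
        by (simp add: measurable_compose[OF measurable_fst measurable_component_singleton])
    next
      case False
      then show ?thesis
        by (simp add: measurable_compose[OF measurable_snd measurable_component_singleton])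
    qed
  qed
  from measurable_compose[OF this f_class_measurable] show ?thesis by (simp add: from_both_def[abs_def])
qed

lemma from_both_measurable' [measurable (raw)]:
  assumes "u \<in> measurable N future_space" "v \<in> measurable N past_space"
  shows "(\<lambda>x. from_both h (u x) (v x)) \<in> borel_measurable N"
  using measurable_compose[OF measurable_Pair[OF assms] from_both_measurable] by simp

lemma causal_0_past: "causal 0 (E \<omega>) = from_past (past \<omega>)"
  by (simp add: causal_def from_past_def past_def)

lemma causal_both: "causal (int h) (E \<omega>) = from_both h (future \<omega>) (past \<omega>)"
  unfolding causal_def from_both_def past_def future_def
  by (intro arg_cong[of _ _ l2_class] arg_cong[of _ _ f]) auto

lemma coupled_both: "l2_class (f (coupled eps h h z)) = from_both h (future (fst z)) (past (snd z))"
  unfolding from_both_def past_def future_def coupled_def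
  by (cases z, intro arg_cong[of _ _ l2_class] arg_cong[of _ _ f]) (auto simp: E_def)

text \<open>The curve at time 0 uses the past of the first outcome, the coupled curve the future of
  the first and the past of the second: three independent blocks. Independence is used twice, once
  to detach the future from the past of the first outcome and once, after an exchange of integrals,
  to attach it to the past of the second. The coupled curve is thus independent of the curve at time
  0 and has the law of the curve at time h.\<close>

lemma coupling_law:
  fixes G :: "l2 \<Rightarrow> l2 \<Rightarrow> ennreal"
  assumes [measurable]: "case_prod G \<in> borel_measurable (borel \<Otimes>\<^sub>M borel)"
  shows "(\<integral>\<^sup>+z. G (causal 0 (E (fst z))) (l2_class (f (coupled eps h h z))) \<partial>(M \<Otimes>\<^sub>M M))
       = (\<integral>\<^sup>+\<omega>. \<integral>\<^sup>+\<omega>'. G (causal 0 (E \<omega>)) (causal (int h) (E \<omega>')) \<partial>M \<partial>M)"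
proof -
  interpret MM: pair_sigma_finite M M ..
  have "(\<integral>\<^sup>+z. G (causal 0 (E (fst z))) (l2_class (f (coupled eps h h z))) \<partial>(M \<Otimes>\<^sub>M M))
      = (\<integral>\<^sup>+z. G (from_past (past (fst z))) (from_both h (future (fst z)) (past (snd z))) \<partial>(M \<Otimes>\<^sub>M M))"
    by (simp only: causal_0_past coupled_both)
  also have "\<dots> = (\<integral>\<^sup>+\<omega>'. \<integral>\<^sup>+\<omega>. G (from_past (past \<omega>)) (from_both h (future \<omega>) (past \<omega>')) \<partial>M \<partial>M)"
    by (subst MM.nn_integral_snd[symmetric]) auto
  also have "\<dots> = (\<integral>\<^sup>+\<omega>'. \<integral>\<^sup>+\<omega>. \<integral>\<^sup>+\<omega>''. G (from_past (past \<omega>)) (from_both h (future \<omega>'') (past \<omega>')) \<partial>M \<partial>M \<partial>M)"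
  proof (rule nn_integral_cong)
    fix \<omega>' assume "\<omega>' \<in> space M"
    then have [simp]: "past \<omega>' \<in> space past_space" by (rule measurable_space[OF past_measurable])
    show "(\<integral>\<^sup>+\<omega>. G (from_past (past \<omega>)) (from_both h (future \<omega>) (past \<omega>')) \<partial>M)
        = (\<integral>\<^sup>+\<omega>. \<integral>\<^sup>+\<omega>''. G (from_past (past \<omega>)) (from_both h (future \<omega>'') (past \<omega>')) \<partial>M \<partial>M)"
      using past_future_indep[of "\<lambda>z. G (from_past (fst z)) (from_both h (snd z) (past \<omega>'))"] by simp
  qed
  also have "\<dots> = (\<integral>\<^sup>+\<omega>. \<integral>\<^sup>+\<omega>'. \<integral>\<^sup>+\<omega>''. G (from_past (past \<omega>)) (from_both h (future \<omega>'') (past \<omega>')) \<partial>M \<partial>M \<partial>M)"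
    by (rule MM.Fubini') measurable
  also have "\<dots> = (\<integral>\<^sup>+\<omega>. \<integral>\<^sup>+\<omega>'. G (from_past (past \<omega>)) (from_both h (future \<omega>') (past \<omega>')) \<partial>M \<partial>M)"
  proof (rule nn_integral_cong)
    fix \<omega> assume "\<omega> \<in> space M"
    then have [simp]: "from_past (past \<omega>) \<in> space borel" by simp
    show "(\<integral>\<^sup>+\<omega>'. \<integral>\<^sup>+\<omega>''. G (from_past (past \<omega>)) (from_both h (future \<omega>'') (past \<omega>')) \<partial>M \<partial>M)
        = (\<integral>\<^sup>+\<omega>'. G (from_past (past \<omega>)) (from_both h (future \<omega>') (past \<omega>')) \<partial>M)"
      using past_future_indep[of "\<lambda>z. G (from_past (past \<omega>)) (from_both h (snd z) (fst z))"] by simp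
  qed
  also have "\<dots> = (\<integral>\<^sup>+\<omega>. \<integral>\<^sup>+\<omega>'. G (causal 0 (E \<omega>)) (causal (int h) (E \<omega>')) \<partial>M \<partial>M)"
    by (simp only: causal_0_past causal_both)
  finally show ?thesis .
qed

lemma op_measurable [measurable]: "K.op \<in> borel_measurable borel"
  by (intro borel_measurable_continuous_onI linear_continuous_on K.bounded_linear_op)

lemma nn_integral_inner_causal:
  assumes "t \<ge> 1"
  shows "(\<integral>\<^sup>+\<omega>. ennreal ((inner g (causal (int t) (E \<omega>)))\<^sup>2) \<partial>M) = ennreal (inner (K.op g) g)"
proof -
  have "(\<integral>\<^sup>+\<omega>. ennreal ((inner g (causal (int t) (E \<omega>)))\<^sup>2) \<partial>M) = (\<integral>\<^sup>+\<omega>. ennreal ((inner (Xc t \<omega>) g)\<^sup>2) \<partial>M)"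
    using Xc_causal[OF assms] by (intro nn_integral_cong_AE) (auto simp: inner_commute elim: AE_mp)
  also have "\<dots> = ennreal (inner (K.op g) g)"
    using expectation_inner_Xc_squared[OF assms, of g] by (subst nn_integral_eq_integral) auto
  finally show ?thesis .
qed

text \<open>Integrating out the second curve leaves the covariance form at the first, whose
  expectation is the squared Hilbert-Schmidt norm. The shift to time 1 makes the known moments of
  \<open>X\<close> available.\<close>

lemma nn_integral_independent:
  assumes "h \<ge> 1"
  shows "(\<integral>\<^sup>+\<omega>. \<integral>\<^sup>+\<omega>'. ennreal ((inner (causal 0 (E \<omega>)) (causal (int h) (E \<omega>')))\<^sup>2) \<partial>M \<partial>M) = ennreal kernel_norm2"
proof -
  have "(\<integral>\<^sup>+\<omega>. \<integral>\<^sup>+\<omega>'. ennreal ((inner (causal 0 (E \<omega>)) (causal (int h) (E \<omega>')))\<^sup>2) \<partial>M \<partial>M)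
      = (\<integral>\<^sup>+\<omega>. ennreal (inner (K.op (causal 0 (E \<omega>))) (causal 0 (E \<omega>))) \<partial>M)"
    unfolding nn_integral_inner_causal[OF assms] ..
  also have "\<dots> = (\<integral>\<^sup>+\<omega>. ennreal (inner (K.op (causal (0 + 1) (E \<omega>))) (causal (0 + 1) (E \<omega>))) \<partial>M)"
    by (rule nn_integral_causal_shift[where G = "\<lambda>x y. ennreal (inner (K.op x) y)", symmetric]) measurable
  also have "\<dots> = (\<integral>\<^sup>+\<omega>. ennreal (inner (K.op (Xc 1 \<omega>)) (Xc 1 \<omega>)) \<partial>M)"
    using Xc_causal[of 1] by (intro nn_integral_cong_AE) (auto elim: AE_mp)
  also have "\<dots> = ennreal kernel_norm2"
    using expectation_op_Xc[of 1] K.op_nonneg by (subst nn_integral_eq_integral) auto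
  finally show ?thesis .
qed

definition m\<^sub>4 :: real where "m\<^sub>4 = (\<integral>\<omega>. norm (Xc 1 \<omega>) ^ 4 \<partial>M)"

lemma m\<^sub>4_nonneg: "0 \<le> m\<^sub>4"
  by (simp add: m\<^sub>4_def)

lemma nn_integral_causal_fourth: "(\<integral>\<^sup>+\<omega>. ennreal (norm (causal t (E \<omega>)) ^ 4) \<partial>M) = ennreal m\<^sub>4"
proof -
  have "(\<integral>\<^sup>+\<omega>. ennreal (norm (causal (1 + (t - 1)) (E \<omega>)) ^ 4) \<partial>M) = (\<integral>\<^sup>+\<omega>. ennreal (norm (causal 1 (E \<omega>)) ^ 4) \<partial>M)"
    by (rule nn_integral_causal_shift[where G = "\<lambda>x y. ennreal (norm x ^ 4)"]) measurable
  also have "\<dots> = (\<integral>\<^sup>+\<omega>. ennreal (norm (Xc 1 \<omega>) ^ 4) \<partial>M)"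
    using Xc_causal[of 1] by (intro nn_integral_cong_AE) (auto elim: AE_mp)
  also have "\<dots> = ennreal m\<^sub>4"
    unfolding m\<^sub>4_def using fourth_moment[of 1] by (subst nn_integral_eq_integral) auto
  finally show ?thesis by simp
qed

text \<open>Constancy in time comes from the shift invariance of the innovations.\<close>

lemma fourth_moment_eq:
  assumes "t \<ge> 1"
  shows "(\<integral>\<omega>. norm (Xc t \<omega>) ^ 4 \<partial>M) = m\<^sub>4"
proof -
  have "ennreal (\<integral>\<omega>. norm (Xc t \<omega>) ^ 4 \<partial>M) = (\<integral>\<^sup>+\<omega>. ennreal (norm (Xc t \<omega>) ^ 4) \<partial>M)"
    using fourth_moment[OF assms] by (subst nn_integral_eq_integral) auto
  also have "\<dots> = (\<integral>\<^sup>+\<omega>. ennreal (norm (causal (int t) (E \<omega>)) ^ 4) \<partial>M)"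
    using Xc_causal[OF assms] by (intro nn_integral_cong_AE) (auto elim: AE_mp)
  also have "\<dots> = ennreal m\<^sub>4" by (rule nn_integral_causal_fourth)
  finally show ?thesis by (simp add: m\<^sub>4_nonneg)
qed

text \<open>The coupling distance at lag \<open>Suc n\<close>: the sequence starts at 0, the lags at
  1.\<close>

definition dep :: "nat \<Rightarrow> real" where
  "dep n = (\<integral>z. L2_norm (\<lambda>s. X (Suc n) (fst z) s - f (coupled eps (Suc n) (Suc n) z) s) ^ 4 \<partial>(M \<Otimes>\<^sub>M M)) powr (1 / 4)"

lemma summable_dep: "summable dep"
  unfolding dep_def[abs_def] by (rule coupling_summable)

lemma dep_nonneg: "0 \<le> dep n"
  by (simp add: dep_def)

lemma nn_integral_coupling_distance:
  "(\<integral>\<^sup>+z. ennreal (norm (causal (int (Suc n)) (E (fst z)) - l2_class (f (coupled eps (Suc n) (Suc n) z))) ^ 4) \<partial>(M \<Otimes>\<^sub>M M))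
     = ennreal (dep n ^ 4)"
proof -
  interpret MM: pair_prob_space M M ..
  define I where "I = (\<integral>z. L2_norm (\<lambda>s. X (Suc n) (fst z) s - f (coupled eps (Suc n) (Suc n) z) s) ^ 4 \<partial>(M \<Otimes>\<^sub>M M))"
  have int: "integrable (M \<Otimes>\<^sub>M M) (\<lambda>z. L2_norm (\<lambda>s. X (Suc n) (fst z) s - f (coupled eps (Suc n) (Suc n) z) s) ^ 4)"
    by (rule coupling_integrable) simp
  have "I \<ge> 0" by (simp add: I_def)
  have "dep n ^ 4 = I"
  proof (cases "I = 0")
    case False
    then have "dep n ^ 4 = I powr (real 4 * (1 / 4))"
      unfolding dep_def I_def[symmetric] by (subst powr_power) auto
    then show ?thesis using \<open>I \<ge> 0\<close> by simp
  qed (simp add: dep_def I_def[symmetric])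
  have "AE z in M \<Otimes>\<^sub>M M. Xc (Suc n) (fst z) = causal (int (Suc n)) (E (fst z))"
    by (rule AE_distrD[OF measurable_fst]) (unfold distr_pair_fst, rule Xc_causal, simp)
  then have "(\<integral>\<^sup>+z. ennreal (norm (causal (int (Suc n)) (E (fst z)) - l2_class (f (coupled eps (Suc n) (Suc n) z))) ^ 4) \<partial>(M \<Otimes>\<^sub>M M))
    = (\<integral>\<^sup>+z. ennreal (L2_norm (\<lambda>s. X (Suc n) (fst z) s - f (coupled eps (Suc n) (Suc n) z) s) ^ 4) \<partial>(M \<Otimes>\<^sub>M M))"
  proof (intro nn_integral_cong_AE, rule AE_mp, intro AE_I2 impI)
    fix z assume z: "z \<in> space (M \<Otimes>\<^sub>M M)" and eq: "Xc (Suc n) (fst z) = causal (int (Suc n)) (E (fst z))"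
    have zz: "fst z \<in> space M" "snd z \<in> space M" using z by (auto simp: space_pair_measure)
    have "coupled eps (Suc n) (Suc n) z \<in> space (PiM UNIV (\<lambda>_. S))"
      using measurable_space[OF eps_measurable] zz by (cases z) (auto simp: space_PiM coupled_def)
    then have L: "f (coupled eps (Suc n) (Suc n) z) \<in> L2" "X (Suc n) (fst z) \<in> L2"
      using f_L2 X_L2[of "Suc n"] zz by auto
    then show "ennreal (norm (causal (int (Suc n)) (E (fst z)) - l2_class (f (coupled eps (Suc n) (Suc n) z))) ^ 4)
       = ennreal (L2_norm (\<lambda>s. X (Suc n) (fst z) s - f (coupled eps (Suc n) (Suc n) z) s) ^ 4)"
      unfolding eq[symmetric] by (simp add: Xc_def L2_diff flip: l2_class_diff norm_l2_class)
  qed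
  also have "\<dots> = ennreal I" unfolding I_def using int by (subst nn_integral_eq_integral) auto
  finally show ?thesis unfolding \<open>dep n ^ 4 = I\<close> .
qed

lemma nn_integral_fst_marginal:
  fixes G :: "'w \<Rightarrow> ennreal"
  assumes "G \<in> borel_measurable M"
  shows "(\<integral>\<^sup>+z. G (fst z) \<partial>(M \<Otimes>\<^sub>M M)) = (\<integral>\<^sup>+\<omega>. G \<omega> \<partial>M)"
  using nn_integral_distr[OF measurable_fst, of G M M] assms by (simp add: distr_pair_fst)

section \<open>Dependence between curves at different times\<close>

lemma inner_Xc_squared_integrable:
  assumes "t \<ge> 1" "u \<ge> 1"
  shows "integrable M (\<lambda>\<omega>. (inner (Xc t \<omega>) (Xc u \<omega>))\<^sup>2)"
proof (rule Bochner_Integration.integrable_bound)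
  show "integrable M (\<lambda>\<omega>. norm (Xc t \<omega>) ^ 4 + norm (Xc u \<omega>) ^ 4)"
    using assms by (intro Bochner_Integration.integrable_add fourth_moment)
  show "(\<lambda>\<omega>. (inner (Xc t \<omega>) (Xc u \<omega>))\<^sup>2) \<in> borel_measurable M"
    using assms by measurable
  have "(inner x y)\<^sup>2 \<le> norm x ^ 4 + norm y ^ 4" for x y :: l2
  proof -
    have "\<bar>inner x y\<bar>\<^sup>2 \<le> (norm x * norm y)\<^sup>2"
      by (intro power_mono Cauchy_Schwarz_ineq2) simp
    moreover have "2 * (norm x)\<^sup>2 * (norm y)\<^sup>2 \<le> ((norm x)\<^sup>2)\<^sup>2 + ((norm y)\<^sup>2)\<^sup>2"
      by (rule sum_squares_bound)
    moreover have "((norm x)\<^sup>2)\<^sup>2 = norm x ^ 4" "((norm y)\<^sup>2)\<^sup>2 = norm y ^ 4"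
      by simp_all
    moreover have "0 \<le> (norm x)\<^sup>2 * (norm y)\<^sup>2" by simp
    ultimately show ?thesis unfolding power2_abs power_mult_distrib by linarith
  qed
  then show "AE \<omega> in M. norm ((inner (Xc t \<omega>) (Xc u \<omega>))\<^sup>2) \<le> norm (norm (Xc t \<omega>) ^ 4 + norm (Xc u \<omega>) ^ 4)"
    by (intro AE_I2) (simp add: abs_of_nonneg)
qed

text \<open>Here \<open>b\<close> will be the coupled copy of \<open>h\<close>, independent of \<open>a\<close>, and \<open>D\<close> its \<open>L\<^sup>4\<close>-distance
  to \<open>h\<close>; all correction terms then have expectation of order \<open>D\<close>.\<close>

lemma coupling_inequality:
  fixes a b h :: "'a::real_inner"
  assumes "D > 0"
  shows "(inner a h)\<^sup>2 \<le> (inner a b)\<^sup>2 + D / 2 * norm a ^ 4 + 1 / (4 * D ^ 3) * norm (h - b) ^ 4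
           + 2 * D * norm h ^ 4 + 2 * D * norm b ^ 4"
proof -
  \<comment> \<open>Once \<open>D\<close> dominates the coupling distance, \<open>W ^ 4\<close> has
    expectation at most 1, and the extracted factor \<open>D\<close> sets the size of the
    correction.\<close>
  define W where "W = norm (h - b) / D"
  define V where "V = norm h + norm b"
  have "(inner a h)\<^sup>2 - (inner a b)\<^sup>2 = inner a (h - b) * inner a (h + b)"
    by (simp add: inner_diff_right inner_add_right algebra_simps power2_eq_square)
  also have "\<dots> \<le> \<bar>inner a (h - b)\<bar> * \<bar>inner a (h + b)\<bar>" by (simp flip: abs_mult)
  also have "\<dots> \<le> (norm a * norm (h - b)) * (norm a * norm (h + b))"
    by (intro mult_mono Cauchy_Schwarz_ineq2) auto
  also have "\<dots> \<le> (norm a * norm (h - b)) * (norm a * V)"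
    unfolding V_def by (intro mult_left_mono norm_triangle_ineq) auto
  also have "\<dots> = D * ((norm a)\<^sup>2 * (W * V))"
    using assms by (simp add: W_def power2_eq_square mult_ac)
  finally have 1: "(inner a h)\<^sup>2 \<le> (inner a b)\<^sup>2 + D * ((norm a)\<^sup>2 * (W * V))" by simp
  have sq: "(x\<^sup>2)\<^sup>2 = x ^ 4" for x :: real by simp
  have "2 * (norm a)\<^sup>2 * (W * V) \<le> norm a ^ 4 + (W * V)\<^sup>2"
    using sum_squares_bound[of "(norm a)\<^sup>2" "W * V"] by simp
  moreover have "2 * (W * V)\<^sup>2 \<le> W ^ 4 + V ^ 4"
    using sum_squares_bound[of "W\<^sup>2" "V\<^sup>2"] by (simp add: power_mult_distrib)
  moreover have "V ^ 4 \<le> 8 * (norm h ^ 4 + norm b ^ 4)"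
  proof -
    have "0 \<le> (norm h - norm b)\<^sup>2" by simp
    then have "V\<^sup>2 \<le> 2 * ((norm h)\<^sup>2 + (norm b)\<^sup>2)"
      unfolding V_def power2_sum power2_diff by simp
    then have "(V\<^sup>2)\<^sup>2 \<le> (2 * ((norm h)\<^sup>2 + (norm b)\<^sup>2))\<^sup>2" by (intro power_mono) auto
    also have "\<dots> = 4 * (norm h ^ 4 + norm b ^ 4 + 2 * (norm h)\<^sup>2 * (norm b)\<^sup>2)"
      by (simp add: power_mult_distrib power2_sum)
    also have "\<dots> \<le> 4 * (norm h ^ 4 + norm b ^ 4 + (norm h ^ 4 + norm b ^ 4))"
      using sum_squares_bound[of "(norm h)\<^sup>2" "(norm b)\<^sup>2"] by simp
    finally show ?thesis by simp
  qed
  ultimately have "(norm a)\<^sup>2 * (W * V) \<le> norm a ^ 4 / 2 + W ^ 4 / 4 + 2 * (norm h ^ 4 + norm b ^ 4)"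
    by linarith
  then have "D * ((norm a)\<^sup>2 * (W * V)) \<le> D * (norm a ^ 4 / 2 + W ^ 4 / 4 + 2 * (norm h ^ 4 + norm b ^ 4))"
    using assms by (intro mult_left_mono) auto
  also have "\<dots> = D / 2 * norm a ^ 4 + D * W ^ 4 / 4 + 2 * D * norm h ^ 4 + 2 * D * norm b ^ 4"
    by (simp add: algebra_simps)
  also have "D * W ^ 4 / 4 = 1 / (4 * D ^ 3) * norm (h - b) ^ 4"
    using assms by (simp add: W_def power_divide field_simps eval_nat_numeral)
  finally show ?thesis using 1 by simp
qed

text \<open>The coefficients of the correction in \<open>coupling_inequality\<close>, in units of
  \<open>D\<close>: 1/2 + 2 + 2 for the three fourth moments and 1/4 for the coupling term.\<close>

definition c_dep :: real where "c_dep = 9 / 2 * m\<^sub>4 + 1 / 4"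

lemma c_dep_pos: "0 < c_dep"
  using m\<^sub>4_nonneg by (simp add: c_dep_def)

lemma kernel_norm2_nonneg: "0 \<le> kernel_norm2"
  by (simp add: kernel_norm2_def)

text \<open>A shift moves the two times to 0 and \<open>Suc n\<close>. The later curve is then
  replaced by its coupled copy, for which the expectation is \<open>kernel_norm2\<close> by
  independence, and \<open>coupling_inequality\<close> prices the replacement.\<close>

lemma lagged_inner_bound:
  assumes t: "t \<ge> 1"
  shows "(\<integral>\<omega>. (inner (Xc t \<omega>) (Xc (t + Suc n) \<omega>))\<^sup>2 \<partial>M) \<le> kernel_norm2 + c_dep * dep n"
proof (rule field_le_epsilon)
  fix e :: real assume "0 < e"
  \<comment> \<open>\<open>coupling_inequality\<close> requires a positive \<open>D\<close>, while
    \<open>dep n\<close> may be zero. The slack is chosen to cost exactly \<open>e\<close> after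
    multiplication by \<open>c_dep\<close>.\<close>
  define D where "D = dep n + e / c_dep"
  have D: "D > 0" "dep n \<le> D" using dep_nonneg[of n] \<open>0 < e\<close> c_dep_pos by (auto simp: D_def add_nonneg_pos)
  interpret MM: pair_prob_space M M ..
  define A where "A z = causal 0 (E (fst z))" for z :: "'w \<times> 'w"
  define H where "H z = causal (int (Suc n)) (E (fst z))" for z :: "'w \<times> 'w"
  define B where "B z = l2_class (f (coupled eps (Suc n) (Suc n) z))" for z :: "'w \<times> 'w"
  have [measurable]: "A \<in> borel_measurable (M \<Otimes>\<^sub>M M)" "H \<in> borel_measurable (M \<Otimes>\<^sub>M M)" "B \<in> borel_measurable (M \<Otimes>\<^sub>M M)"
    unfolding A_def[abs_def] H_def[abs_def] B_def[abs_def] coupled_both by measurable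
  have "ennreal (\<integral>\<omega>. (inner (Xc t \<omega>) (Xc (t + Suc n) \<omega>))\<^sup>2 \<partial>M) = (\<integral>\<^sup>+\<omega>. ennreal ((inner (Xc t \<omega>) (Xc (t + Suc n) \<omega>))\<^sup>2) \<partial>M)"
    using inner_Xc_squared_integrable[OF t, of "t + Suc n"] by (subst nn_integral_eq_integral) auto
  also have "\<dots> = (\<integral>\<^sup>+\<omega>. ennreal ((inner (causal (0 + int t) (E \<omega>)) (causal (int (Suc n) + int t) (E \<omega>)))\<^sup>2) \<partial>M)"
  proof (rule nn_integral_cong_AE)
    show "AE \<omega> in M. ennreal ((inner (Xc t \<omega>) (Xc (t + Suc n) \<omega>))\<^sup>2) =
      ennreal ((inner (causal (0 + int t) (E \<omega>)) (causal (int (Suc n) + int t) (E \<omega>)))\<^sup>2)"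
    proof -
      have e: "int (Suc n) + int t = int (t + Suc n)" by simp
      have "AE \<omega> in M. Xc (t + Suc n) \<omega> = causal (int (Suc n) + int t) (E \<omega>)"
        unfolding e by (rule Xc_causal) simp
      with Xc_causal[OF t] show ?thesis by eventually_elim simp
    qed
  qed
  also have "\<dots> = (\<integral>\<^sup>+\<omega>. ennreal ((inner (causal 0 (E \<omega>)) (causal (int (Suc n)) (E \<omega>)))\<^sup>2) \<partial>M)"
    by (rule nn_integral_causal_shift[where G = "\<lambda>x y. ennreal ((inner x y)\<^sup>2)"]) measurable
  also have "\<dots> = (\<integral>\<^sup>+z. ennreal ((inner (A z) (H z))\<^sup>2) \<partial>(M \<Otimes>\<^sub>M M))"
    unfolding A_def H_def by (rule nn_integral_fst_marginal[symmetric]) measurable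
  also have "\<dots> \<le> (\<integral>\<^sup>+z. ennreal ((inner (A z) (B z))\<^sup>2) + ennreal (D / 2) * ennreal (norm (A z) ^ 4)
      + ennreal (1 / (4 * D ^ 3)) * ennreal (norm (H z - B z) ^ 4)
      + ennreal (2 * D) * ennreal (norm (H z) ^ 4) + ennreal (2 * D) * ennreal (norm (B z) ^ 4) \<partial>(M \<Otimes>\<^sub>M M))"
    using D(1) coupling_inequality[OF D(1)]
    by (intro nn_integral_mono) (simp add: ennreal_leI flip: ennreal_mult ennreal_plus)
  also have "\<dots> = (\<integral>\<^sup>+z. ennreal ((inner (A z) (B z))\<^sup>2) \<partial>(M \<Otimes>\<^sub>M M)) + ennreal (D / 2) * (\<integral>\<^sup>+z. ennreal (norm (A z) ^ 4) \<partial>(M \<Otimes>\<^sub>M M))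
      + ennreal (1 / (4 * D ^ 3)) * (\<integral>\<^sup>+z. ennreal (norm (H z - B z) ^ 4) \<partial>(M \<Otimes>\<^sub>M M))
      + ennreal (2 * D) * (\<integral>\<^sup>+z. ennreal (norm (H z) ^ 4) \<partial>(M \<Otimes>\<^sub>M M)) + ennreal (2 * D) * (\<integral>\<^sup>+z. ennreal (norm (B z) ^ 4) \<partial>(M \<Otimes>\<^sub>M M))"
    by (simp add: nn_integral_add nn_integral_cmult)
  also have "(\<integral>\<^sup>+z. ennreal ((inner (A z) (B z))\<^sup>2) \<partial>(M \<Otimes>\<^sub>M M)) = ennreal kernel_norm2"
  proof -
    have "(\<integral>\<^sup>+z. ennreal ((inner (A z) (B z))\<^sup>2) \<partial>(M \<Otimes>\<^sub>M M)) =
        (\<integral>\<^sup>+\<omega>. \<integral>\<^sup>+\<omega>'. ennreal ((inner (causal 0 (E \<omega>)) (causal (int (Suc n)) (E \<omega>')))\<^sup>2) \<partial>M \<partial>M)"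
      unfolding A_def B_def by (rule coupling_law[where G = "\<lambda>x y. ennreal ((inner x y)\<^sup>2)"]) measurable
    also have "\<dots> = ennreal kernel_norm2" by (rule nn_integral_independent) simp
    finally show ?thesis .
  qed
  also have "(\<integral>\<^sup>+z. ennreal (norm (A z) ^ 4) \<partial>(M \<Otimes>\<^sub>M M)) = ennreal m\<^sub>4"
    unfolding A_def nn_integral_causal_fourth[of 0, symmetric] by (rule nn_integral_fst_marginal) measurable
  also have "(\<integral>\<^sup>+z. ennreal (norm (H z) ^ 4) \<partial>(M \<Otimes>\<^sub>M M)) = ennreal m\<^sub>4"
    unfolding H_def nn_integral_causal_fourth[of "int (Suc n)", symmetric] by (rule nn_integral_fst_marginal) measurable
  also have "(\<integral>\<^sup>+z. ennreal (norm (B z) ^ 4) \<partial>(M \<Otimes>\<^sub>M M)) = ennreal m\<^sub>4"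
  proof -
    have "(\<integral>\<^sup>+z. ennreal (norm (B z) ^ 4) \<partial>(M \<Otimes>\<^sub>M M)) = (\<integral>\<^sup>+\<omega>. \<integral>\<^sup>+\<omega>'. ennreal (norm (causal (int (Suc n)) (E \<omega>')) ^ 4) \<partial>M \<partial>M)"
      unfolding B_def by (rule coupling_law[where G = "\<lambda>x y. ennreal (norm y ^ 4)"]) measurable
    also have "\<dots> = ennreal m\<^sub>4" unfolding nn_integral_causal_fourth by (simp add: emeasure_space_1)
    finally show ?thesis .
  qed
  also have "(\<integral>\<^sup>+z. ennreal (norm (H z - B z) ^ 4) \<partial>(M \<Otimes>\<^sub>M M)) = ennreal (dep n ^ 4)"
    unfolding H_def B_def by (rule nn_integral_coupling_distance)
  also have "ennreal kernel_norm2 + ennreal (D / 2) * ennreal m\<^sub>4 + ennreal (1 / (4 * D ^ 3)) * ennreal (dep n ^ 4)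
      + ennreal (2 * D) * ennreal m\<^sub>4 + ennreal (2 * D) * ennreal m\<^sub>4
      = ennreal (kernel_norm2 + D / 2 * m\<^sub>4 + 1 / (4 * D ^ 3) * dep n ^ 4 + 2 * D * m\<^sub>4 + 2 * D * m\<^sub>4)"
    using D(1) m\<^sub>4_nonneg kernel_norm2_nonneg by (simp flip: ennreal_mult ennreal_plus)
  finally have "(\<integral>\<omega>. (inner (Xc t \<omega>) (Xc (t + Suc n) \<omega>))\<^sup>2 \<partial>M)
      \<le> kernel_norm2 + D / 2 * m\<^sub>4 + 1 / (4 * D ^ 3) * dep n ^ 4 + 2 * D * m\<^sub>4 + 2 * D * m\<^sub>4"
    using D(1) m\<^sub>4_nonneg kernel_norm2_nonneg by (subst (asm) ennreal_le_iff) (auto intro!: add_nonneg_nonneg)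
  also have "\<dots> \<le> kernel_norm2 + D / 2 * m\<^sub>4 + 1 / (4 * D ^ 3) * D ^ 4 + 2 * D * m\<^sub>4 + 2 * D * m\<^sub>4"
    using D dep_nonneg[of n] by (intro add_right_mono add_left_mono mult_left_mono power_mono) auto
  also have "1 / (4 * D ^ 3) * D ^ 4 = D / 4" using D(1) by (simp add: field_simps eval_nat_numeral)
  also have "kernel_norm2 + D / 2 * m\<^sub>4 + D / 4 + 2 * D * m\<^sub>4 + 2 * D * m\<^sub>4 = kernel_norm2 + c_dep * D"
    by (simp add: c_dep_def algebra_simps)
  also have "\<dots> = kernel_norm2 + c_dep * dep n + e"
    using c_dep_pos by (simp add: D_def distrib_left)
  finally show "(\<integral>\<omega>. (inner (Xc t \<omega>) (Xc (t + Suc n) \<omega>))\<^sup>2 \<partial>M) \<le> kernel_norm2 + c_dep * dep n + e" .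
qed

text \<open>The diagonal term of a row plus the summed corrections for later and for earlier
  times.\<close>

definition c_hs :: real where "c_hs = m\<^sub>4 + 2 * c_dep * suminf dep"

lemma c_hs_nonneg: "0 \<le> c_hs"
  using m\<^sub>4_nonneg c_dep_pos suminf_nonneg[OF summable_dep dep_nonneg] by (simp add: c_hs_def)

lemma sum_dep_le:
  assumes "finite I" "inj_on g I"
  shows "(\<Sum>i\<in>I. dep (g i)) \<le> suminf dep"
proof -
  have "(\<Sum>i\<in>I. dep (g i)) = (\<Sum>k\<in>g ` I. dep k)" using assms by (simp add: sum.reindex)
  also have "\<dots> \<le> suminf dep"
    using assms by (intro sum_le_suminf summable_dep) (auto simp: dep_nonneg)
  finally show ?thesis .
qed

text \<open>Each off-diagonal term exceeds \<open>kernel_norm2\<close> by at most a multiple of the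
  coupling distance at its lag. Within each of the two sides the lags are distinct, so the total
  excess is bounded independently of n.\<close>

lemma inner_row_bound:
  assumes t: "t \<in> {1..n}"
  shows "(\<Sum>u\<in>{1..n}. \<integral>\<omega>. (inner (Xc t \<omega>) (Xc u \<omega>))\<^sup>2 \<partial>M) \<le> real n * kernel_norm2 + c_hs"
proof -
  let ?a = "\<lambda>u. \<integral>\<omega>. (inner (Xc t \<omega>) (Xc u \<omega>))\<^sup>2 \<partial>M"
  have later: "?a u \<le> kernel_norm2 + c_dep * dep (u - t - 1)" if "u \<in> {t<..n}" for u
    using lagged_inner_bound[of t "u - t - 1"] that t by simp
  have earlier: "?a u \<le> kernel_norm2 + c_dep * dep (t - u - 1)" if "u \<in> {1..<t}" for u
    using lagged_inner_bound[of u "t - u - 1"] that by (simp add: inner_commute)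
  have diag: "?a t = m\<^sub>4"
  proof -
    have "(inner x x)\<^sup>2 = norm x ^ 4" for x :: l2
      unfolding power2_norm_eq_inner[symmetric] by simp
    then show ?thesis using fourth_moment_eq[of t] t by simp
  qed
  have iv: "{1..n} = {1..<t} \<union> {t} \<union> {t<..n}" using t by auto
  have "(\<Sum>u\<in>{1..n}. ?a u) = (\<Sum>u\<in>{1..<t}. ?a u) + ?a t + (\<Sum>u\<in>{t<..n}. ?a u)"
    unfolding iv by (subst sum.union_disjoint; (subst sum.union_disjoint)?) auto
  \<comment> \<open>The diagonal term is enlarged by \<open>kernel_norm2\<close>, so that all n
    terms of the row carry it.\<close>
  also have "\<dots> \<le> (\<Sum>u\<in>{1..<t}. kernel_norm2 + c_dep * dep (t - u - 1)) + (kernel_norm2 + m\<^sub>4)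
      + (\<Sum>u\<in>{t<..n}. kernel_norm2 + c_dep * dep (u - t - 1))"
    unfolding diag using kernel_norm2_nonneg by (intro add_mono sum_mono later earlier) auto
  also have "\<dots> = (real (t - 1) + 1 + real (n - t)) * kernel_norm2 + m\<^sub>4
      + c_dep * ((\<Sum>u\<in>{1..<t}. dep (t - u - 1)) + (\<Sum>u\<in>{t<..n}. dep (u - t - 1)))"
    by (simp add: sum.distrib sum_distrib_left algebra_simps)
  also have "real (t - 1) + 1 + real (n - t) = real n" using t by auto
  also have "real n * kernel_norm2 + m\<^sub>4 + c_dep * ((\<Sum>u\<in>{1..<t}. dep (t - u - 1)) + (\<Sum>u\<in>{t<..n}. dep (u - t - 1)))
      \<le> real n * kernel_norm2 + m\<^sub>4 + c_dep * (suminf dep + suminf dep)"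
    using c_dep_pos by (intro add_left_mono mult_left_mono add_mono sum_dep_le) (auto simp: inj_on_def)
  finally show ?thesis by (simp add: c_hs_def)
qed

text \<open>The multiples 1, -2 and 1 of \<open>kernel_norm2\<close> cancel. What remains is the
  excess \<open>c_hs\<close> of n rows, divided by n squared.\<close>

lemma hs_dist2_expectation:
  assumes n: "n \<ge> 1"
  shows "integrable M (hs_dist2 n)" and "(\<integral>\<omega>. hs_dist2 n \<omega> \<partial>M) \<le> c_hs / real n"
proof -
  have i1: "integrable M (\<lambda>\<omega>. (inner (Xc t \<omega>) (Xc u \<omega>))\<^sup>2)" if "t \<in> {1..n}" "u \<in> {1..n}" for t u
    using that by (intro inner_Xc_squared_integrable) auto
  have i2: "integrable M (\<lambda>\<omega>. \<Sum>t\<in>{1..n}. \<Sum>u\<in>{1..n}. (inner (Xc t \<omega>) (Xc u \<omega>))\<^sup>2)"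
    by (intro Bochner_Integration.integrable_sum i1)
  have i3: "integrable M (\<lambda>\<omega>. \<Sum>t\<in>{1..n}. inner (K.op (Xc t \<omega>)) (Xc t \<omega>))"
    by (intro Bochner_Integration.integrable_sum expectation_op_Xc) auto
  show "integrable M (hs_dist2 n)"
    unfolding hs_dist2_def[abs_def]
    by (intro Bochner_Integration.integrable_add Bochner_Integration.integrable_diff integrable_divide
        integrable_mult_right i2 i3) simp
  have e2: "(\<integral>\<omega>. (\<Sum>t\<in>{1..n}. \<Sum>u\<in>{1..n}. (inner (Xc t \<omega>) (Xc u \<omega>))\<^sup>2) \<partial>M)
      = (\<Sum>t\<in>{1..n}. \<Sum>u\<in>{1..n}. \<integral>\<omega>. (inner (Xc t \<omega>) (Xc u \<omega>))\<^sup>2 \<partial>M)"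
  proof -
    have "(\<integral>\<omega>. (\<Sum>t\<in>{1..n}. \<Sum>u\<in>{1..n}. (inner (Xc t \<omega>) (Xc u \<omega>))\<^sup>2) \<partial>M)
        = (\<Sum>t\<in>{1..n}. \<integral>\<omega>. (\<Sum>u\<in>{1..n}. (inner (Xc t \<omega>) (Xc u \<omega>))\<^sup>2) \<partial>M)"
      by (intro Bochner_Integration.integral_sum Bochner_Integration.integrable_sum i1)
    also have "\<dots> = (\<Sum>t\<in>{1..n}. \<Sum>u\<in>{1..n}. \<integral>\<omega>. (inner (Xc t \<omega>) (Xc u \<omega>))\<^sup>2 \<partial>M)"
      by (intro sum.cong refl Bochner_Integration.integral_sum i1)
    finally show ?thesis .
  qed
  have e3: "(\<integral>\<omega>. (\<Sum>t\<in>{1..n}. inner (K.op (Xc t \<omega>)) (Xc t \<omega>)) \<partial>M) = real n * kernel_norm2"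
  proof -
    have "(\<integral>\<omega>. (\<Sum>t\<in>{1..n}. inner (K.op (Xc t \<omega>)) (Xc t \<omega>)) \<partial>M)
        = (\<Sum>t\<in>{1..n}. \<integral>\<omega>. inner (K.op (Xc t \<omega>)) (Xc t \<omega>) \<partial>M)"
      by (intro Bochner_Integration.integral_sum expectation_op_Xc) auto
    also have "\<dots> = (\<Sum>t\<in>{1..n}. kernel_norm2)" by (intro sum.cong refl expectation_op_Xc) auto
    finally show ?thesis by simp
  qed
  have "(\<integral>\<omega>. hs_dist2 n \<omega> \<partial>M)
      = (\<Sum>t\<in>{1..n}. \<Sum>u\<in>{1..n}. \<integral>\<omega>. (inner (Xc t \<omega>) (Xc u \<omega>))\<^sup>2 \<partial>M) / (real n)\<^sup>2
        - 2 * (real n * kernel_norm2) / real n + kernel_norm2"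
  proof -
    have "(\<integral>\<omega>. hs_dist2 n \<omega> \<partial>M) = (\<integral>\<omega>. (\<Sum>t\<in>{1..n}. \<Sum>u\<in>{1..n}. (inner (Xc t \<omega>) (Xc u \<omega>))\<^sup>2) / (real n)\<^sup>2
     - 2 * (\<Sum>t\<in>{1..n}. inner (K.op (Xc t \<omega>)) (Xc t \<omega>)) / real n \<partial>M) + (\<integral>\<omega>. kernel_norm2 \<partial>M)"
      unfolding hs_dist2_def
      by (intro Bochner_Integration.integral_add Bochner_Integration.integrable_diff integrable_divide
        integrable_mult_right i2 i3) simp
    also have "(\<integral>\<omega>. (\<Sum>t\<in>{1..n}. \<Sum>u\<in>{1..n}. (inner (Xc t \<omega>) (Xc u \<omega>))\<^sup>2) / (real n)\<^sup>2
     - 2 * (\<Sum>t\<in>{1..n}. inner (K.op (Xc t \<omega>)) (Xc t \<omega>)) / real n \<partial>M)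
       = (\<integral>\<omega>. (\<Sum>t\<in>{1..n}. \<Sum>u\<in>{1..n}. (inner (Xc t \<omega>) (Xc u \<omega>))\<^sup>2) / (real n)\<^sup>2 \<partial>M)
        - (\<integral>\<omega>. 2 * (\<Sum>t\<in>{1..n}. inner (K.op (Xc t \<omega>)) (Xc t \<omega>)) / real n \<partial>M)"
      by (intro Bochner_Integration.integral_diff integrable_divide integrable_mult_right i2 i3)
    finally show ?thesis
      unfolding integral_divide_zero integral_mult_right_zero e2 e3 using prob_space by simp
  qed
  also have "\<dots> \<le> (\<Sum>t\<in>{1..n}. real n * kernel_norm2 + c_hs) / (real n)\<^sup>2
        - 2 * (real n * kernel_norm2) / real n + kernel_norm2"
    by (intro add_right_mono diff_right_mono divide_right_mono sum_mono inner_row_bound) auto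
  also have "\<dots> = c_hs / real n"
    using n by (simp add: field_simps power2_eq_square)
  finally show "(\<integral>\<omega>. hs_dist2 n \<omega> \<partial>M) \<le> c_hs / real n" .
qed

end

section \<open>Noise and discretisation\<close>

text \<open>For a positive variance this is the moment formula of the centred normal law, with
  equality. In the degenerate case the zero mean forces the variable to vanish almost
  surely.\<close>

lemma (in prob_space) gaussian_centred_moments:
  assumes g: "gaussian M Z" and mean: "(\<integral>\<omega>. Z \<omega> \<partial>M) = 0"
  shows "integrable M (\<lambda>\<omega>. Z \<omega> ^ 4)" "integrable M (\<lambda>\<omega>. (Z \<omega>)\<^sup>2)"
    "(\<integral>\<omega>. Z \<omega> ^ 4 \<partial>M) \<le> 3 * (\<integral>\<omega>. (Z \<omega>)\<^sup>2 \<partial>M)\<^sup>2"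
proof -
  have Z [measurable]: "Z \<in> borel_measurable M" using g by (simp add: gaussian_def)
  obtain \<mu> \<sigma> where \<mu>\<sigma>: "if \<sigma> > 0 then distributed M lborel Z (normal_density \<mu> \<sigma>) else (AE \<omega> in M. Z \<omega> = \<mu>)"
    using g by (auto simp: gaussian_def)
  have "integrable M (\<lambda>\<omega>. Z \<omega> ^ 4) \<and> integrable M (\<lambda>\<omega>. (Z \<omega>)\<^sup>2)
    \<and> (\<integral>\<omega>. Z \<omega> ^ 4 \<partial>M) \<le> 3 * (\<integral>\<omega>. (Z \<omega>)\<^sup>2 \<partial>M)\<^sup>2"
  proof (cases "\<sigma> > 0")
    case True
    then have D: "distributed M lborel Z (normal_density \<mu> \<sigma>)" using \<mu>\<sigma> by simp
    have "\<mu> = 0" using normal_distributed_expectation[OF True D] mean by simp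
    have even: "integrable M (\<lambda>\<omega>. Z \<omega> ^ (2 * k))"
      "(\<integral>\<omega>. Z \<omega> ^ (2 * k) \<partial>M) = fact (2 * k) / ((2 / \<sigma>\<^sup>2) ^ k * fact k)" for k
    proof -
      note D0 = D[unfolded \<open>\<mu> = 0\<close>] and hb = normal_moment_even[OF True, of 0 k, unfolded diff_0_right]
      show "integrable M (\<lambda>\<omega>. Z \<omega> ^ (2 * k))"
        by (rule distributed_integrable[OF D0, THEN iffD1, rotated 2, OF integrable.intros[OF hb]]) auto
      have "(\<integral>\<omega>. Z \<omega> ^ (2 * k) \<partial>M) = (\<integral>x. normal_density 0 \<sigma> x * x ^ (2 * k) \<partial>lborel)"
        by (rule distributed_integral[OF D0, of "\<lambda>x. x ^ (2 * k)", symmetric]) auto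
      then show "(\<integral>\<omega>. Z \<omega> ^ (2 * k) \<partial>M) = fact (2 * k) / ((2 / \<sigma>\<^sup>2) ^ k * fact k)"
        unfolding has_bochner_integral_integral_eq[OF hb] .
    qed
    have "(\<integral>\<omega>. Z \<omega> ^ 4 \<partial>M) = 3 * \<sigma> ^ 4"
      using even(2)[of 2] True by (simp add: fact_numeral power_divide field_simps)
    moreover have "(\<integral>\<omega>. (Z \<omega>)\<^sup>2 \<partial>M) = \<sigma>\<^sup>2"
      using even(2)[of 1] True by (simp add: fact_numeral power2_eq_square)
    ultimately show ?thesis using even(1)[of 2] even(1)[of 1] by simp
  next
    case False
    then have ae: "AE \<omega> in M. Z \<omega> = \<mu>" using \<mu>\<sigma> by simp
    have "(\<integral>\<omega>. Z \<omega> \<partial>M) = (\<integral>\<omega>. \<mu> \<partial>M)" using ae by (intro integral_cong_AE) auto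
    then have "\<mu> = 0" using mean prob_space by simp
    from ae have z4: "AE \<omega> in M. Z \<omega> ^ 4 = 0" by eventually_elim (simp add: \<open>\<mu> = 0\<close>)
    from ae have z2: "AE \<omega> in M. (Z \<omega>)\<^sup>2 = 0" by eventually_elim (simp add: \<open>\<mu> = 0\<close>)
    have "integrable M (\<lambda>\<omega>. Z \<omega> ^ 4)" "integrable M (\<lambda>\<omega>. (Z \<omega>)\<^sup>2)"
      using integrable_cong_AE[of "\<lambda>\<omega>. Z \<omega> ^ 4" M "\<lambda>_. 0"] integrable_cong_AE[of "\<lambda>\<omega>. (Z \<omega>)\<^sup>2" M "\<lambda>_. 0"] z4 z2
      by auto
    moreover have "(\<integral>\<omega>. Z \<omega> ^ 4 \<partial>M) = 0" using integral_cong_AE[OF _ _ z4] by simp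
    ultimately show ?thesis by simp
  qed
  then show "integrable M (\<lambda>\<omega>. Z \<omega> ^ 4)" "integrable M (\<lambda>\<omega>. (Z \<omega>)\<^sup>2)"
    "(\<integral>\<omega>. Z \<omega> ^ 4 \<partial>M) \<le> 3 * (\<integral>\<omega>. (Z \<omega>)\<^sup>2 \<partial>M)\<^sup>2" by auto
qed

text \<open>The sigma-algebras generated by \<open>f\<close> and \<open>g\<close> lie in the
  independent ones. The lemma passes from independence of signal and noise to independence of
  functions of them.\<close>

lemma (in prob_space) indep_var_of_indep_set:
  assumes "indep_set (sets N1) (sets N2)" "space N1 = space M" "space N2 = space M"
    and f: "f \<in> measurable N1 S" and g: "g \<in> measurable N2 T"
  shows "indep_var S f T g"
proof -
  have sub: "sets N1 \<subseteq> events" "sets N2 \<subseteq> events"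
    using indep_setD_ev1[OF assms(1)] indep_setD_ev2[OF assms(1)] by auto
  have f': "{f -` A \<inter> space M |A. A \<in> sets S} \<subseteq> sets N1"
    using measurable_sets[OF f] assms(2) by auto
  have g': "{g -` A \<inter> space M |A. A \<in> sets T} \<subseteq> sets N2"
    using measurable_sets[OF g] assms(3) by auto
  have sf: "sigma_sets (space M) {f -` A \<inter> space M |A. A \<in> sets S} \<subseteq> sets N1"
    using sets.sigma_sets_subset[OF f'] assms(2) by simp
  have sg: "sigma_sets (space M) {g -` A \<inter> space M |A. A \<in> sets T} \<subseteq> sets N2"
    using sets.sigma_sets_subset[OF g'] assms(3) by simp
  have "f \<in> measurable M S" "g \<in> measurable M T"
    using f g f' g' sub assms(2,3) by (auto simp: measurable_def)
  moreover have "indep_set (sigma_sets (space M) {f -` A \<inter> space M |A. A \<in> sets S})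
      (sigma_sets (space M) {g -` A \<inter> space M |A. A \<in> sets T})"
    using assms(1) sf sg unfolding indep_sets2_eq by blast
  ultimately show ?thesis by (simp add: indep_var_eq)
qed

lemma (in prob_space) second_moment_sum_uncorrelated:
  fixes \<xi> :: "'i \<Rightarrow> 'a \<Rightarrow> real"
  assumes I: "finite I"
    and int: "\<And>t u. t \<in> I \<Longrightarrow> u \<in> I \<Longrightarrow> integrable M (\<lambda>\<omega>. \<xi> t \<omega> * \<xi> u \<omega>)"
    and orth: "\<And>t u. t \<in> I \<Longrightarrow> u \<in> I \<Longrightarrow> t \<noteq> u \<Longrightarrow> (\<integral>\<omega>. \<xi> t \<omega> * \<xi> u \<omega> \<partial>M) = 0"
  shows "integrable M (\<lambda>\<omega>. (\<Sum>t\<in>I. \<xi> t \<omega>)\<^sup>2)"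
    and "(\<integral>\<omega>. (\<Sum>t\<in>I. \<xi> t \<omega>)\<^sup>2 \<partial>M) = (\<Sum>t\<in>I. \<integral>\<omega>. (\<xi> t \<omega>)\<^sup>2 \<partial>M)"
proof -
  have eq: "(\<Sum>t\<in>I. \<xi> t \<omega>)\<^sup>2 = (\<Sum>t\<in>I. \<Sum>u\<in>I. \<xi> t \<omega> * \<xi> u \<omega>)" for \<omega>
    by (simp add: power2_eq_square sum_product)
  show "integrable M (\<lambda>\<omega>. (\<Sum>t\<in>I. \<xi> t \<omega>)\<^sup>2)"
    unfolding eq by (intro Bochner_Integration.integrable_sum int)
  have "(\<integral>\<omega>. (\<Sum>t\<in>I. \<xi> t \<omega>)\<^sup>2 \<partial>M) = (\<Sum>t\<in>I. \<integral>\<omega>. (\<Sum>u\<in>I. \<xi> t \<omega> * \<xi> u \<omega>) \<partial>M)"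
    unfolding eq by (intro Bochner_Integration.integral_sum Bochner_Integration.integrable_sum int)
  also have "\<dots> = (\<Sum>t\<in>I. \<Sum>u\<in>I. \<integral>\<omega>. \<xi> t \<omega> * \<xi> u \<omega> \<partial>M)"
    by (intro sum.cong refl Bochner_Integration.integral_sum int)
  also have "\<dots> = (\<Sum>t\<in>I. \<Sum>u\<in>I. if u = t then \<integral>\<omega>. (\<xi> t \<omega>)\<^sup>2 \<partial>M else 0)"
    using orth by (intro sum.cong refl) (auto simp: power2_eq_square)
  also have "\<dots> = (\<Sum>t\<in>I. \<integral>\<omega>. (\<xi> t \<omega>)\<^sup>2 \<partial>M)" using I by simp
  finally show "(\<integral>\<omega>. (\<Sum>t\<in>I. \<xi> t \<omega>)\<^sup>2 \<partial>M) = (\<Sum>t\<in>I. \<integral>\<omega>. (\<xi> t \<omega>)\<^sup>2 \<partial>M)" .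
qed

text \<open>One sample size. Increments are compared only from the left end of a cell to a point
  inside it, hence the range of \<open>h\<close>; once the cells are short enough, the regularity
  condition supplies one \<open>C_r\<close> for all sample sizes.\<close>

locale noisy_sample = functional_signal M X S eps f C_X
  for M :: "'w measure" and X S eps f C_X +
  fixes T p :: nat and U :: "nat \<Rightarrow> 'w \<Rightarrow> nat \<Rightarrow> real" and \<gamma> :: "int \<Rightarrow> real" and C C_r :: real
  assumes noise: "noise_cond M X T p U \<gamma> C" and T: "T \<ge> 1" and p: "p \<ge> 1"
    and increments: "\<And>s h. s \<in> {0..1} \<Longrightarrow> s + h \<in> {0..1} \<Longrightarrow> 0 < h \<Longrightarrow> h < 1 / real p \<Longrightarrow>
      (\<integral>\<omega>. (X 1 \<omega> (s + h) - X 1 \<omega> s)\<^sup>2 \<partial>M) \<le> C_r * h"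
    and C_r: "C_r \<ge> 0"
begin

lemma
  shows noise_indep: "indep_vars (\<lambda>_. PiM {1..p} (\<lambda>_. borel)) (\<lambda>t \<omega>. restrict (U t \<omega>) {1..p}) {1..T}"
    and signal_noise_indep: "indep_set
       (sets (vimage_algebra (space M) (curve_values X) (PiM curve_index (\<lambda>_. borel))))
       (sets (vimage_algebra (space M) (\<lambda>\<omega>. \<lambda>(t, i)\<in>{1..T} \<times> {1..p}. U t \<omega> i)
                (PiM ({1..T} \<times> {1..p}) (\<lambda>_. borel))))"
    and noise_gaussian: "t \<in> {1..T} \<Longrightarrow> gaussian_process M {1..p} (\<lambda>i \<omega>. U t \<omega> i)"
    and noise_mean: "t \<in> {1..T} \<Longrightarrow> i \<in> {1..p} \<Longrightarrow> (\<integral>\<omega>. U t \<omega> i \<partial>M) = 0"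
    and noise_cov: "t \<in> {1..T} \<Longrightarrow> i \<in> {1..p} \<Longrightarrow> j \<in> {1..p} \<Longrightarrow>
      cov M (\<lambda>\<omega>. U t \<omega> i) (\<lambda>\<omega>. U t \<omega> j) = \<gamma> (int i - int j)"
    and \<gamma>_summable: "(\<lambda>h. \<bar>\<gamma> h\<bar>) summable_on UNIV"
    and \<gamma>_sum_le: "(\<Sum>\<^sub>\<infinity>h. \<bar>\<gamma> h\<bar>) \<le> C"
proof -
  note n = noise[unfolded noise_cond_def]
  note n3 = n[THEN conjunct2, THEN conjunct2]
  note n4 = n3[THEN conjunct2, THEN conjunct1, rule_format] and n5 = n3[THEN conjunct2, THEN conjunct2]
  show "indep_vars (\<lambda>_. PiM {1..p} (\<lambda>_. borel)) (\<lambda>t \<omega>. restrict (U t \<omega>) {1..p}) {1..T}"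
    by (rule n[THEN conjunct1])
  show "indep_set (sets (vimage_algebra (space M) (curve_values X) (PiM curve_index (\<lambda>_. borel))))
      (sets (vimage_algebra (space M) (\<lambda>\<omega>. \<lambda>(t, i)\<in>{1..T} \<times> {1..p}. U t \<omega> i)
        (PiM ({1..T} \<times> {1..p}) (\<lambda>_. borel))))"
    by (rule n3[THEN conjunct1])
  show "gaussian_process M {1..p} (\<lambda>i \<omega>. U t \<omega> i)" if "t \<in> {1..T}"
    by (rule n4[OF that, THEN conjunct1])
  show "(\<integral>\<omega>. U t \<omega> i \<partial>M) = 0" if "t \<in> {1..T}" "i \<in> {1..p}"
    by (rule n4[OF that(1), THEN conjunct2, THEN conjunct1, rule_format, OF that(2)])
  show "cov M (\<lambda>\<omega>. U t \<omega> i) (\<lambda>\<omega>. U t \<omega> j) = \<gamma> (int i - int j)"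
    if "t \<in> {1..T}" "i \<in> {1..p}" "j \<in> {1..p}"
    by (rule n4[OF that(1), THEN conjunct2, THEN conjunct2, rule_format, OF that(2,3)])
  show "(\<lambda>h. \<bar>\<gamma> h\<bar>) summable_on UNIV" "(\<Sum>\<^sub>\<infinity>h. \<bar>\<gamma> h\<bar>) \<le> C"
    by (rule n5[THEN conjunct1], rule n5[THEN conjunct2])
qed

lemma \<gamma>_finite_sum_le: "finite I \<Longrightarrow> (\<Sum>h\<in>I. \<bar>\<gamma> h\<bar>) \<le> C"
  by (rule order_trans[OF finite_sum_le_infsum[OF \<gamma>_summable] \<gamma>_sum_le]) auto

lemma \<gamma>_le: "\<bar>\<gamma> h\<bar> \<le> C"
  using \<gamma>_finite_sum_le[of "{h}"] by simp

lemma C_nonneg: "0 \<le> C"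
  using \<gamma>_finite_sum_le[of "{}"] by simp

lemma U_measurable: "t \<in> {1..T} \<Longrightarrow> i \<in> {1..p} \<Longrightarrow> (\<lambda>\<omega>. U t \<omega> i) \<in> borel_measurable M"
proof -
  assume t: "t \<in> {1..T}" and i: "i \<in> {1..p}"
  have "(\<lambda>\<omega>. restrict (U t \<omega>) {1..p}) \<in> measurable M (PiM {1..p} (\<lambda>_. borel))"
    using noise_indep t unfolding indep_vars_def by blast
  from measurable_compose[OF this measurable_component_singleton[OF i]] show ?thesis
    unfolding restrict_apply'[OF i] .
qed

lemma U_gaussian:
  assumes "t \<in> {1..T}" "i \<in> {1..p}"
  shows "gaussian M (\<lambda>\<omega>. U t \<omega> i)"
  using noise_gaussian[OF assms(1), unfolded gaussian_process_def, rule_format, of "{i}" "\<lambda>_. 1"] assms(2)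
  by simp

lemma U_moments:
  assumes "t \<in> {1..T}" "i \<in> {1..p}"
  shows "integrable M (\<lambda>\<omega>. U t \<omega> i ^ 4)" "integrable M (\<lambda>\<omega>. (U t \<omega> i)\<^sup>2)"
    "(\<integral>\<omega>. U t \<omega> i ^ 4 \<partial>M) \<le> 3 * C\<^sup>2"
proof -
  note m = gaussian_centred_moments[OF U_gaussian[OF assms] noise_mean[OF assms]]
  show "integrable M (\<lambda>\<omega>. U t \<omega> i ^ 4)" "integrable M (\<lambda>\<omega>. (U t \<omega> i)\<^sup>2)" by (rule m)+
  have "(\<integral>\<omega>. (U t \<omega> i)\<^sup>2 \<partial>M) = \<gamma> 0"
    using noise_cov[OF assms assms(2)] noise_mean[OF assms] by (simp add: cov_def power2_eq_square)
  then have "(\<integral>\<omega>. (U t \<omega> i)\<^sup>2 \<partial>M)\<^sup>2 \<le> C\<^sup>2"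
    using \<gamma>_le[of 0] by (simp add: abs_le_square_iff[symmetric])
  then show "(\<integral>\<omega>. U t \<omega> i ^ 4 \<partial>M) \<le> 3 * C\<^sup>2" using m(3) by linarith
qed

lemma U_product:
  assumes "t \<in> {1..T}" "i \<in> {1..p}" "j \<in> {1..p}"
  shows "integrable M (\<lambda>\<omega>. U t \<omega> i * U t \<omega> j)" "(\<integral>\<omega>. U t \<omega> i * U t \<omega> j \<partial>M) = \<gamma> (int i - int j)"
    "integrable M (\<lambda>\<omega>. (U t \<omega> i * U t \<omega> j)\<^sup>2)" "(\<integral>\<omega>. (U t \<omega> i * U t \<omega> j)\<^sup>2 \<partial>M) \<le> 3 * C\<^sup>2"
proof -
  note Ui = U_moments[OF assms(1,2)] and Uj = U_moments[OF assms(1,3)]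
  have [measurable]: "(\<lambda>\<omega>. U t \<omega> i) \<in> borel_measurable M" "(\<lambda>\<omega>. U t \<omega> j) \<in> borel_measurable M"
    using assms by (auto intro: U_measurable)
  show "integrable M (\<lambda>\<omega>. U t \<omega> i * U t \<omega> j)"
    by (intro integrable_mult_squares Ui Uj) auto
  show "(\<integral>\<omega>. U t \<omega> i * U t \<omega> j \<partial>M) = \<gamma> (int i - int j)"
    using noise_cov[OF assms] noise_mean[OF assms(1,2)] noise_mean[OF assms(1,3)] by (simp add: cov_def)
  have eq: "(x * y)\<^sup>2 \<le> (x ^ 4 + y ^ 4) / 2" for x y :: real
    using sum_squares_bound[of "x\<^sup>2" "y\<^sup>2"] by (simp add: power_mult_distrib)
  have bnd: "integrable M (\<lambda>\<omega>. (U t \<omega> i ^ 4 + U t \<omega> j ^ 4) / 2)" using Ui Uj by simp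
  show int: "integrable M (\<lambda>\<omega>. (U t \<omega> i * U t \<omega> j)\<^sup>2)"
  proof (rule Bochner_Integration.integrable_bound[OF bnd])
    have "norm ((x * y)\<^sup>2) \<le> norm ((x ^ 4 + y ^ 4) / 2)" for x y :: real
      using eq[of x y] by simp
    then show "AE \<omega> in M. norm ((U t \<omega> i * U t \<omega> j)\<^sup>2) \<le> norm ((U t \<omega> i ^ 4 + U t \<omega> j ^ 4) / 2)" by blast
  qed measurable
  have "(\<integral>\<omega>. (U t \<omega> i * U t \<omega> j)\<^sup>2 \<partial>M) \<le> (\<integral>\<omega>. (U t \<omega> i ^ 4 + U t \<omega> j ^ 4) / 2 \<partial>M)"
    by (intro integral_mono int bnd eq)
  also have "\<dots> \<le> 3 * C\<^sup>2" using Ui Uj by simp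
  finally show "(\<integral>\<omega>. (U t \<omega> i * U t \<omega> j)\<^sup>2 \<partial>M) \<le> 3 * C\<^sup>2" .
qed

lemma noise_pair_indep:
  assumes tu: "t \<in> {1..T}" "u \<in> {1..T}" "t \<noteq> u"
    and g: "g \<in> borel_measurable (PiM {1..p} (\<lambda>_. borel :: real measure))"
      "h \<in> borel_measurable (PiM {1..p} (\<lambda>_. borel :: real measure))"
  shows "indep_var borel (\<lambda>\<omega>. g (restrict (U t \<omega>) {1..p})) borel (\<lambda>\<omega>. h (restrict (U u \<omega>) {1..p}))"
proof -
  let ?P = "PiM {1..p} (\<lambda>_. borel :: real measure)"
  have ind: "indep_var (PiM {t} (\<lambda>_. ?P)) (\<lambda>\<omega>. restrict (\<lambda>t. restrict (U t \<omega>) {1..p}) {t})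
      (PiM {u} (\<lambda>_. ?P)) (\<lambda>\<omega>. restrict (\<lambda>t. restrict (U t \<omega>) {1..p}) {u})"
    using tu by (intro indep_var_restrict[OF noise_indep]) auto
  have m1: "(\<lambda>y. g (y t)) \<in> borel_measurable (PiM {t} (\<lambda>_. ?P))"
    by (rule measurable_compose[OF measurable_component_singleton[of t "{t}" "\<lambda>_. ?P"] g(1)]) simp
  have m2: "(\<lambda>y. h (y u)) \<in> borel_measurable (PiM {u} (\<lambda>_. ?P))"
    by (rule measurable_compose[OF measurable_component_singleton[of u "{u}" "\<lambda>_. ?P"] g(2)]) simp
  show ?thesis using indep_var_compose[OF ind m1 m2] by (simp add: o_def)
qed

lemma noise_uncorrelated:
  assumes tu: "t \<in> {1..T}" "u \<in> {1..T}" "t \<noteq> u" and j: "j \<in> {1..p}"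
  shows "(\<integral>\<omega>. U t \<omega> j * U u \<omega> j \<partial>M) = 0"
proof -
  have "indep_var borel (\<lambda>\<omega>. restrict (U t \<omega>) {1..p} j) borel (\<lambda>\<omega>. restrict (U u \<omega>) {1..p} j)"
    using j by (intro noise_pair_indep[OF tu] measurable_component_singleton)
  then have "indep_var borel (\<lambda>\<omega>. U t \<omega> j) borel (\<lambda>\<omega>. U u \<omega> j)" using j by simp
  moreover have "integrable M (\<lambda>\<omega>. U t \<omega> j)" if "t \<in> {1..T}" for t
    using square_integrable_imp_integrable[OF U_measurable[OF that j]] U_moments(2)[OF that j] by simp
  ultimately have "(\<integral>\<omega>. U t \<omega> j * U u \<omega> j \<partial>M) = (\<integral>\<omega>. U t \<omega> j \<partial>M) * (\<integral>\<omega>. U u \<omega> j \<partial>M)"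
    using tu by (intro indep_var_lebesgue_integral) auto
  then show ?thesis using noise_mean[OF tu(1) j] by simp
qed

text \<open>The first factor is measurable for the sigma-algebra of the signal and the second for
  that of the noise, so the expectation of the product factorises.\<close>

lemma signal_noise_pair:
  assumes tu: "t \<in> {1..T}" "u \<in> {1..T}" and j: "j \<in> {1..p}" and s: "s \<in> {0..1}"
  shows "integrable M (\<lambda>\<omega>. (X t \<omega> s * X u \<omega> s) * (U t \<omega> j * U u \<omega> j))"
    and "(\<integral>\<omega>. (X t \<omega> s * X u \<omega> s) * (U t \<omega> j * U u \<omega> j) \<partial>M) =
      (\<integral>\<omega>. X t \<omega> s * X u \<omega> s \<partial>M) * (\<integral>\<omega>. U t \<omega> j * U u \<omega> j \<partial>M)"
proof -
  let ?P = "PiM curve_index (\<lambda>_. borel :: real measure)"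
  let ?Q = "PiM ({1..T} \<times> {1..p}) (\<lambda>_. borel :: real measure)"
  let ?V = "\<lambda>\<omega>. \<lambda>(t, i)\<in>{1..T} \<times> {1..p}. U t \<omega> i"
  let ?N1 = "vimage_algebra (space M) (curve_values X) ?P"
  let ?N2 = "vimage_algebra (space M) ?V ?Q"
  have cv: "curve_values X \<in> measurable ?N1 ?P"
    by (rule measurable_vimage_algebra1) (auto simp: curve_values_def space_PiM)
  have X1: "(\<lambda>\<omega>. X v \<omega> s) \<in> borel_measurable ?N1" if "v \<ge> 1" for v
  proof -
    have "(\<lambda>y. y (v, s)) \<in> borel_measurable ?P" using that s by (intro measurable_component_singleton) auto
    from measurable_compose[OF cv this] show ?thesis using that s by (simp add: curve_values_def)
  qed
  have vv: "?V \<in> measurable ?N2 ?Q"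
    by (rule measurable_vimage_algebra1) (auto simp: space_PiM)
  have U1: "(\<lambda>\<omega>. U v \<omega> j) \<in> borel_measurable ?N2" if "v \<in> {1..T}" for v
  proof -
    have "(\<lambda>y. y (v, j)) \<in> borel_measurable ?Q" using that j by (intro measurable_component_singleton) auto
    from measurable_compose[OF vv this] show ?thesis using that j by simp
  qed
  have ind: "indep_var borel (\<lambda>\<omega>. X t \<omega> s * X u \<omega> s) borel (\<lambda>\<omega>. U t \<omega> j * U u \<omega> j)"
    using tu by (intro indep_var_of_indep_set[OF signal_noise_indep] borel_measurable_times X1 U1) auto
  have iX: "integrable M (\<lambda>\<omega>. X t \<omega> s * X u \<omega> s)"
    using tu s by (intro integrable_mult_squares X_measurable square_moment) auto
  have iU: "integrable M (\<lambda>\<omega>. U t \<omega> j * U u \<omega> j)"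
    using tu j by (intro integrable_mult_squares U_measurable U_moments) auto
  show "integrable M (\<lambda>\<omega>. (X t \<omega> s * X u \<omega> s) * (U t \<omega> j * U u \<omega> j))"
    by (rule indep_var_integrable[OF ind iX iU])
  show "(\<integral>\<omega>. (X t \<omega> s * X u \<omega> s) * (U t \<omega> j * U u \<omega> j) \<partial>M) =
      (\<integral>\<omega>. X t \<omega> s * X u \<omega> s \<partial>M) * (\<integral>\<omega>. U t \<omega> j * U u \<omega> j \<partial>M)"
    by (rule indep_var_lebesgue_integral[OF ind iX iU])
qed

text \<open>The signal may be dependent over time. The noise factors at different times are
  uncorrelated, and this alone removes the off-diagonal terms of the square.\<close>

lemma cross_moment:
  assumes j: "j \<in> {1..p}" and s: "s \<in> {0..1}"
  shows "integrable M (\<lambda>\<omega>. ((\<Sum>t\<in>{1..T}. X t \<omega> s * U t \<omega> j) / real T)\<^sup>2)"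
    and "(\<integral>\<omega>. ((\<Sum>t\<in>{1..T}. X t \<omega> s * U t \<omega> j) / real T)\<^sup>2 \<partial>M) \<le> c\<^sub>2 * C / real T"
proof -
  define \<xi> where "\<xi> t \<omega> = X t \<omega> s * U t \<omega> j" for t \<omega>
  have eq: "\<xi> t \<omega> * \<xi> u \<omega> = (X t \<omega> s * X u \<omega> s) * (U t \<omega> j * U u \<omega> j)" for t u \<omega>
    by (simp add: \<xi>_def mult_ac)
  have int: "integrable M (\<lambda>\<omega>. \<xi> t \<omega> * \<xi> u \<omega>)" if "t \<in> {1..T}" "u \<in> {1..T}" for t u
    unfolding eq by (rule signal_noise_pair(1)[OF that j s])
  have orth: "(\<integral>\<omega>. \<xi> t \<omega> * \<xi> u \<omega> \<partial>M) = 0" if "t \<in> {1..T}" "u \<in> {1..T}" "t \<noteq> u" for t u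
    unfolding eq signal_noise_pair(2)[OF that(1,2) j s] noise_uncorrelated[OF that j] by simp
  have sm: "integrable M (\<lambda>\<omega>. (\<Sum>t\<in>{1..T}. \<xi> t \<omega>)\<^sup>2)"
    "(\<integral>\<omega>. (\<Sum>t\<in>{1..T}. \<xi> t \<omega>)\<^sup>2 \<partial>M) = (\<Sum>t\<in>{1..T}. \<integral>\<omega>. (\<xi> t \<omega>)\<^sup>2 \<partial>M)"
    by (rule second_moment_sum_uncorrelated; (rule finite_atLeastAtMost | erule (1) int | erule (2) orth))+
  have sq: "((\<Sum>t\<in>{1..T}. X t \<omega> s * U t \<omega> j) / real T)\<^sup>2 = (\<Sum>t\<in>{1..T}. \<xi> t \<omega>)\<^sup>2 / (real T)\<^sup>2" for \<omega>
    unfolding \<xi>_def power_divide ..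
  show "integrable M (\<lambda>\<omega>. ((\<Sum>t\<in>{1..T}. X t \<omega> s * U t \<omega> j) / real T)\<^sup>2)"
    unfolding sq by (intro integrable_divide sm(1))
  have "(\<integral>\<omega>. ((\<Sum>t\<in>{1..T}. X t \<omega> s * U t \<omega> j) / real T)\<^sup>2 \<partial>M) = (\<Sum>t\<in>{1..T}. \<integral>\<omega>. (\<xi> t \<omega>)\<^sup>2 \<partial>M) / (real T)\<^sup>2"
    unfolding sq integral_divide_zero sm(2) ..
  also have "\<dots> \<le> (\<Sum>t\<in>{1..T}. c\<^sub>2 * C) / (real T)\<^sup>2"
  proof (intro divide_right_mono sum_mono)
    fix t assume t: "t \<in> {1..T}"
    have "(\<integral>\<omega>. (\<xi> t \<omega>)\<^sup>2 \<partial>M) = (\<integral>\<omega>. X t \<omega> s * X t \<omega> s \<partial>M) * (\<integral>\<omega>. U t \<omega> j * U t \<omega> j \<partial>M)"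
      unfolding power2_eq_square eq by (rule signal_noise_pair(2)[OF t t j s])
    also have "\<dots> \<le> c\<^sub>2 * C"
    proof (rule mult_mono)
      show "(\<integral>\<omega>. X t \<omega> s * X t \<omega> s \<partial>M) \<le> c\<^sub>2"
        using square_moment(2)[of t s] t s by (simp add: power2_eq_square)
      show "(\<integral>\<omega>. U t \<omega> j * U t \<omega> j \<partial>M) \<le> C"
        using U_product(2)[OF t j j] \<gamma>_le[of 0] by simp
    qed (use c\<^sub>2_nonneg in auto)
    finally show "(\<integral>\<omega>. (\<xi> t \<omega>)\<^sup>2 \<partial>M) \<le> c\<^sub>2 * C" .
  qed simp
  also have "\<dots> = c\<^sub>2 * C / real T" using T by (simp add: power2_eq_square)
  finally show "(\<integral>\<omega>. ((\<Sum>t\<in>{1..T}. X t \<omega> s * U t \<omega> j) / real T)\<^sup>2 \<partial>M) \<le> c\<^sub>2 * C / real T" .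
qed

text \<open>Squared mean plus variance: the mean is the autocovariance, and the variance of an
  average over T independent products is at most their second moment divided by T.\<close>

lemma noise_covariance_moment:
  assumes i: "i \<in> {1..p}" and j: "j \<in> {1..p}"
  shows "integrable M (\<lambda>\<omega>. ((\<Sum>t\<in>{1..T}. U t \<omega> i * U t \<omega> j) / real T)\<^sup>2)"
    and "(\<integral>\<omega>. ((\<Sum>t\<in>{1..T}. U t \<omega> i * U t \<omega> j) / real T)\<^sup>2 \<partial>M) \<le> (\<gamma> (int i - int j))\<^sup>2 + 3 * C\<^sup>2 / real T"
proof -
  define c where "c = \<gamma> (int i - int j)"
  define \<xi> where "\<xi> t \<omega> = U t \<omega> i * U t \<omega> j - c" for t \<omega>
  have \<xi>_int: "integrable M (\<xi> t)" and \<xi>_mean: "(\<integral>\<omega>. \<xi> t \<omega> \<partial>M) = 0"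
    and \<xi>2_int: "integrable M (\<lambda>\<omega>. (\<xi> t \<omega>)\<^sup>2)" and \<xi>2: "(\<integral>\<omega>. (\<xi> t \<omega>)\<^sup>2 \<partial>M) \<le> 3 * C\<^sup>2"
    if t: "t \<in> {1..T}" for t
  proof -
    note P = U_product[OF t i j]
    show "integrable M (\<xi> t)" unfolding \<xi>_def[abs_def] using P(1) by simp
    show "(\<integral>\<omega>. \<xi> t \<omega> \<partial>M) = 0" unfolding \<xi>_def using P(1,2) prob_space by (simp add: c_def)
    have eq: "(\<xi> t \<omega>)\<^sup>2 = (U t \<omega> i * U t \<omega> j)\<^sup>2 - 2 * c * (U t \<omega> i * U t \<omega> j) + c\<^sup>2" for \<omega>
      by (simp add: \<xi>_def power2_diff algebra_simps)
    show "integrable M (\<lambda>\<omega>. (\<xi> t \<omega>)\<^sup>2)" unfolding eq using P(1,3) by simp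
    have "(\<integral>\<omega>. (\<xi> t \<omega>)\<^sup>2 \<partial>M) = (\<integral>\<omega>. (U t \<omega> i * U t \<omega> j)\<^sup>2 \<partial>M) - 2 * c * c + c\<^sup>2"
      unfolding eq using P(1,2,3) prob_space by (simp add: c_def)
    also have "\<dots> = (\<integral>\<omega>. (U t \<omega> i * U t \<omega> j)\<^sup>2 \<partial>M) - c\<^sup>2" by (simp add: power2_eq_square)
    also have "\<dots> \<le> 3 * C\<^sup>2" using P(4) zero_le_power2[of c] by linarith
    finally show "(\<integral>\<omega>. (\<xi> t \<omega>)\<^sup>2 \<partial>M) \<le> 3 * C\<^sup>2" .
  qed
  have \<xi>_meas: "\<xi> t \<in> borel_measurable M" if "t \<in> {1..T}" for t using \<xi>_int[OF that] by simp
  have int: "integrable M (\<lambda>\<omega>. \<xi> t \<omega> * \<xi> u \<omega>)" if "t \<in> {1..T}" "u \<in> {1..T}" for t u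
    using that by (intro integrable_mult_squares \<xi>_meas \<xi>2_int)
  have orth: "(\<integral>\<omega>. \<xi> t \<omega> * \<xi> u \<omega> \<partial>M) = 0" if tu: "t \<in> {1..T}" "u \<in> {1..T}" "t \<noteq> u" for t u
  proof -
    let ?P = "PiM {1..p} (\<lambda>_. borel :: real measure)"
    have "(\<lambda>y. y i * y j - c) \<in> borel_measurable ?P"
      using i j by (intro borel_measurable_diff borel_measurable_times measurable_component_singleton) auto
    then have "indep_var borel (\<lambda>\<omega>. restrict (U t \<omega>) {1..p} i * restrict (U t \<omega>) {1..p} j - c)
        borel (\<lambda>\<omega>. restrict (U u \<omega>) {1..p} i * restrict (U u \<omega>) {1..p} j - c)"
      by (intro noise_pair_indep[OF tu])
    then have "indep_var borel (\<xi> t) borel (\<xi> u)" using i j by (simp add: \<xi>_def[abs_def])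
    from indep_var_lebesgue_integral[OF this \<xi>_int[OF tu(1)] \<xi>_int[OF tu(2)]] show ?thesis
      using \<xi>_mean[OF tu(1)] by simp
  qed
  have sm: "integrable M (\<lambda>\<omega>. (\<Sum>t\<in>{1..T}. \<xi> t \<omega>)\<^sup>2)"
    "(\<integral>\<omega>. (\<Sum>t\<in>{1..T}. \<xi> t \<omega>)\<^sup>2 \<partial>M) = (\<Sum>t\<in>{1..T}. \<integral>\<omega>. (\<xi> t \<omega>)\<^sup>2 \<partial>M)"
    by (rule second_moment_sum_uncorrelated; (rule finite_atLeastAtMost | erule (1) int | erule (2) orth))+
  have eq: "((\<Sum>t\<in>{1..T}. U t \<omega> i * U t \<omega> j) / real T)\<^sup>2
      = (\<Sum>t\<in>{1..T}. \<xi> t \<omega>)\<^sup>2 / (real T)\<^sup>2 + 2 * c * (\<Sum>t\<in>{1..T}. \<xi> t \<omega>) / real T + c\<^sup>2" for \<omega>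
  proof -
    have "(\<Sum>t\<in>{1..T}. U t \<omega> i * U t \<omega> j) = (\<Sum>t\<in>{1..T}. \<xi> t \<omega>) + real T * c"
      by (simp add: \<xi>_def sum_subtractf)
    then show ?thesis using T by (simp add: power2_eq_square field_simps)
  qed
  have sum_int: "integrable M (\<lambda>\<omega>. \<Sum>t\<in>{1..T}. \<xi> t \<omega>)"
    by (intro Bochner_Integration.integrable_sum \<xi>_int)
  have sum_mean: "(\<integral>\<omega>. (\<Sum>t\<in>{1..T}. \<xi> t \<omega>) \<partial>M) = 0"
  proof -
    have "(\<integral>\<omega>. (\<Sum>t\<in>{1..T}. \<xi> t \<omega>) \<partial>M) = (\<Sum>t\<in>{1..T}. \<integral>\<omega>. \<xi> t \<omega> \<partial>M)"
      by (intro Bochner_Integration.integral_sum \<xi>_int)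
    then show ?thesis using \<xi>_mean by simp
  qed
  show "integrable M (\<lambda>\<omega>. ((\<Sum>t\<in>{1..T}. U t \<omega> i * U t \<omega> j) / real T)\<^sup>2)"
    unfolding eq using sm(1) sum_int by simp
  have "(\<integral>\<omega>. ((\<Sum>t\<in>{1..T}. U t \<omega> i * U t \<omega> j) / real T)\<^sup>2 \<partial>M)
      = (\<Sum>t\<in>{1..T}. \<integral>\<omega>. (\<xi> t \<omega>)\<^sup>2 \<partial>M) / (real T)\<^sup>2 + c\<^sup>2"
    unfolding eq sm(2)[symmetric] using sm(1) sum_int sum_mean prob_space by simp
  also have "\<dots> \<le> (\<Sum>t\<in>{1..T}. 3 * C\<^sup>2) / (real T)\<^sup>2 + c\<^sup>2"
    by (intro add_right_mono divide_right_mono sum_mono \<xi>2) auto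
  also have "\<dots> = (\<gamma> (int i - int j))\<^sup>2 + 3 * C\<^sup>2 / real T"
    using T by (simp add: c_def power2_eq_square)
  finally show "(\<integral>\<omega>. ((\<Sum>t\<in>{1..T}. U t \<omega> i * U t \<omega> j) / real T)\<^sup>2 \<partial>M) \<le> (\<gamma> (int i - int j))\<^sup>2 + 3 * C\<^sup>2 / real T" .
qed

text \<open>In each row one factor is bounded by \<open>C\<close> and the other is summed over
  distinct lags, which costs another \<open>C\<close>. The bound thus grows like p rather than p
  squared, and this is the source of the noise contribution 1/p.\<close>

lemma \<gamma>_square_sum: "(\<Sum>i<p. \<Sum>j<p. (\<gamma> (int (Suc i) - int (Suc j)))\<^sup>2) \<le> real p * C\<^sup>2"
proof -
  have "(\<Sum>j<p. (\<gamma> (int (Suc i) - int (Suc j)))\<^sup>2) \<le> C\<^sup>2" for i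
  proof -
    have "(\<Sum>j<p. (\<gamma> (int (Suc i) - int (Suc j)))\<^sup>2) \<le> (\<Sum>j<p. C * \<bar>\<gamma> (int (Suc i) - int (Suc j))\<bar>)"
    proof (rule sum_mono)
      fix j
      have "\<bar>\<gamma> (int (Suc i) - int (Suc j))\<bar> * \<bar>\<gamma> (int (Suc i) - int (Suc j))\<bar> \<le> C * \<bar>\<gamma> (int (Suc i) - int (Suc j))\<bar>"
        by (intro mult_right_mono \<gamma>_le) simp
      then show "(\<gamma> (int (Suc i) - int (Suc j)))\<^sup>2 \<le> C * \<bar>\<gamma> (int (Suc i) - int (Suc j))\<bar>"
        by (simp add: power2_eq_square)
    qed
    also have "\<dots> = C * (\<Sum>h\<in>(\<lambda>j. int (Suc i) - int (Suc j)) ` {..<p}. \<bar>\<gamma> h\<bar>)"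
      by (subst sum.reindex) (auto simp: inj_on_def sum_distrib_left)
    also have "\<dots> \<le> C * C" by (intro mult_left_mono \<gamma>_finite_sum_le C_nonneg) simp
    finally show ?thesis by (simp add: power2_eq_square)
  qed
  then have "(\<Sum>i<p. \<Sum>j<p. (\<gamma> (int (Suc i) - int (Suc j)))\<^sup>2) \<le> (\<Sum>i<p. C\<^sup>2)" by (intro sum_mono)
  then show ?thesis by simp
qed

text \<open>The squared Hilbert-Schmidt norm of the operator that the cross-covariance matrix
  induces on step functions, after scaling by 1/p.\<close>

definition cross2 :: "'w \<Rightarrow> real" where
  "cross2 \<omega> = (\<Sum>i<p. \<Sum>j<p. ((\<Sum>t\<in>{1..T}. X t \<omega> (real i / real p) * U t \<omega> (Suc j)) / real T)\<^sup>2) / (real p)\<^sup>2"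

definition noise2 :: "'w \<Rightarrow> real" where
  "noise2 \<omega> = (\<Sum>i<p. \<Sum>j<p. ((\<Sum>t\<in>{1..T}. U t \<omega> (Suc i) * U t \<omega> (Suc j)) / real T)\<^sup>2) / (real p)\<^sup>2"

lemma grid_point: "i < p \<Longrightarrow> real i / real p \<in> {0..1}"
  by simp

lemma integral_double_sum:
  assumes "\<And>i j. i < p \<Longrightarrow> j < p \<Longrightarrow> integrable M (g i j)"
  shows "integrable M (\<lambda>\<omega>. \<Sum>i<p. \<Sum>j<p. g i j \<omega> :: real)"
    and "(\<integral>\<omega>. (\<Sum>i<p. \<Sum>j<p. g i j \<omega>) \<partial>M) = (\<Sum>i<p. \<Sum>j<p. \<integral>\<omega>. g i j \<omega> \<partial>M)"
proof -
  show "integrable M (\<lambda>\<omega>. \<Sum>i<p. \<Sum>j<p. g i j \<omega>)"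
    using assms by (intro Bochner_Integration.integrable_sum) auto
  have "(\<integral>\<omega>. (\<Sum>i<p. \<Sum>j<p. g i j \<omega>) \<partial>M) = (\<Sum>i<p. \<integral>\<omega>. (\<Sum>j<p. g i j \<omega>) \<partial>M)"
    using assms by (intro Bochner_Integration.integral_sum Bochner_Integration.integrable_sum) auto
  also have "\<dots> = (\<Sum>i<p. \<Sum>j<p. \<integral>\<omega>. g i j \<omega> \<partial>M)"
    using assms by (intro sum.cong refl Bochner_Integration.integral_sum) auto
  finally show "(\<integral>\<omega>. (\<Sum>i<p. \<Sum>j<p. g i j \<omega>) \<partial>M) = (\<Sum>i<p. \<Sum>j<p. \<integral>\<omega>. g i j \<omega> \<partial>M)" .
qed

lemma cross2_expectation: "integrable M cross2" "(\<integral>\<omega>. cross2 \<omega> \<partial>M) \<le> c\<^sub>2 * C / real T"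
proof -
  have m: "integrable M (\<lambda>\<omega>. ((\<Sum>t\<in>{1..T}. X t \<omega> (real i / real p) * U t \<omega> (Suc j)) / real T)\<^sup>2)"
    "(\<integral>\<omega>. ((\<Sum>t\<in>{1..T}. X t \<omega> (real i / real p) * U t \<omega> (Suc j)) / real T)\<^sup>2 \<partial>M) \<le> c\<^sub>2 * C / real T"
    if "i < p" "j < p" for i j
    using that by (intro cross_moment[of "Suc j" "real i / real p"]; simp)+
  show "integrable M cross2"
    unfolding cross2_def[abs_def] by (intro integrable_divide integral_double_sum(1) m)
  have "(\<integral>\<omega>. cross2 \<omega> \<partial>M) = (\<Sum>i<p. \<Sum>j<p. \<integral>\<omega>. ((\<Sum>t\<in>{1..T}. X t \<omega> (real i / real p) * U t \<omega> (Suc j)) / real T)\<^sup>2 \<partial>M) / (real p)\<^sup>2"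
    unfolding cross2_def integral_divide_zero by (subst integral_double_sum(2)[OF m(1)]) auto
  also have "\<dots> \<le> (\<Sum>i<p. \<Sum>j<p. c\<^sub>2 * C / real T) / (real p)\<^sup>2"
    by (intro divide_right_mono sum_mono m) auto
  also have "\<dots> = c\<^sub>2 * C / real T" using p by (simp add: power2_eq_square)
  finally show "(\<integral>\<omega>. cross2 \<omega> \<partial>M) \<le> c\<^sub>2 * C / real T" .
qed

lemma noise2_expectation: "integrable M noise2" "(\<integral>\<omega>. noise2 \<omega> \<partial>M) \<le> C\<^sup>2 / real p + 3 * C\<^sup>2 / real T"
proof -
  have m: "integrable M (\<lambda>\<omega>. ((\<Sum>t\<in>{1..T}. U t \<omega> (Suc i) * U t \<omega> (Suc j)) / real T)\<^sup>2)"
    "(\<integral>\<omega>. ((\<Sum>t\<in>{1..T}. U t \<omega> (Suc i) * U t \<omega> (Suc j)) / real T)\<^sup>2 \<partial>M)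
      \<le> (\<gamma> (int (Suc i) - int (Suc j)))\<^sup>2 + 3 * C\<^sup>2 / real T"
    if "i < p" "j < p" for i j
    using that by (intro noise_covariance_moment[of "Suc i" "Suc j"]; simp)+
  show "integrable M noise2"
    unfolding noise2_def[abs_def] by (intro integrable_divide integral_double_sum(1) m)
  have "(\<integral>\<omega>. noise2 \<omega> \<partial>M) = (\<Sum>i<p. \<Sum>j<p. \<integral>\<omega>. ((\<Sum>t\<in>{1..T}. U t \<omega> (Suc i) * U t \<omega> (Suc j)) / real T)\<^sup>2 \<partial>M) / (real p)\<^sup>2"
    unfolding noise2_def integral_divide_zero by (subst integral_double_sum(2)[OF m(1)]) auto
  also have "\<dots> \<le> (\<Sum>i<p. \<Sum>j<p. (\<gamma> (int (Suc i) - int (Suc j)))\<^sup>2 + 3 * C\<^sup>2 / real T) / (real p)\<^sup>2"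
    by (intro divide_right_mono sum_mono m) auto
  also have "\<dots> = (\<Sum>i<p. \<Sum>j<p. (\<gamma> (int (Suc i) - int (Suc j)))\<^sup>2) / (real p)\<^sup>2 + 3 * C\<^sup>2 / real T"
    using p by (simp add: sum.distrib add_divide_distrib power2_eq_square)
  also have "\<dots> \<le> real p * C\<^sup>2 / (real p)\<^sup>2 + 3 * C\<^sup>2 / real T"
    by (intro add_right_mono divide_right_mono \<gamma>_square_sum) simp
  also have "real p * C\<^sup>2 / (real p)\<^sup>2 = C\<^sup>2 / real p" using p by (simp add: power2_eq_square)
  finally show "(\<integral>\<omega>. noise2 \<omega> \<partial>M) \<le> C\<^sup>2 / real p + 3 * C\<^sup>2 / real T" .
qed

end

section \<open>From matrices to bilinear forms\<close>

lemma data_curve_class: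
  assumes "p \<ge> 1"
  shows "(\<lambda>s. \<Sum>i<p. y i * indicator (cell p i) s) \<in> L2"
    and "data_curve p y = l2_class (\<lambda>s. \<Sum>i<p. y i * indicator (cell p i) s)"
proof -
  show "(\<lambda>s. \<Sum>i<p. y i * indicator (cell p i) s) \<in> L2"
    by (intro L2_sum L2_scale indicator_L2) simp
  have "l2_class (\<lambda>s. y i * indicator (cell p i) s) = (1 / sqrt (real p)) *\<^sub>R y i *\<^sub>R grid p i" for i
    using assms by (simp add: grid_def l2_class_scale indicator_L2)
  then have "data_curve p y = (\<Sum>i<p. l2_class (\<lambda>s. y i * indicator (cell p i) s))"
    unfolding data_curve_def embed_def scaleR_sum_right by (intro sum.cong refl) (rule sym)
  also have "\<dots> = l2_class (\<lambda>s. \<Sum>i<p. y i * indicator (cell p i) s)"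
    by (intro l2_class_sum[symmetric] L2_scale indicator_L2) simp
  finally show "data_curve p y = l2_class (\<lambda>s. \<Sum>i<p. y i * indicator (cell p i) s)" .
qed

lemma data_curve_add: "data_curve p (\<lambda>i. y i + z i) = data_curve p y + data_curve p z"
  by (simp add: data_curve_def embed_def scaleR_add_left sum.distrib scaleR_add_right)

lemma norm_data_curve: "p \<ge> 1 \<Longrightarrow> (norm (data_curve p y))\<^sup>2 = (\<Sum>i<p. (y i)\<^sup>2) / real p"
  unfolding power2_norm_eq_inner data_curve_def inner_scaleR_left inner_scaleR_right inner_embed
  by (simp add: power2_eq_square)

lemma grid_Bessel: "(\<Sum>i<p. (inner g (grid p i))\<^sup>2) \<le> (norm g)\<^sup>2"
proof (rule orthonormal_decomposition[OF orthonormal_grid[of p] finite_lessThan, of g])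
  fix w assume "(norm g)\<^sup>2 = (\<Sum>i<p. (inner g (grid p i))\<^sup>2) + (norm w)\<^sup>2"
  then show ?thesis by simp
qed

text \<open>Cauchy-Schwarz over pairs of indices, followed by Bessel's inequality for each
  argument.\<close>

lemma grid_form_bound:
  "\<bar>\<Sum>i<p. \<Sum>j<p. D i j * (inner g (grid p i) * inner h (grid p j))\<bar>
     \<le> sqrt (\<Sum>i<p. \<Sum>j<p. (D i j)\<^sup>2) * (norm g * norm h)"
proof -
  let ?I = "{..<p} \<times> {..<p}"
  define b where "b z = inner g (grid p (fst z)) * inner h (grid p (snd z))" for z
  have "(\<Sum>z\<in>?I. D (fst z) (snd z) * b z)\<^sup>2 \<le> (\<Sum>z\<in>?I. (D (fst z) (snd z))\<^sup>2) * (\<Sum>z\<in>?I. (b z)\<^sup>2)"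
    by (rule Cauchy_Schwarz_ineq_sum)
  also have "(\<Sum>z\<in>?I. (b z)\<^sup>2) = (\<Sum>i<p. (inner g (grid p i))\<^sup>2) * (\<Sum>j<p. (inner h (grid p j))\<^sup>2)"
    by (simp add: b_def power_mult_distrib sum_product sum.cartesian_product split_beta')
  also have "(\<Sum>z\<in>?I. (D (fst z) (snd z))\<^sup>2) * \<dots> \<le> (\<Sum>z\<in>?I. (D (fst z) (snd z))\<^sup>2) * ((norm g)\<^sup>2 * (norm h)\<^sup>2)"
    by (intro mult_left_mono mult_mono grid_Bessel sum_nonneg) auto
  finally have "sqrt ((\<Sum>z\<in>?I. D (fst z) (snd z) * b z)\<^sup>2)
      \<le> sqrt ((\<Sum>z\<in>?I. (D (fst z) (snd z))\<^sup>2) * ((norm g)\<^sup>2 * (norm h)\<^sup>2))"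
    by (rule real_sqrt_le_mono)
  then show ?thesis
    by (simp add: b_def sum.cartesian_product split_beta' real_sqrt_mult)
qed

text \<open>Two families of data are allowed, so that the signal-noise and the noise-noise terms are
  both instances.\<close>

lemma data_form_bound:
  assumes "p \<ge> 1"
  shows "\<bar>(\<Sum>t\<in>I. inner (data_curve p (y t)) g * inner (data_curve p (z t)) h) / c\<bar>
    \<le> sqrt ((\<Sum>i<p. \<Sum>j<p. ((\<Sum>t\<in>I. y t i * z t j) / c)\<^sup>2) / (real p)\<^sup>2) * (norm g * norm h)"
proof -
  define D where "D i j = ((\<Sum>t\<in>I. y t i * z t j) / c) / real p" for i j
  have eq: "inner (data_curve p (y t)) g * inner (data_curve p (z t)) h
      = (\<Sum>i<p. \<Sum>j<p. (y t i * z t j / real p) * (inner g (grid p i) * inner h (grid p j)))" for t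
  proof -
    have "inner (data_curve p (y t)) g * inner (data_curve p (z t)) h
      = (1 / sqrt (real p) * (1 / sqrt (real p))) * ((\<Sum>i<p. y t i * inner g (grid p i)) * (\<Sum>j<p. z t j * inner h (grid p j)))"
      unfolding inner_data_curve by (simp only: mult_ac)
    also have "1 / sqrt (real p) * (1 / sqrt (real p)) = 1 / real p" using assms by simp
    finally show ?thesis
      unfolding sum_product unfolding sum_distrib_left by (simp add: mult_ac)
  qed
  have "(\<Sum>t\<in>I. inner (data_curve p (y t)) g * inner (data_curve p (z t)) h)
      = (\<Sum>i<p. \<Sum>j<p. \<Sum>t\<in>I. (y t i * z t j / real p) * (inner g (grid p i) * inner h (grid p j)))"
    unfolding eq by (subst sum.swap) (intro sum.cong refl sum.swap)
  then have "(\<Sum>t\<in>I. inner (data_curve p (y t)) g * inner (data_curve p (z t)) h) / c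
      = (\<Sum>i<p. \<Sum>j<p. \<Sum>t\<in>I. (y t i * z t j / real p) * (inner g (grid p i) * inner h (grid p j))) / c"
    by (rule arg_cong)
  also have "\<dots> = (\<Sum>i<p. \<Sum>j<p. D i j * (inner g (grid p i) * inner h (grid p j)))"
    unfolding D_def sum_divide_distrib sum_distrib_right by (simp add: mult_ac)
  finally have form: "(\<Sum>t\<in>I. inner (data_curve p (y t)) g * inner (data_curve p (z t)) h) / c
      = (\<Sum>i<p. \<Sum>j<p. D i j * (inner g (grid p i) * inner h (grid p j)))" .
  have sq: "(\<Sum>i<p. \<Sum>j<p. (D i j)\<^sup>2) = (\<Sum>i<p. \<Sum>j<p. ((\<Sum>t\<in>I. y t i * z t j) / c)\<^sup>2) / (real p)\<^sup>2"
    by (simp add: D_def power_divide power_mult_distrib sum_divide_distrib[symmetric])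
  show ?thesis unfolding form using grid_form_bound[where D = D and g = g and h = h and p = p] unfolding sq .
qed

text \<open>The four groups match the four groups of \<open>error_bound\<close>, each measured in
  units of the rate. In the last one, \<open>4 * C\<^sup>2\<close> collects 1 from the
  autocovariances and 3 from the sampling fluctuation. The constant depends on neither T nor
  p.\<close>

definition (in functional_signal) error_const :: "real \<Rightarrow> real \<Rightarrow> real" where
  "error_const C C_r = (c_hs + 1) / 2 + (C_r / 2 + c\<^sub>2 + (1 + m\<^sub>4)) + (c\<^sub>2 * C + 1) + (4 * C\<^sup>2 + 1) / 2"

section \<open>The total error and its expectation\<close>

context noisy_sample
begin

definition Xh :: "nat \<Rightarrow> 'w \<Rightarrow> l2" where "Xh t \<omega> = data_curve p (\<lambda>i. X t \<omega> (real i / real p))"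
definition Uh :: "nat \<Rightarrow> 'w \<Rightarrow> l2" where "Uh t \<omega> = data_curve p (\<lambda>i. U t \<omega> (Suc i))"

lemma Xh_measurable: "t \<ge> 1 \<Longrightarrow> Xh t \<in> borel_measurable M"
  unfolding Xh_def[abs_def] data_curve_def embed_def
  by (intro borel_measurable_scaleR borel_measurable_sum X_measurable borel_measurable_const) auto

lemma Xh_second_moment:
  assumes "t \<ge> 1"
  shows "integrable M (\<lambda>\<omega>. (norm (Xh t \<omega>))\<^sup>2)" "(\<integral>\<omega>. (norm (Xh t \<omega>))\<^sup>2 \<partial>M) \<le> c\<^sub>2"
proof -
  have int: "integrable M (\<lambda>\<omega>. (X t \<omega> (real i / real p))\<^sup>2)" if "i \<in> {..<p}" for i
    using square_moment(1)[OF assms, of "real i / real p"] that by simp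
  show "integrable M (\<lambda>\<omega>. (norm (Xh t \<omega>))\<^sup>2)"
    unfolding Xh_def norm_data_curve[OF p] by (intro integrable_divide Bochner_Integration.integrable_sum int)
  have "(\<integral>\<omega>. (norm (Xh t \<omega>))\<^sup>2 \<partial>M) = (\<Sum>i<p. \<integral>\<omega>. (X t \<omega> (real i / real p))\<^sup>2 \<partial>M) / real p"
    unfolding Xh_def norm_data_curve[OF p] integral_divide_zero
    by (intro arg_cong2[of _ _ _ _ "(/)"] Bochner_Integration.integral_sum int refl)
  also have "\<dots> \<le> (\<Sum>i<p. c\<^sub>2) / real p"
    by (intro divide_right_mono sum_mono square_moment(2) assms grid_point) auto
  also have "\<dots> = c\<^sub>2" using p by simp
  finally show "(\<integral>\<omega>. (norm (Xh t \<omega>))\<^sup>2 \<partial>M) \<le> c\<^sub>2" .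
qed

lemma Xc_second_moment:
  assumes "t \<ge> 1"
  shows "integrable M (\<lambda>\<omega>. (norm (Xc t \<omega>))\<^sup>2)" "(\<integral>\<omega>. (norm (Xc t \<omega>))\<^sup>2 \<partial>M) \<le> 1 + m\<^sub>4"
proof -
  have le: "x\<^sup>2 \<le> 1 + x ^ 4" for x :: real
  proof -
    have "(x\<^sup>2)\<^sup>2 = x ^ 4" by simp
    then have "2 * x\<^sup>2 \<le> x ^ 4 + 1" using sum_squares_bound[of "x\<^sup>2" 1] by simp
    then show ?thesis using zero_le_power2[of x] by linarith
  qed
  have bnd: "integrable M (\<lambda>\<omega>. 1 + norm (Xc t \<omega>) ^ 4)" using fourth_moment[OF assms] by simp
  show int: "integrable M (\<lambda>\<omega>. (norm (Xc t \<omega>))\<^sup>2)"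
  proof (rule Bochner_Integration.integrable_bound[OF bnd])
    show "(\<lambda>\<omega>. (norm (Xc t \<omega>))\<^sup>2) \<in> borel_measurable M" using assms by measurable
    have "norm ((norm y)\<^sup>2) \<le> norm (1 + norm y ^ 4)" for y :: l2 using le[of "norm y"] by simp
    then show "AE \<omega> in M. norm ((norm (Xc t \<omega>))\<^sup>2) \<le> norm (1 + norm (Xc t \<omega>) ^ 4)" by blast
  qed
  have "(\<integral>\<omega>. (norm (Xc t \<omega>))\<^sup>2 \<partial>M) \<le> (\<integral>\<omega>. 1 + norm (Xc t \<omega>) ^ 4 \<partial>M)"
    by (intro integral_mono int bnd le)
  also have "\<dots> = 1 + m\<^sub>4" using fourth_moment[OF assms] fourth_moment_eq[OF assms] prob_space by simp
  finally show "(\<integral>\<omega>. (norm (Xc t \<omega>))\<^sup>2 \<partial>M) \<le> 1 + m\<^sub>4" .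
qed

lemma increment_moment:
  assumes t: "t \<ge> 1" and i: "i < p" and s: "s \<in> cell p i"
  shows "(\<integral>\<^sup>+\<omega>. ennreal ((X t \<omega> (real i / real p) - X t \<omega> s)\<^sup>2) \<partial>M) \<le> ennreal (C_r / real p)"
proof -
  let ?u = "real i / real p"
  have s01: "s \<in> {0..1}" using cell_subset[OF i] s by blast
  have u01: "?u \<in> {0..1}" by (rule grid_point[OF i])
  have eq: "(x - y)\<^sup>2 = x\<^sup>2 - 2 * (x * y) + y\<^sup>2" for x y :: real by (simp add: power2_diff)
  have int: "integrable M (\<lambda>\<omega>. (X t \<omega> ?u - X t \<omega> s)\<^sup>2)"
    unfolding eq using square_moment(1)[OF t u01] square_moment(1)[OF t s01] product_moment(1)[OF t u01 s01] by simp
  have "(\<integral>\<omega>. (X t \<omega> ?u - X t \<omega> s)\<^sup>2 \<partial>M) = (\<integral>\<omega>. (X 1 \<omega> ?u - X 1 \<omega> s)\<^sup>2 \<partial>M)"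
    using pair_expectation(2)[OF t u01 s01, of "\<lambda>z. (fst z - snd z)\<^sup>2"] by simp
  also have "\<dots> \<le> C_r / real p"
  proof (cases "s = ?u")
    case True
    then show ?thesis using C_r by simp
  next
    case False
    define h where "h = s - ?u"
    have h: "0 < h" "h < 1 / real p" "s = ?u + h"
      using s False by (auto simp: h_def add_divide_distrib)
    have "(\<integral>\<omega>. (X 1 \<omega> ?u - X 1 \<omega> s)\<^sup>2 \<partial>M) = (\<integral>\<omega>. (X 1 \<omega> (?u + h) - X 1 \<omega> ?u)\<^sup>2 \<partial>M)"
      unfolding h(3) by (simp add: power2_commute)
    also have "\<dots> \<le> C_r * h" using s01 by (intro increments u01 h(1,2)) (simp add: h(3))
    also have "\<dots> \<le> C_r * (1 / real p)" using h C_r by (intro mult_left_mono) auto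
    finally show ?thesis by simp
  qed
  finally have "(\<integral>\<omega>. (X t \<omega> ?u - X t \<omega> s)\<^sup>2 \<partial>M) \<le> C_r / real p" .
  then show ?thesis using int by (subst nn_integral_eq_integral) (auto intro: ennreal_leI)
qed

text \<open>By Fubini the mean squared distance is an integral over s of the mean squared increment
  between s and the left end of its cell, and each of these is bounded by
  \<open>increment_moment\<close>.\<close>

lemma discretisation_error:
  assumes t: "t \<ge> 1"
  shows "integrable M (\<lambda>\<omega>. (norm (Xh t \<omega> - Xc t \<omega>))\<^sup>2)" "(\<integral>\<omega>. (norm (Xh t \<omega> - Xc t \<omega>))\<^sup>2 \<partial>M) \<le> C_r / real p"
proof -
  interpret P: pair_sigma_finite M leb01 ..
  define x where "x \<omega> s = (\<Sum>i<p. X t \<omega> (real i / real p) * indicator (cell p i) s)" for \<omega> s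
  have xL2: "x \<omega> \<in> L2" and Xh: "Xh t \<omega> = l2_class (x \<omega>)" for \<omega>
    unfolding x_def Xh_def using data_curve_class[OF p] by auto
  have [measurable]: "(\<lambda>z. X t (fst z) (snd z)) \<in> borel_measurable (M \<Otimes>\<^sub>M leb01)" by (rule joint_measurable[OF t])
  have xm [measurable]: "(\<lambda>z. x (fst z) (snd z)) \<in> borel_measurable (M \<Otimes>\<^sub>M leb01)"
    unfolding x_def
  proof (intro borel_measurable_sum borel_measurable_times)
    fix i assume "i \<in> {..<p}"
    then show "(\<lambda>z. X t (fst z) (real i / real p)) \<in> borel_measurable (M \<Otimes>\<^sub>M leb01)"
      by (intro measurable_compose[OF measurable_fst X_measurable[OF t]]) simp
    show "(\<lambda>z. indicator (cell p i) (snd z) :: real) \<in> borel_measurable (M \<Otimes>\<^sub>M leb01)"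
      by (rule measurable_compose[OF measurable_snd indicator_measurable_leb01]) simp
  qed
  have "(\<integral>\<^sup>+\<omega>. ennreal ((norm (Xh t \<omega> - Xc t \<omega>))\<^sup>2) \<partial>M) = (\<integral>\<^sup>+\<omega>. \<integral>\<^sup>+s. ennreal ((x \<omega> s - X t \<omega> s)\<^sup>2) \<partial>leb01 \<partial>M)"
  proof (rule nn_integral_cong)
    fix \<omega> assume \<omega>: "\<omega> \<in> space M"
    have L: "(\<lambda>s. x \<omega> s - X t \<omega> s) \<in> L2" by (intro L2_diff xL2 X_L2 t \<omega>)
    have "(norm (Xh t \<omega> - Xc t \<omega>))\<^sup>2 = (\<integral>s. (x \<omega> s - X t \<omega> s)\<^sup>2 \<partial>leb01)"
      unfolding Xh Xc_def l2_class_diff[OF xL2 X_L2[OF t \<omega>], symmetric] norm_l2_class[OF L] L2_norm_def by simp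
    then show "ennreal ((norm (Xh t \<omega> - Xc t \<omega>))\<^sup>2) = (\<integral>\<^sup>+s. ennreal ((x \<omega> s - X t \<omega> s)\<^sup>2) \<partial>leb01)"
      using L2_D(2)[OF L] by (subst nn_integral_eq_integral) auto
  qed
  also have "\<dots> = (\<integral>\<^sup>+s. \<integral>\<^sup>+\<omega>. ennreal ((x \<omega> s - X t \<omega> s)\<^sup>2) \<partial>M \<partial>leb01)"
    by (rule P.Fubini'[symmetric]) (simp add: split_beta')
  also have "\<dots> \<le> (\<integral>\<^sup>+s. ennreal (C_r / real p) \<partial>leb01)"
  proof (rule nn_integral_mono_AE)
    \<comment> \<open>The half-open cells cover the unit interval except for its right end, where
      the step function is 0.\<close>
    have "AE s in leb01. s \<noteq> 1"
      by (subst AE_restrict_space_iff) (auto intro: AE_mp[OF AE_lborel_singleton])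
    then show "AE s in leb01. (\<integral>\<^sup>+\<omega>. ennreal ((x \<omega> s - X t \<omega> s)\<^sup>2) \<partial>M) \<le> ennreal (C_r / real p)"
    proof (rule AE_mp, intro AE_I2 impI)
      fix s assume "s \<in> space leb01" "s \<noteq> 1"
      then have s: "0 \<le> s" "s < 1" by auto
      \<comment> \<open>The index of the cell containing s.\<close>
      define i where "i = nat \<lfloor>s * real p\<rfloor>"
      have fl: "real i \<le> s * real p" "s * real p < real i + 1"
        using s by (simp_all add: i_def of_nat_nat)
      have "s * real p < real p" using s p by simp
      then have i: "i < p" using fl(1) by linarith
      have si: "s \<in> cell p i" using fl p by (simp add: field_simps)
      have "x \<omega> s = X t \<omega> (real i / real p)" for \<omega>
      proof -
        have "indicator (cell p j) s = (if j = i then 1 else 0 :: real)" for j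
          using si cell_disjoint[of j i p] by (auto simp: indicator_def)
        then show ?thesis unfolding x_def using i by (simp only: if_distrib[of "\<lambda>z. _ * z"] mult_1_right mult_zero_right) simp
      qed
      then show "(\<integral>\<^sup>+\<omega>. ennreal ((x \<omega> s - X t \<omega> s)\<^sup>2) \<partial>M) \<le> ennreal (C_r / real p)"
        using increment_moment[OF t i si] by simp
    qed
  qed
  also have "\<dots> = ennreal (C_r / real p)" using leb01.emeasure_space_1 by (simp del: space_leb01)
  finally have nn: "(\<integral>\<^sup>+\<omega>. ennreal ((norm (Xh t \<omega> - Xc t \<omega>))\<^sup>2) \<partial>M) \<le> ennreal (C_r / real p)" .
  have m: "(\<lambda>\<omega>. (norm (Xh t \<omega> - Xc t \<omega>))\<^sup>2) \<in> borel_measurable M"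
    using Xh_measurable[OF t] Xc_measurable[OF t] by measurable
  show int: "integrable M (\<lambda>\<omega>. (norm (Xh t \<omega> - Xc t \<omega>))\<^sup>2)"
    using nn by (intro integrableI_bounded m) (auto intro: le_less_trans)
  show "(\<integral>\<omega>. (norm (Xh t \<omega> - Xc t \<omega>))\<^sup>2 \<partial>M) \<le> C_r / real p"
    using nn int C_r by (subst (asm) nn_integral_eq_integral) auto
qed

definition rate :: real where "rate = 1 / sqrt (real p) + 1 / sqrt (real T)"

lemma rate: "rate > 0" "1 / real p \<le> rate\<^sup>2" "1 / real T \<le> rate\<^sup>2"
proof -
  have pos: "0 < 1 / sqrt (real p)" "0 < 1 / sqrt (real T)" using p T by auto
  then show "rate > 0" unfolding rate_def by linarith
  have "(1 / sqrt (real p))\<^sup>2 \<le> rate\<^sup>2" "(1 / sqrt (real T))\<^sup>2 \<le> rate\<^sup>2"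
    using pos unfolding rate_def by (intro power_mono; simp)+
  then show "1 / real p \<le> rate\<^sup>2" "1 / real T \<le> rate\<^sup>2" by (simp_all add: power_divide)
qed

text \<open>The groups belong to the fully observed curves, the discretisation, the cross terms and
  the noise. Two cross terms occur, one with the arguments exchanged, so their group is not
  halved.\<close>

definition error_bound :: "'w \<Rightarrow> real" where
  "error_bound \<omega> = (hs_dist2 T \<omega> / rate + rate) / 2
     + (\<Sum>t\<in>{1..T}. (norm (Xh t \<omega> - Xc t \<omega>))\<^sup>2 / (2 * rate) + rate * ((norm (Xh t \<omega>))\<^sup>2 + (norm (Xc t \<omega>))\<^sup>2)) / real T
     + (cross2 \<omega> / rate + rate) + (noise2 \<omega> / rate + rate) / 2"

lemma sqrt_le_rate: "0 \<le> q \<Longrightarrow> sqrt q \<le> (q / rate + rate) / 2"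
proof -
  assume "0 \<le> q"
  have "2 * sqrt q * rate \<le> (sqrt q)\<^sup>2 + rate\<^sup>2" by (rule sum_squares_bound)
  then show ?thesis using rate(1) \<open>0 \<le> q\<close> by (simp add: field_simps power2_eq_square)
qed

text \<open>Each data curve is a discretised signal plus noise. Expanding the product and comparing
  with the full curves leaves five sums, one for each of the sources in \<open>error_bound\<close>
  and two for the cross terms.\<close>

lemma error_bound_form:
  assumes \<omega>: "\<omega> \<in> space M"
  defines "Y \<equiv> data_matrix X T p U \<omega>"
  shows "\<bar>(\<Sum>t<T. inner (data_curve p (\<lambda>i. Y $$ (i, t))) g * inner (data_curve p (\<lambda>i. Y $$ (i, t))) h) / real T
      - inner (K.op g) h\<bar> \<le> error_bound \<omega> * norm g * norm h"
    and "0 \<le> error_bound \<omega>"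
proof -
  have c2: "0 \<le> cross2 \<omega>" and n2: "0 \<le> noise2 \<omega>"
    unfolding cross2_def noise2_def by (auto intro!: divide_nonneg_nonneg sum_nonneg)
  note hs = empirical_form_bound[OF \<omega> T]
  have r: "rate > 0" by (rule rate)
  show "0 \<le> error_bound \<omega>"
    unfolding error_bound_def using hs(1) c2 n2 r
    by (intro add_nonneg_nonneg divide_nonneg_nonneg sum_nonneg mult_nonneg_nonneg) auto
  let ?A = "\<Sum>t\<in>{1..T}. inner (Xc t \<omega>) g * inner (Xc t \<omega>) h"
  let ?B = "\<Sum>t\<in>{1..T}. inner (Xh t \<omega>) g * inner (Xh t \<omega>) h - inner (Xc t \<omega>) g * inner (Xc t \<omega>) h"
  let ?C1 = "\<Sum>t\<in>{1..T}. inner (Xh t \<omega>) g * inner (Uh t \<omega>) h"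
  let ?C2 = "\<Sum>t\<in>{1..T}. inner (Xh t \<omega>) h * inner (Uh t \<omega>) g"
  let ?N = "\<Sum>t\<in>{1..T}. inner (Uh t \<omega>) g * inner (Uh t \<omega>) h"
  let ?G = "norm g * norm h"
  \<comment> \<open>Matrix columns are counted from 0, times from 1.\<close>
  have Yt: "data_curve p (\<lambda>i. Y $$ (i, t)) = Xh (Suc t) \<omega> + Uh (Suc t) \<omega>" if "t < T" for t
  proof -
    have "data_curve p (\<lambda>i. Y $$ (i, t)) = data_curve p (\<lambda>i. X (Suc t) \<omega> (real i / real p) + U (Suc t) \<omega> (Suc i))"
      unfolding data_curve_def using that by (intro arg_cong[of _ _ "scaleR _"] embed_cong) (simp add: Y_def data_matrix_def)
    then show ?thesis by (simp add: data_curve_add Xh_def Uh_def)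
  qed
  have "(\<Sum>t<T. inner (data_curve p (\<lambda>i. Y $$ (i, t))) g * inner (data_curve p (\<lambda>i. Y $$ (i, t))) h)
      = (\<Sum>t<T. inner (Xh (Suc t) \<omega> + Uh (Suc t) \<omega>) g * inner (Xh (Suc t) \<omega> + Uh (Suc t) \<omega>) h)"
    by (intro sum.cong refl) (simp add: Yt)
  also have "\<dots> = (\<Sum>t\<in>{1..T}. inner (Xh t \<omega> + Uh t \<omega>) g * inner (Xh t \<omega> + Uh t \<omega>) h)"
    by (rule sum.reindex_bij_witness[of _ "\<lambda>t. t - 1" Suc]) auto
  also have "\<dots> = ?A + ?B + ?C1 + ?C2 + ?N"
    by (simp add: inner_add_left algebra_simps sum.distrib sum_subtractf)
  finally have split: "(\<Sum>t<T. inner (data_curve p (\<lambda>i. Y $$ (i, t))) g * inner (data_curve p (\<lambda>i. Y $$ (i, t))) h) / real T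
      - inner (K.op g) h = (?A / real T - inner (K.op g) h) + ?B / real T + ?C1 / real T + ?C2 / real T + ?N / real T"
    by (simp add: add_divide_distrib)
  have A: "\<bar>?A / real T - inner (K.op g) h\<bar> \<le> (hs_dist2 T \<omega> / rate + rate) / 2 * ?G"
  proof -
    have "\<bar>?A / real T - inner (K.op g) h\<bar> \<le> sqrt (hs_dist2 T \<omega>) * ?G" using hs(2)[of g h] by (simp add: mult.assoc)
    also have "\<dots> \<le> (hs_dist2 T \<omega> / rate + rate) / 2 * ?G"
      by (intro mult_right_mono sqrt_le_rate hs(1)) simp
    finally show ?thesis .
  qed
  let ?b = "\<lambda>t. (norm (Xh t \<omega> - Xc t \<omega>))\<^sup>2 / (2 * rate) + rate * ((norm (Xh t \<omega>))\<^sup>2 + (norm (Xc t \<omega>))\<^sup>2)"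
  have B: "\<bar>?B / real T\<bar> \<le> (\<Sum>t\<in>{1..T}. ?b t) / real T * ?G"
  proof -
    have step: "\<bar>inner x g * inner x h - inner y g * inner y h\<bar>
        \<le> ((norm (x - y))\<^sup>2 / (2 * rate) + rate * ((norm x)\<^sup>2 + (norm y)\<^sup>2)) * ?G" for x y :: l2
    proof -
      \<comment> \<open>The forms are quadratic in the curve, so the difference splits into two
        products that each contain \<open>x - y\<close> once.\<close>
      have "inner x g * inner x h - inner y g * inner y h = inner (x - y) g * inner x h + inner y g * inner (x - y) h"
        by (simp add: inner_diff_left algebra_simps)
      also have "\<bar>\<dots>\<bar> \<le> \<bar>inner (x - y) g\<bar> * \<bar>inner x h\<bar> + \<bar>inner y g\<bar> * \<bar>inner (x - y) h\<bar>"
        unfolding abs_mult[symmetric] by (rule abs_triangle_ineq)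
      also have "\<dots> \<le> (norm (x - y) * norm g) * (norm x * norm h) + (norm y * norm g) * (norm (x - y) * norm h)"
        by (intro add_mono mult_mono Cauchy_Schwarz_ineq2) auto
      also have "\<dots> = norm (x - y) * (norm x + norm y) * ?G" by (simp add: algebra_simps)
      also have "\<dots> \<le> ((norm (x - y))\<^sup>2 / (2 * rate) + rate * ((norm x)\<^sup>2 + (norm y)\<^sup>2)) * ?G"
      proof (rule mult_right_mono)
        \<comment> \<open>The weight balances the factors: the squared distance is of order
          \<open>rate\<^sup>2\<close> in mean, the norms are of order 1.\<close>
        have "2 * norm (x - y) * (rate * (norm x + norm y)) \<le> (norm (x - y))\<^sup>2 + (rate * (norm x + norm y))\<^sup>2"
          by (rule sum_squares_bound)
        also have "(rate * (norm x + norm y))\<^sup>2 \<le> rate\<^sup>2 * (2 * ((norm x)\<^sup>2 + (norm y)\<^sup>2))"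
        proof -
          have "0 \<le> (norm x - norm y)\<^sup>2" by simp
          then have "(norm x + norm y)\<^sup>2 \<le> 2 * ((norm x)\<^sup>2 + (norm y)\<^sup>2)"
            unfolding power2_sum power2_diff by simp
          then show ?thesis unfolding power_mult_distrib by (intro mult_left_mono) auto
        qed
        finally have "2 * norm (x - y) * (rate * (norm x + norm y)) \<le> (norm (x - y))\<^sup>2 + rate\<^sup>2 * (2 * ((norm x)\<^sup>2 + (norm y)\<^sup>2))"
          by simp
        then have "norm (x - y) * (norm x + norm y) \<le> ((norm (x - y))\<^sup>2 + rate\<^sup>2 * (2 * ((norm x)\<^sup>2 + (norm y)\<^sup>2))) / (2 * rate)"
          using r by (simp add: field_simps)
        also have "\<dots> = (norm (x - y))\<^sup>2 / (2 * rate) + rate * ((norm x)\<^sup>2 + (norm y)\<^sup>2)"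
          using r by (simp add: field_simps power2_eq_square)
        finally show "norm (x - y) * (norm x + norm y) \<le> (norm (x - y))\<^sup>2 / (2 * rate) + rate * ((norm x)\<^sup>2 + (norm y)\<^sup>2)" .
      qed simp
      finally show ?thesis .
    qed
    have "\<bar>?B\<bar> \<le> (\<Sum>t\<in>{1..T}. ?b t * ?G)" by (rule order_trans[OF sum_abs sum_mono[OF step]])
    then have "\<bar>?B\<bar> / real T \<le> (\<Sum>t\<in>{1..T}. ?b t * ?G) / real T" by (rule divide_right_mono) simp
    then show ?thesis unfolding sum_distrib_right[symmetric] abs_divide by simp
  qed
  \<comment> \<open>Stated for arbitrary arguments, since \<open>?C2\<close> is \<open>?C1\<close>
    with \<open>g\<close> and \<open>h\<close> exchanged.\<close>
  have cross: "\<bar>(\<Sum>t\<in>{1..T}. inner (Xh t \<omega>) g * inner (Uh t \<omega>) h) / real T\<bar> \<le> (cross2 \<omega> / rate + rate) / 2 * (norm g * norm h)" for g h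
  proof -
    have "\<bar>(\<Sum>t\<in>{1..T}. inner (Xh t \<omega>) g * inner (Uh t \<omega>) h) / real T\<bar> \<le> sqrt (cross2 \<omega>) * (norm g * norm h)"
      unfolding Xh_def Uh_def cross2_def by (rule data_form_bound[OF p])
    also have "\<dots> \<le> (cross2 \<omega> / rate + rate) / 2 * (norm g * norm h)"
      by (intro mult_right_mono sqrt_le_rate c2) simp
    finally show ?thesis .
  qed
  have N: "\<bar>?N / real T\<bar> \<le> (noise2 \<omega> / rate + rate) / 2 * ?G"
  proof -
    have "\<bar>?N / real T\<bar> \<le> sqrt (noise2 \<omega>) * ?G"
      unfolding Uh_def noise2_def by (rule data_form_bound[OF p])
    also have "\<dots> \<le> (noise2 \<omega> / rate + rate) / 2 * ?G"
      by (intro mult_right_mono sqrt_le_rate n2) simp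
    finally show ?thesis .
  qed
  have abs5: "\<bar>a + b + c + d + e\<bar> \<le> a' + b' + c' + d' + e'"
    if "\<bar>a\<bar> \<le> a'" "\<bar>b\<bar> \<le> b'" "\<bar>c\<bar> \<le> c'" "\<bar>d\<bar> \<le> d'" "\<bar>e\<bar> \<le> e'" for a b c d e a' b' c' d' e' :: real
    using that by linarith
  have "\<bar>(?A / real T - inner (K.op g) h) + ?B / real T + ?C1 / real T + ?C2 / real T + ?N / real T\<bar>
      \<le> (hs_dist2 T \<omega> / rate + rate) / 2 * ?G + (\<Sum>t\<in>{1..T}. ?b t) / real T * ?G
        + (cross2 \<omega> / rate + rate) / 2 * ?G + (cross2 \<omega> / rate + rate) / 2 * ?G + (noise2 \<omega> / rate + rate) / 2 * ?G"
    by (rule abs5[OF A B cross cross[of h g, unfolded mult.commute[of "norm h" "norm g"]] N])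
  also have "\<dots> = error_bound \<omega> * norm g * norm h"
    unfolding error_bound_def by (simp only: distrib_right mult.assoc) (simp add: algebra_simps)
  finally show "\<bar>(\<Sum>t<T. inner (data_curve p (\<lambda>i. Y $$ (i, t))) g * inner (data_curve p (\<lambda>i. Y $$ (i, t))) h) / real T
      - inner (K.op g) h\<bar> \<le> error_bound \<omega> * norm g * norm h"
    unfolding split .
qed

lemma divide_rate_le:
  assumes "0 \<le> c" "x \<le> c * rate\<^sup>2"
  shows "x / rate \<le> c * rate"
  using assms rate(1) by (simp add: field_simps power2_eq_square)

text \<open>Both 1/p and 1/T are at most \<open>rate\<^sup>2\<close>, so every squared distance has
  expectation of that order, and division by \<open>rate\<close> leaves one power.\<close>

lemma error_bound_expectation:
  shows "integrable M error_bound" and "(\<integral>\<omega>. error_bound \<omega> \<partial>M) \<le> error_const C C_r * rate"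
proof -
  let ?b = "\<lambda>t \<omega>. (norm (Xh t \<omega> - Xc t \<omega>))\<^sup>2 / (2 * rate) + rate * ((norm (Xh t \<omega>))\<^sup>2 + (norm (Xc t \<omega>))\<^sup>2)"
  note hs = hs_dist2_expectation[OF T] and cr = cross2_expectation and no = noise2_expectation
  have b: "integrable M (?b t)" "(\<integral>\<omega>. ?b t \<omega> \<partial>M) \<le> (C_r / 2 + c\<^sub>2 + (1 + m\<^sub>4)) * rate" if "t \<in> {1..T}" for t
  proof -
    have t: "t \<ge> 1" using that by simp
    note d = discretisation_error[OF t] and xh = Xh_second_moment[OF t] and xc = Xc_second_moment[OF t]
    show "integrable M (?b t)" using d xh xc by simp
    have "(\<integral>\<omega>. ?b t \<omega> \<partial>M) = (\<integral>\<omega>. (norm (Xh t \<omega> - Xc t \<omega>))\<^sup>2 \<partial>M) / (2 * rate)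
        + rate * ((\<integral>\<omega>. (norm (Xh t \<omega>))\<^sup>2 \<partial>M) + (\<integral>\<omega>. (norm (Xc t \<omega>))\<^sup>2 \<partial>M))"
      using d xh xc by simp
    also have "\<dots> \<le> (C_r / real p) / (2 * rate) + rate * (c\<^sub>2 + (1 + m\<^sub>4))"
      using rate(1) d(2) xh(2) xc(2) by (intro add_mono divide_right_mono mult_left_mono) auto
    also have "(C_r / real p) / (2 * rate) = (C_r / real p) / rate / 2" by simp
    also have "\<dots> \<le> C_r * rate / 2"
    proof (intro divide_right_mono divide_rate_le C_r)
      show "C_r / real p \<le> C_r * rate\<^sup>2" using mult_left_mono[OF rate(2) C_r] by simp
    qed simp
    finally show "(\<integral>\<omega>. ?b t \<omega> \<partial>M) \<le> (C_r / 2 + c\<^sub>2 + (1 + m\<^sub>4)) * rate" by (simp add: algebra_simps)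
  qed
  have B: "integrable M (\<lambda>\<omega>. \<Sum>t\<in>{1..T}. ?b t \<omega>)"
    by (intro Bochner_Integration.integrable_sum b(1))
  have EB: "(\<integral>\<omega>. (\<Sum>t\<in>{1..T}. ?b t \<omega>) \<partial>M) / real T \<le> (C_r / 2 + c\<^sub>2 + (1 + m\<^sub>4)) * rate"
  proof -
    have "(\<integral>\<omega>. (\<Sum>t\<in>{1..T}. ?b t \<omega>) \<partial>M) = (\<Sum>t\<in>{1..T}. \<integral>\<omega>. ?b t \<omega> \<partial>M)"
      by (intro Bochner_Integration.integral_sum b(1))
    also have "\<dots> \<le> (\<Sum>t\<in>{1..T}. (C_r / 2 + c\<^sub>2 + (1 + m\<^sub>4)) * rate)" by (intro sum_mono b(2))
    finally show ?thesis using T by (simp add: field_simps)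
  qed
  show "integrable M error_bound"
    unfolding error_bound_def[abs_def] using hs(1) cr(1) no(1) B by simp
  have "(\<integral>\<omega>. error_bound \<omega> \<partial>M) = ((\<integral>\<omega>. hs_dist2 T \<omega> \<partial>M) / rate + rate) / 2
      + (\<integral>\<omega>. (\<Sum>t\<in>{1..T}. ?b t \<omega>) \<partial>M) / real T
      + ((\<integral>\<omega>. cross2 \<omega> \<partial>M) / rate + rate) + ((\<integral>\<omega>. noise2 \<omega> \<partial>M) / rate + rate) / 2"
    unfolding error_bound_def using hs(1) cr(1) no(1) B prob_space by simp
  also have "\<dots> \<le> (c_hs * rate + rate) / 2 + (C_r / 2 + c\<^sub>2 + (1 + m\<^sub>4)) * rate
      + (c\<^sub>2 * C * rate + rate) + (4 * C\<^sup>2 * rate + rate) / 2"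
  proof (intro add_mono divide_right_mono divide_rate_le EB order_refl)
    show "(\<integral>\<omega>. hs_dist2 T \<omega> \<partial>M) \<le> c_hs * rate\<^sup>2"
      using hs(2) mult_left_mono[OF rate(3) c_hs_nonneg] by simp
    show "(\<integral>\<omega>. cross2 \<omega> \<partial>M) \<le> c\<^sub>2 * C * rate\<^sup>2"
      using cr(2) mult_left_mono[OF rate(3) mult_nonneg_nonneg[OF c\<^sub>2_nonneg C_nonneg]] by simp
    show "(\<integral>\<omega>. noise2 \<omega> \<partial>M) \<le> 4 * C\<^sup>2 * rate\<^sup>2"
      using no(2) mult_left_mono[OF rate(2) zero_le_power2[of C]] mult_left_mono[OF rate(3) zero_le_power2[of C]] by simp
  qed (use c_hs_nonneg c\<^sub>2_nonneg C_nonneg in auto)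
  also have "\<dots> = error_const C C_r * rate" by (simp add: error_const_def algebra_simps add_divide_distrib)
  finally show "(\<integral>\<omega>. error_bound \<omega> \<partial>M) \<le> error_const C C_r * rate" .
qed

text \<open>A large estimation error forces \<open>error_bound\<close> to be at least
  \<open>c * rate\<close>, and Markov's inequality bounds the probability of that event. The
  constant in front of \<open>c\<close> is the one of \<open>estimator_error\<close>.\<close>

lemma estimator_deviation:
  assumes eigensystem: "eigensystem kernel lam phi" and l: "l \<ge> 1" "l \<le> p"
    and psi: "\<And>\<omega>. \<omega> \<in> space M \<Longrightarrow> unit_eigenvector (sample_cov T (data_matrix X T p U \<omega>)) l (\<psi> \<omega>)"
    and sign: "\<And>\<omega>. \<omega> \<in> space M \<Longrightarrow> L2_inner (phi l) (step_function p (\<psi> \<omega>)) \<ge> 0"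
    and "c > 0" and \<alpha>: "eigengap lam l > 0"
  shows "measure M {\<omega> \<in> space M. \<bar>L2_norm (\<lambda>s. phi l s - step_function p (\<psi> \<omega>) s)\<bar>
      > 2 * sqrt 2 / eigengap lam l * c * rate} \<le> error_const C C_r / c"
proof -
  note eb = error_bound_expectation
  have "{\<omega> \<in> space M. \<bar>L2_norm (\<lambda>s. phi l s - step_function p (\<psi> \<omega>) s)\<bar> > 2 * sqrt 2 / eigengap lam l * c * rate}
      \<subseteq> {\<omega> \<in> space M. c * rate \<le> error_bound \<omega>}"
  proof (intro subsetI CollectI conjI)
    fix \<omega> assume a: "\<omega> \<in> {\<omega> \<in> space M. \<bar>L2_norm (\<lambda>s. phi l s - step_function p (\<psi> \<omega>) s)\<bar>
        > 2 * sqrt 2 / eigengap lam l * c * rate}"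
    then show \<omega>: "\<omega> \<in> space M" by simp
    have Y: "data_matrix X T p U \<omega> \<in> carrier_mat p T" by (simp add: data_matrix_def)
    have "L2_norm (\<lambda>s. phi l s - step_function p (\<psi> \<omega>) s) \<le> 2 * sqrt 2 * error_bound \<omega> / eigengap lam l"
      by (rule K.estimator_error[OF eigensystem l(1) less_imp_neq[OF \<alpha>, symmetric] Y l(2) psi[OF \<omega>] sign[OF \<omega>]
            error_bound_form(2)[OF \<omega>] error_bound_form(1)[OF \<omega>]])
    moreover have "0 \<le> L2_norm (\<lambda>s. phi l s - step_function p (\<psi> \<omega>) s)" by (simp add: L2_norm_def)
    ultimately have "2 * sqrt 2 / eigengap lam l * (c * rate) < 2 * sqrt 2 / eigengap lam l * error_bound \<omega>"
      using a by simp
    then show "c * rate \<le> error_bound \<omega>" using \<alpha> by (subst (asm) mult_less_cancel_left_pos) auto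
  qed
  moreover have sets: "{\<omega> \<in> space M. c * rate \<le> error_bound \<omega>} \<in> events"
    using borel_measurable_integrable[OF eb(1)] by measurable
  ultimately have "measure M {\<omega> \<in> space M. \<bar>L2_norm (\<lambda>s. phi l s - step_function p (\<psi> \<omega>) s)\<bar>
      > 2 * sqrt 2 / eigengap lam l * c * rate} \<le> measure M {\<omega> \<in> space M. c * rate \<le> error_bound \<omega>}"
    by (rule finite_measure_mono)
  also have "\<dots> \<le> (\<integral>\<omega>. error_bound \<omega> \<partial>M) / (c * rate)"
    using \<open>c > 0\<close> rate(1) error_bound_form(2)
    by (intro integral_Markov_inequality_measure[of _ _ "{}"] eb(1)) auto
  also have "\<dots> \<le> error_const C C_r * rate / (c * rate)"
    using \<open>c > 0\<close> rate(1) by (intro divide_right_mono eb(2)) simp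
  also have "\<dots> = error_const C C_r / c" using rate(1) by simp
  finally show ?thesis .
qed

end

theorem theorem2:
  fixes M :: "'w measure"
    and X :: "nat \<Rightarrow> 'w \<Rightarrow> real \<Rightarrow> real"
    and S :: "'s measure" and eps :: "int \<Rightarrow> 'w \<Rightarrow> 's" and f :: "(nat \<Rightarrow> 's) \<Rightarrow> real \<Rightarrow> real"
    and p :: "nat \<Rightarrow> nat"
    and U :: "nat \<Rightarrow> nat \<Rightarrow> 'w \<Rightarrow> nat \<Rightarrow> real" and \<gamma> :: "nat \<Rightarrow> int \<Rightarrow> real"
    and C_U C_X :: real
    and lam :: "nat \<Rightarrow> real" and phi :: "nat \<Rightarrow> real \<Rightarrow> real"
    and l :: nat and psi :: "nat \<Rightarrow> 'w \<Rightarrow> real Matrix.vec"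
  assumes "prob_space M"
    and "\<And>t. t \<ge> 1 \<Longrightarrow> random_curve M (X t)"
    and "stationary_curves M X"
    and "filterlim p at_top sequentially"
    and noise: "\<And>T. T \<ge> 1 \<Longrightarrow> noise_cond M X T (p T) (U T) (\<gamma> T) C_U"
    and signal_a: "signal_cond_a M S eps f X"
    and signal_b: "signal_cond_b M X C_X"
    and regularity:
      "(\<lambda>h. SUP s \<in> {s. s \<in> {0..1} \<and> s + h \<in> {0..1}}. \<integral>\<omega>. \<bar>X 1 \<omega> (s + h) - X 1 \<omega> s\<bar>\<^sup>2 \<partial>M)
         \<in> O[at 0](\<lambda>h. h)"
    and "eigensystem (cov_kernel M (X 1)) lam phi"
    and "l \<ge> 1" and "eigengap lam l \<noteq> 0"
    and psi_random:
      "\<And>T i. T \<ge> 1 \<Longrightarrow> l \<le> p T \<Longrightarrow> i < p T \<Longrightarrow> (\<lambda>\<omega>. psi T \<omega> $ i) \<in> borel_measurable M"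
    and psi_eigenvector:
      "\<And>T \<omega>. T \<ge> 1 \<Longrightarrow> l \<le> p T \<Longrightarrow> \<omega> \<in> space M \<Longrightarrow>
         unit_eigenvector (sample_cov T (data_matrix X T (p T) (U T) \<omega>)) l (psi T \<omega>)"
    and psi_sign:
      "\<And>T \<omega>. T \<ge> 1 \<Longrightarrow> l \<le> p T \<Longrightarrow> \<omega> \<in> space M \<Longrightarrow>
         L2_inner (phi l) (step_function (p T) (psi T \<omega>)) \<ge> 0"
  shows "bigO_P M (\<lambda>T \<omega>. L2_norm (\<lambda>s. phi l s - step_function (p T) (psi T \<omega>) s))
           (\<lambda>T. 1 / sqrt (real (p T)) + 1 / sqrt (real T))"
proof -
  interpret prob_space M by (rule assms(1))
  interpret functional_signal M X S eps f C_X
    by unfold_locales (use assms in auto)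
  have es: "eigensystem kernel lam phi"
    using assms(9) unfolding kernel_def[abs_def] .
  let ?J = "\<lambda>h. {s. s \<in> {0..1} \<and> s + h \<in> {0..1}}"
  let ?inc = "\<lambda>s h. \<integral>\<omega>. \<bar>X 1 \<omega> (s + h) - X 1 \<omega> s\<bar>\<^sup>2 \<partial>M"
  obtain C_r where C_r: "C_r > 0"
    and ev: "\<forall>\<^sub>F h in at 0. norm (SUP s\<in>?J h. ?inc s h) \<le> C_r * norm (h :: real)"
    using regularity by (elim landau_o.bigE)
  from ev obtain h0 where h0: "h0 > 0"
    and sup_le: "\<And>h. h \<noteq> 0 \<Longrightarrow> \<bar>h\<bar> < h0 \<Longrightarrow> \<bar>SUP s\<in>?J h. ?inc s h\<bar> \<le> C_r * \<bar>h\<bar>"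
    unfolding eventually_at by (auto simp: dist_real_def)
  \<comment> \<open>Makes the set of increments bounded above. A supremum of an unbounded set of
    reals would say nothing about its members.\<close>
  have inc_le: "?inc s h \<le> 4 * c\<^sub>2" if "s \<in> ?J h" for s h
  proof -
    have sq: "integrable M (\<lambda>\<omega>. (X 1 \<omega> (s + h))\<^sup>2)" "integrable M (\<lambda>\<omega>. (X 1 \<omega> s)\<^sup>2)"
      "(\<integral>\<omega>. (X 1 \<omega> (s + h))\<^sup>2 \<partial>M) \<le> c\<^sub>2" "(\<integral>\<omega>. (X 1 \<omega> s)\<^sup>2 \<partial>M) \<le> c\<^sub>2"
      using that square_moment[of 1] by auto
    have "?inc s h \<le> (\<integral>\<omega>. 2 * (X 1 \<omega> (s + h))\<^sup>2 + 2 * (X 1 \<omega> s)\<^sup>2 \<partial>M)"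
    proof (rule integral_mono')
      show "integrable M (\<lambda>\<omega>. 2 * (X 1 \<omega> (s + h))\<^sup>2 + 2 * (X 1 \<omega> s)\<^sup>2)" using sq by simp
      have "\<bar>x - y\<bar>\<^sup>2 \<le> 2 * x\<^sup>2 + 2 * y\<^sup>2" for x y :: real
      proof -
        have "0 \<le> (x + y)\<^sup>2" by simp
        then show ?thesis unfolding power2_abs power2_diff power2_sum by simp
      qed
      then show "\<bar>X 1 \<omega> (s + h) - X 1 \<omega> s\<bar>\<^sup>2 \<le> 2 * (X 1 \<omega> (s + h))\<^sup>2 + 2 * (X 1 \<omega> s)\<^sup>2" for \<omega> .
    qed simp
    also have "\<dots> \<le> 4 * c\<^sub>2" using sq by simp
    finally show ?thesis .
  qed
  have inc: "(\<integral>\<omega>. (X 1 \<omega> (s + h) - X 1 \<omega> s)\<^sup>2 \<partial>M) \<le> C_r * h"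
    if "s \<in> {0..1}" "s + h \<in> {0..1}" "0 < h" "h < h0" for s h
  proof -
    have "?inc s h \<le> (SUP s\<in>?J h. ?inc s h)"
      using that by (intro cSUP_upper bdd_aboveI2[of _ _ "4 * c\<^sub>2"] inc_le) auto
    also have "\<dots> \<le> C_r * h" using sup_le[of h] that by simp
    finally show ?thesis by simp
  qed
  have "lam (l + 1) \<le> lam l" "l \<noteq> 1 \<Longrightarrow> lam l \<le> lam (l - 1)"
    using \<open>l \<ge> 1\<close> by (auto intro!: K.lam_decreasing[OF es])
  then have "0 \<le> eigengap lam l" by (cases "l = 1") (auto simp: eigengap_def)
  then have gap: "eigengap lam l > 0" using \<open>eigengap lam l \<noteq> 0\<close> by linarith
  \<comment> \<open>From some T on, p is at least l, so that an l-th eigenvalue exists, and exceeds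
    \<open>1 / h0\<close>, so that cells are shorter than the range of the regularity bound.\<close>
  have large: "\<forall>\<^sub>F T in sequentially. T \<ge> 1 \<and> max l (nat \<lceil>1 / h0\<rceil> + 1) \<le> p T"
    using assms(4) unfolding filterlim_at_top by (intro eventually_conj eventually_ge_at_top) blast
  show ?thesis unfolding bigO_P_def
  proof (intro allI impI)
    fix e :: real assume "e > 0"
    \<comment> \<open>Adding 1 keeps \<open>c\<close> positive and makes the quotient in
      \<open>small\<close> strictly less than \<open>e\<close>.\<close>
    define c where "c = (\<bar>error_const C_U C_r\<bar> + 1) / e"
    have c: "c > 0" using \<open>e > 0\<close> by (simp add: c_def add_nonneg_pos)
    have "error_const C_U C_r / c = error_const C_U C_r * e / (\<bar>error_const C_U C_r\<bar> + 1)"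
      by (simp add: c_def)
    also have "\<dots> < e"
      using \<open>e > 0\<close> by (subst pos_divide_less_eq) (auto simp: mult.commute add_nonneg_pos)
    finally have small: "error_const C_U C_r / c < e" .
    show "\<exists>C>0. \<forall>\<^sub>F T in sequentially. measure M {\<omega> \<in> space M.
        \<bar>L2_norm (\<lambda>s. phi l s - step_function (p T) (psi T \<omega>) s)\<bar>
        > C * (1 / sqrt (real (p T)) + 1 / sqrt (real T))} < e"
    proof (intro exI[of _ "2 * sqrt 2 / eigengap lam l * c"] conjI)
      show "0 < 2 * sqrt 2 / eigengap lam l * c" using gap c by simp
      show "\<forall>\<^sub>F T in sequentially. measure M {\<omega> \<in> space M.
        \<bar>L2_norm (\<lambda>s. phi l s - step_function (p T) (psi T \<omega>) s)\<bar>
        > 2 * sqrt 2 / eigengap lam l * c * (1 / sqrt (real (p T)) + 1 / sqrt (real T))} < e"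
        using large
      proof eventually_elim
        case (elim T)
        then have T: "T \<ge> 1" and l: "l \<le> p T" and pT: "nat \<lceil>1 / h0\<rceil> + 1 \<le> p T" by auto
        have "1 / h0 \<le> real (nat \<lceil>1 / h0\<rceil>)" by (rule real_nat_ceiling_ge)
        then have "1 / h0 < real (p T)" using pT by linarith
        then have ph: "1 / real (p T) < h0" using h0 pT by (simp add: field_simps)
        interpret N: noisy_sample M X S eps f C_X T "p T" "U T" "\<gamma> T" C_U C_r
        proof unfold_locales
          show "noise_cond M X T (p T) (U T) (\<gamma> T) C_U" by (rule noise[OF T])
          show "(\<integral>\<omega>. (X 1 \<omega> (s + h) - X 1 \<omega> s)\<^sup>2 \<partial>M) \<le> C_r * h"
            if "s \<in> {0..1}" "s + h \<in> {0..1}" "0 < h" "h < 1 / real (p T)" for s h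
            using that ph by (intro inc) auto
        qed (use T pT C_r in auto)
        have "measure M {\<omega> \<in> space M. \<bar>L2_norm (\<lambda>s. phi l s - step_function (p T) (psi T \<omega>) s)\<bar>
            > 2 * sqrt 2 / eigengap lam l * c * N.rate} \<le> error_const C_U C_r / c"
          by (rule N.estimator_deviation[OF es \<open>l \<ge> 1\<close> l
                psi_eigenvector[OF T l] psi_sign[OF T l] c gap])
        then show ?case using small unfolding N.rate_def by linarith
      qed
    qed
  qed
qed

end
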